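(* Let $1<\alpha<2$, $\frac12<\beta\le1$, $T>0$. Let $u_n$ be the solution of $\partial_t^\alpha u_n+(-\Delta)^\beta u_n=\frac{\partial^2W_n}{\partial t\partial x}$ on $(0,T)\times(0,1)$ with homogeneous Dirichlet boundary conditions, $u_n(0)=v_1$, $\partial_tu_n(0)=v_2$. Assume $|\sigma_k^n(t)|\le\mu_k^n$ for all $t\in[0,T]$ and all $k\ge1$, and that $v_1\in L^2(\Omega;\dot H^q)$, $v_2\in L^2(\Omega;\dot H^r)$ with $q,r\in[0,2\beta]$. Then, provided that the infinite series below are all convergent, there is a constant $C>0$ independent of $\Delta t$ such that for all $t\in(0,T]$ $$\mathbf{E}|u_n(t)|_{2\beta}^2\le Ct^{\frac{\alpha(q-2\beta)}{\beta}}\mathbf{E}|v_1|_q^2+Ct^{2-\frac{\alpha(2\beta-r)}{\beta}}\mathbf{E}|v_2|_r^2+Ct^\alpha\frac{1}{\Delta t}\sum_{k=1}^\infty\lambda_k^{\frac{\beta(\alpha+1)}{\alpha}}(\mu_k^n)^2,$$ and $$\mathbf{E}\|\partial_t^\alpha u_n(t)\|^2\le Ct^{\frac{\alpha(q-2\beta)}{\beta}}\mathbf{E}|v_1|_q^2+Ct^{2-\frac{\alpha(2\beta-r)}{\beta}}\mathbf{E}|v_2|_r^2+Ct^\alpha\frac{1}{\Delta t}\sum_{k=1}^\infty\lambda_k^{\frac{\beta(\alpha+1)}{\alpha}}(\mu_k^n)^2+C\frac{1}{\Delta t}\sum_{k=1}^\infty(\mu_k^n)^2.$$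
   Context: $H=L^2(0,1)$ with inner product $(\cdot,\cdot)$ and norm $\|\cdot\|$. $\lambda_k=k^2\pi^2$, $e_k(x)=\sqrt2\sin(k\pi x)$, $k\ge1$ (Dirichlet eigenpairs of $-\Delta$ on $(0,1)$). For $q\ge0$, $\dot H^q\subset H$ is the Hilbert space with norm $|u|_q^2=\sum_k\lambda_k^q(u,e_k)^2$; $(-\Delta)^\beta u=\sum_k\lambda_k^\beta(u,e_k)e_k$. $L^2(\Omega;\dot H^q)$ is the space of square-integrable $\dot H^q$-valued random variables. $E_{a,b}(z)=\sum_{k\ge0}\frac{z^k}{\Gamma(ak+b)}$ is the Mittag-Leffler function. Noise: on a complete filtered probability space, $\xi_k$ ($k\ge1$) are standard real Wiener processes. Let $t_i=(i-1)\Delta t$, $i=1,\dots,I+1$, $\Delta t=T/I$; $\chi_i$ is the characteristic function of the $i$th subinterval $[t_i,t_{i+1})$, $\xi_{ki}=\frac{1}{\sqrt{\Delta t}}(\xi_k(t_{i+1})-\xi_k(t_i))$; $\sigma_k^n$ are deterministic continuous functions on $[0,T]$, and $$\frac{\partial^2W_n}{\partial t\partial x}(t,x)=\sum_{k=1}^\infty\sigma_k^n(t)e_k(x)\sum_{i=1}^I\frac{1}{\sqrt{\Delta t}}\xi_{ki}\chi_i(t).$$ The solution $u_n$ is the mild solution $$u_n(t)=\sum_{k=1}^\infty\Big[E_{\alpha,1}(-\lambda_k^\beta t^\alpha)(v_1,e_k)+tE_{\alpha,2}(-\lambda_k^\beta t^\alpha)(v_2,e_k)+\int_0^t(t-s)^{\alpha-1}E_{\alpha,\alpha}(-\lambda_k^\beta(t-s)^\alpha)\sigma_k^n(s)\sum_{i=1}^I\tfrac{1}{\sqrt{\Delta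 t}}\xi_{ki}\chi_i(s)\,ds\Big]e_k.$$ $\partial_t^\alpha$ is the left-sided Caputo derivative of order $\alpha$ in time; for the mild solution, $\partial_t^\alpha u_n(t)$ is understood through the equation, i.e. $\partial_t^\alpha u_n(t)=-(-\Delta)^\beta u_n(t)+\frac{\partial^2W_n}{\partial t\partial x}(t,\cdot)$. The constant $C$ may depend on $\alpha,\beta,q,r,T$. *)

theory Defs
  imports "HOL-Probability.Probability"
begin

section \<open>The Hilbert space \<open>H = L\<^sup>2(0,1)\<close>\<close>

abbreviation unit_interval_measure :: "real measure" where
  "unit_interval_measure \<equiv> lebesgue_on {0<..<1}"

definition square_integrable01 :: "(real \<Rightarrow> real) \<Rightarrow> bool" where
  "square_integrable01 f \<longleftrightarrow> f \<in> borel_measurable unit_interval_measure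
     \<and> integrable unit_interval_measure (\<lambda>x. (f x)\<^sup>2)"

definition L2_rel :: "(real \<Rightarrow> real) \<Rightarrow> (real \<Rightarrow> real) \<Rightarrow> bool" where
  "L2_rel f g \<longleftrightarrow> square_integrable01 f \<and> square_integrable01 g
     \<and> (AE x in unit_interval_measure. f x = g x)"

lemma square_integrable01_zero: "square_integrable01 (\<lambda>x. 0)"
  by (simp add: square_integrable01_def)

quotient_type L2 = "real \<Rightarrow> real" / partial: L2_rel
proof (rule part_equivpI)
  show "\<exists>f. L2_rel f f"
    using square_integrable01_zero by (auto simp: L2_rel_def)
  show "symp L2_rel"
    by (rule sympI) (auto simp: L2_rel_def)
  show "transp L2_rel"
    by (rule transpI) (auto simp: L2_rel_def)
qed

lemma square_integrable01_scale:
  "square_integrable01 f \<Longrightarrow> square_integrable01 (\<lambda>x. c * f x)"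
  by (auto simp: square_integrable01_def power_mult_distrib)

lemma square_integrable01_mult:
  assumes "square_integrable01 f" "square_integrable01 g"
  shows "integrable unit_interval_measure (\<lambda>x. f x * g x)"
proof (rule Bochner_Integration.integrable_bound)
  show "integrable unit_interval_measure (\<lambda>x. (f x)\<^sup>2 + (g x)\<^sup>2)"
    using assms by (simp add: square_integrable01_def)
  show "(\<lambda>x. f x * g x) \<in> borel_measurable unit_interval_measure"
    using assms by (auto simp: square_integrable01_def)
  have "\<bar>a * b\<bar> \<le> a\<^sup>2 + b\<^sup>2" for a b :: real
  proof -
    have "0 \<le> (\<bar>a\<bar> - \<bar>b\<bar>)\<^sup>2" "0 \<le> \<bar>a\<bar> * \<bar>b\<bar>"
      by simp_all
    then show ?thesis
      unfolding abs_mult power2_diff power2_abs by linarith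
  qed
  then show "AE x in unit_interval_measure. norm (f x * g x) \<le> norm ((f x)\<^sup>2 + (g x)\<^sup>2)"
    by (intro AE_I2) simp
qed

lemma square_integrable01_add:
  assumes "square_integrable01 f" "square_integrable01 g"
  shows "square_integrable01 (\<lambda>x. f x + g x)"
proof -
  have "integrable unit_interval_measure (\<lambda>x. (f x)\<^sup>2 + (g x)\<^sup>2 + 2 * (f x * g x))"
    using assms square_integrable01_mult[OF assms] by (simp add: square_integrable01_def)
  then show ?thesis
    using assms by (auto simp: square_integrable01_def power2_sum mult.assoc)
qed

instantiation L2 :: real_vector
begin

lift_definition zero_L2 :: L2 is "\<lambda>x. 0"
  using square_integrable01_zero by (simp add: L2_rel_def)

lift_definition plus_L2 :: "L2 \<Rightarrow> L2 \<Rightarrow> L2" is "\<lambda>f g x. f x + g x"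
  by (auto simp: L2_rel_def intro: square_integrable01_add)

lift_definition uminus_L2 :: "L2 \<Rightarrow> L2" is "\<lambda>f x. - f x"
  using square_integrable01_scale[where c = "-1"] by (auto simp: L2_rel_def)

lift_definition scaleR_L2 :: "real \<Rightarrow> L2 \<Rightarrow> L2" is "\<lambda>c f x. c * f x"
  by (auto simp: L2_rel_def intro: square_integrable01_scale)

definition minus_L2 :: "L2 \<Rightarrow> L2 \<Rightarrow> L2" where
  "minus_L2 u v = u + - v"

instance
proof
  fix u v w :: L2 and a b :: real
  show "u + v + w = u + (v + w)"
    by transfer (auto simp: L2_rel_def algebra_simps intro!: square_integrable01_add)
  show "u + v = v + u"
    by transfer (auto simp: L2_rel_def algebra_simps intro!: square_integrable01_add)
  show "0 + u = u"
    by transfer (auto simp: L2_rel_def)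
  show "- u + u = 0"
    by transfer (auto simp: L2_rel_def square_integrable01_zero)
  show "u - v = u + - v"
    by (rule minus_L2_def)
  show "a *\<^sub>R (u + v) = a *\<^sub>R u + a *\<^sub>R v"
    by transfer
      (auto simp: L2_rel_def distrib_left
        intro!: square_integrable01_add square_integrable01_scale
          square_integrable01_add[of "\<lambda>x. a * _ x" "\<lambda>x. a * _ x"])
  show "(a + b) *\<^sub>R u = a *\<^sub>R u + b *\<^sub>R u"
    by transfer
      (auto simp: L2_rel_def distrib_right
        intro!: square_integrable01_add square_integrable01_scale)
  show "a *\<^sub>R b *\<^sub>R u = (a * b) *\<^sub>R u"
    by transfer (auto simp: L2_rel_def mult.assoc intro: square_integrable01_scale
        dest: square_integrable01_scale[where c = "a * b"])
  show "1 *\<^sub>R u = u"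
    by transfer (auto simp: L2_rel_def)
qed

end

instantiation L2 :: real_inner
begin

lift_definition inner_L2 :: "L2 \<Rightarrow> L2 \<Rightarrow> real"
  is "\<lambda>f g. \<integral>x. f x * g x \<partial>unit_interval_measure"
proof -
  fix f f' g g'
  assume "L2_rel f f'" "L2_rel g g'"
  then show "(\<integral>x. f x * g x \<partial>unit_interval_measure) = (\<integral>x. f' x * g' x \<partial>unit_interval_measure)"
    by (intro integral_cong_AE) (auto simp: L2_rel_def square_integrable01_def)
qed

definition norm_L2 :: "L2 \<Rightarrow> real" where
  "norm_L2 u = sqrt (inner u u)"

definition sgn_L2 :: "L2 \<Rightarrow> L2" where
  "sgn_L2 u = u /\<^sub>R norm u"

definition dist_L2 :: "L2 \<Rightarrow> L2 \<Rightarrow> real" where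
  "dist_L2 u v = norm (u - v)"

definition uniformity_L2 :: "(L2 \<times> L2) filter" where
  "uniformity_L2 = (INF \<epsilon>\<in>{0<..}. principal {(u, v). dist u v < \<epsilon>})"

definition open_L2 :: "L2 set \<Rightarrow> bool" where
  "open_L2 U \<longleftrightarrow> (\<forall>u\<in>U. eventually (\<lambda>(u', v). u' = u \<longrightarrow> v \<in> U) uniformity)"

instance
proof
  fix u v w :: L2 and a :: real
  show "inner u v = inner v u"
    by transfer (simp add: mult.commute)
  show "inner (u + v) w = inner u w + inner v w"
    by transfer (simp add: L2_rel_def distrib_right square_integrable01_mult)
  show "inner (a *\<^sub>R u) v = a * inner u v"
    by transfer (simp add: L2_rel_def mult.assoc)
  show "0 \<le> inner u u"
    by transfer simp
  show "inner u u = 0 \<longleftrightarrow> u = 0"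
  proof transfer
    fix f
    assume f: "L2_rel f f"
    then have "integrable unit_interval_measure (\<lambda>x. f x * f x)"
      by (simp add: L2_rel_def square_integrable01_mult)
    then show "(\<integral>x. f x * f x \<partial>unit_interval_measure) = 0 \<longleftrightarrow> L2_rel f (\<lambda>x. 0)"
      using f by (subst integral_nonneg_eq_0_iff_AE)
        (auto simp: L2_rel_def square_integrable01_zero)
  qed
qed (rule norm_L2_def sgn_L2_def dist_L2_def uniformity_L2_def open_L2_def)+

end

section \<open>Dirichlet eigenpairs and the spaces of order \<open>q\<close>\<close>

text \<open>Eigenpairs are numbered from \<open>1\<close>, so series over \<open>k \<ge> 1\<close> are written with \<open>Suc k\<close>.\<close>

definition eigenval :: "nat \<Rightarrow> real" where
  "eigenval k = (real k)\<^sup>2 * pi\<^sup>2"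

lemma square_integrable01_sin: "square_integrable01 (\<lambda>x. sqrt 2 * sin (real k * pi * x))"
proof -
  have m: "(\<lambda>x. sqrt 2 * sin (real k * pi * x)) \<in> borel_measurable unit_interval_measure"
    by (rule continuous_imp_measurable_on_sets_lebesgue) (auto intro!: continuous_intros)
  have "integrable unit_interval_measure (\<lambda>x. (sqrt 2 * sin (real k * pi * x))\<^sup>2)"
  proof (rule Bochner_Integration.integrable_bound[where f = "\<lambda>x. 2 :: real"])
    show "integrable unit_interval_measure (\<lambda>x. 2 :: real)"
      by (rule finite_measure.integrable_const) (simp add: finite_measure_lebesgue_on)
    show "(\<lambda>x. (sqrt 2 * sin (real k * pi * x))\<^sup>2) \<in> borel_measurable unit_interval_measure"
      using m by (rule borel_measurable_power)
    show "AE x in unit_interval_measure. norm ((sqrt 2 * sin (real k * pi * x))\<^sup>2) \<le> norm (2 :: real)"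
      by (intro AE_I2) (simp add: power_mult_distrib abs_square_le_1)
  qed
  with m show ?thesis
    by (simp add: square_integrable01_def)
qed

lift_definition eigenfun :: "nat \<Rightarrow> L2" is "\<lambda>k x. sqrt 2 * sin (real k * pi * x)"
  by (simp add: L2_rel_def square_integrable01_sin)

text \<open>The squared norm \<open>|u|\<^sub>q\<^sup>2\<close>, with value \<open>\<infinity>\<close> when \<open>u\<close> lies outside the space.\<close>

definition dotH_normsq :: "real \<Rightarrow> L2 \<Rightarrow> ennreal" where
  "dotH_normsq q u = (\<Sum>k. ennreal (eigenval (Suc k) powr q * (inner u (eigenfun (Suc k)))\<^sup>2))"

definition dotH :: "real \<Rightarrow> L2 set" where
  "dotH q = {u. dotH_normsq q u < \<infinity>}"

text \<open>The Borel \<open>\<sigma>\<close>-algebra of the norm topology of the space of order \<open>q\<close>.\<close>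

definition dotH_borel :: "real \<Rightarrow> L2 measure" where
  "dotH_borel q = sigma (dotH q)
     {U. U \<subseteq> dotH q \<and>
         (\<forall>u\<in>U. \<exists>\<epsilon>>0. \<forall>w\<in>dotH q. dotH_normsq q (w - u) < ennreal (\<epsilon>\<^sup>2) \<longrightarrow> w \<in> U)}"

definition L2_rv_dotH :: "'w measure \<Rightarrow> real \<Rightarrow> ('w \<Rightarrow> L2) set" where
  "L2_rv_dotH M q = {v. v \<in> measurable M (dotH_borel q) \<and> (\<integral>\<^sup>+\<omega>. dotH_normsq q (v \<omega>) \<partial>M) < \<infinity>}"

definition frac_laplacian :: "real \<Rightarrow> L2 \<Rightarrow> L2" where
  "frac_laplacian \<beta> u =
     (\<Sum>k. (eigenval (Suc k) powr \<beta> * inner u (eigenfun (Suc k))) *\<^sub>R eigenfun (Suc k))"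

definition mittag_leffler :: "real \<Rightarrow> real \<Rightarrow> real \<Rightarrow> real" where
  "mittag_leffler a b z = (\<Sum>k. z ^ k / Gamma (a * real k + b))"

section \<open>Noise\<close>

definition complete_filtered_prob_space :: "'w measure \<Rightarrow> (real \<Rightarrow> 'w measure) \<Rightarrow> bool" where
  "complete_filtered_prob_space M F \<longleftrightarrow>
     prob_space M \<and> complete_measure M \<and>
     (\<forall>t\<ge>0. subalgebra M (F t) \<and> null_sets M \<subseteq> sets (F t)) \<and>
     (\<forall>s t. 0 \<le> s \<and> s \<le> t \<longrightarrow> sets (F s) \<subseteq> sets (F t))"

definition standard_wiener ::
  "'w measure \<Rightarrow> (real \<Rightarrow> 'w measure) \<Rightarrow> (real \<Rightarrow> 'w \<Rightarrow> real) \<Rightarrow> bool" where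
  "standard_wiener M F W \<longleftrightarrow>
     (\<forall>t\<ge>0. W t \<in> borel_measurable (F t)) \<and>
     (AE \<omega> in M. W 0 \<omega> = 0) \<and>
     (AE \<omega> in M. continuous_on {0..} (\<lambda>t. W t \<omega>)) \<and>
     (\<forall>s t. 0 \<le> s \<and> s < t \<longrightarrow>
        distributed M lborel (\<lambda>\<omega>. W t \<omega> - W s \<omega>) (normal_density 0 (sqrt (t - s))) \<and>
        prob_space.indep_set M (sets (F s))
          {(\<lambda>\<omega>. W t \<omega> - W s \<omega>) -` A \<inter> space M | A. A \<in> sets borel})"

definition grid_point :: "real \<Rightarrow> nat \<Rightarrow> real" where
  "grid_point \<Delta>t i = (real i - 1) * \<Delta>t"

text \<open>The increment is normalised to unit variance by one factor \<open>1 / sqrt \<Delta>t\<close>; the discretised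
  white noise carries a second such factor, see \<open>step_noise\<close>.\<close>

definition normalised_increment ::
  "(nat \<Rightarrow> real \<Rightarrow> 'w \<Rightarrow> real) \<Rightarrow> real \<Rightarrow> nat \<Rightarrow> nat \<Rightarrow> 'w \<Rightarrow> real" where
  "normalised_increment \<xi> \<Delta>t k i \<omega> =
     1 / sqrt \<Delta>t * (\<xi> k (grid_point \<Delta>t (i + 1)) \<omega> - \<xi> k (grid_point \<Delta>t i) \<omega>)"

definition step_noise ::
  "(nat \<Rightarrow> real \<Rightarrow> 'w \<Rightarrow> real) \<Rightarrow> real \<Rightarrow> nat \<Rightarrow> nat \<Rightarrow> real \<Rightarrow> 'w \<Rightarrow> real" where
  "step_noise \<xi> \<Delta>t I k t \<omega> =
     (\<Sum>i=1..I. 1 / sqrt \<Delta>t * normalised_increment \<xi> \<Delta>t k i \<omega>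
        * indicator {grid_point \<Delta>t i..<grid_point \<Delta>t (i + 1)} t)"

text \<open>The noise \<open>\<partial>\<^sup>2W\<^sub>n/\<partial>t\<partial>x\<close> at time \<open>t\<close>, as an element of \<open>H\<close>; \<open>T / I\<close> is the step size.\<close>

definition noise ::
  "real \<Rightarrow> nat \<Rightarrow> (nat \<Rightarrow> real \<Rightarrow> real) \<Rightarrow> (nat \<Rightarrow> real \<Rightarrow> 'w \<Rightarrow> real) \<Rightarrow> real \<Rightarrow> 'w \<Rightarrow> L2" where
  "noise T I \<sigma> \<xi> t \<omega> =
     (\<Sum>k. (\<sigma> (Suc k) t * step_noise \<xi> (T / real I) I (Suc k) t \<omega>) *\<^sub>R eigenfun (Suc k))"

section \<open>The mild solution\<close>

definition mild_coeff ::
  "real \<Rightarrow> real \<Rightarrow> real \<Rightarrow> nat \<Rightarrow> (nat \<Rightarrow> real \<Rightarrow> real) \<Rightarrow> (nat \<Rightarrow> real \<Rightarrow> 'w \<Rightarrow> real) \<Rightarrow>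
    ('w \<Rightarrow> L2) \<Rightarrow> ('w \<Rightarrow> L2) \<Rightarrow> nat \<Rightarrow> real \<Rightarrow> 'w \<Rightarrow> real" where
  "mild_coeff \<alpha> \<beta> T I \<sigma> \<xi> v1 v2 k t \<omega> =
     mittag_leffler \<alpha> 1 (- (eigenval k powr \<beta>) * t powr \<alpha>) * inner (v1 \<omega>) (eigenfun k)
     + t * mittag_leffler \<alpha> 2 (- (eigenval k powr \<beta>) * t powr \<alpha>) * inner (v2 \<omega>) (eigenfun k)
     + (LBINT s:{0..t}. (t - s) powr (\<alpha> - 1)
          * mittag_leffler \<alpha> \<alpha> (- (eigenval k powr \<beta>) * (t - s) powr \<alpha>)
          * \<sigma> k s * step_noise \<xi> (T / real I) I k s \<omega>)"

definition mild_solution ::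
  "real \<Rightarrow> real \<Rightarrow> real \<Rightarrow> nat \<Rightarrow> (nat \<Rightarrow> real \<Rightarrow> real) \<Rightarrow> (nat \<Rightarrow> real \<Rightarrow> 'w \<Rightarrow> real) \<Rightarrow>
    ('w \<Rightarrow> L2) \<Rightarrow> ('w \<Rightarrow> L2) \<Rightarrow> real \<Rightarrow> 'w \<Rightarrow> L2" where
  "mild_solution \<alpha> \<beta> T I \<sigma> \<xi> v1 v2 t \<omega> =
     (\<Sum>k. mild_coeff \<alpha> \<beta> T I \<sigma> \<xi> v1 v2 (Suc k) t \<omega> *\<^sub>R eigenfun (Suc k))"

text \<open>The Caputo derivative of the mild solution is understood through the equation.\<close>

definition caputo_mild_solution ::
  "real \<Rightarrow> real \<Rightarrow> real \<Rightarrow> nat \<Rightarrow> (nat \<Rightarrow> real \<Rightarrow> real) \<Rightarrow> (nat \<Rightarrow> real \<Rightarrow> 'w \<Rightarrow> real) \<Rightarrow>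
    ('w \<Rightarrow> L2) \<Rightarrow> ('w \<Rightarrow> L2) \<Rightarrow> real \<Rightarrow> 'w \<Rightarrow> L2" where
  "caputo_mild_solution \<alpha> \<beta> T I \<sigma> \<xi> v1 v2 t \<omega> =
     - frac_laplacian \<beta> (mild_solution \<alpha> \<beta> T I \<sigma> \<xi> v1 v2 t \<omega>) + noise T I \<sigma> \<xi> t \<omega>"

end

theory Submission
  imports Defs "HOL-Complex_Analysis.Complex_Analysis" "HOL-Real_Asymp.Real_Asymp"
begin

text \<open>In eigenfunction coordinates everything reduces to the bound
  \<open>\<bar>E\<^sub>a\<^sub>,\<^sub>b (- x)\<bar> \<le> D / (1 + x)\<close> for \<open>1 < a < 2\<close> and \<open>1 \<le> b \<le> 2\<close>. To prove it,
  let \<open>g t\<close> be the contour integral of \<open>exp (t z) z\<^sup>a\<^sup>-\<^sup>b / (z\<^sup>a + 1)\<close> over two conjugate rays in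
  the left half-plane. By the residue theorem \<open>g\<close> has the Laplace transform
  \<open>p\<^sup>a\<^sup>-\<^sup>b / (p\<^sup>a + 1)\<close>, and so has \<open>t\<^sup>b\<^sup>-\<^sup>1 E\<^sub>a\<^sub>,\<^sub>b (- t\<^sup>a)\<close>, term by term; hence the two agree,
  and on the rays the integrand decays fast enough to give \<open>\<bar>g t\<bar> \<le> C t\<^sup>b\<^sup>-\<^sup>1\<^sup>-\<^sup>a\<close>.

  With \<open>x = \<lambda>\<^sub>k\<^sup>\<beta> t\<^sup>\<alpha>\<close>, the bound trades powers of \<open>\<lambda>\<^sub>k\<close> for powers of \<open>t\<close>, since
  \<open>x\<^sup>\<theta> \<le> (1 + x)\<^sup>2\<close> for \<open>0 \<le> \<theta> \<le> 2\<close>; for the convolution kernel one takes the exponent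
  \<open>(\<alpha> - 1) / (2 \<alpha>)\<close>. The noise is then controlled pathwise by the Cauchy-Schwarz inequality on
  the time grid, which needs only the second moments of the increments, and the surplus factor
  \<open>t\<close> it produces is at most \<open>T\<close>. Finite expectations make the coefficient series converge almost
  surely, and completeness of \<open>L\<^sup>2(0,1)\<close> turns them into elements with these coefficients.\<close>

section \<open>Laplace transforms and the Mittag-Leffler series\<close>

text \<open>The obstacle is decay. At \<open>- x\<close> the Mittag-Leffler series alternates with
  huge terms that cancel, so its coefficients show no bound like \<open>1 / x\<close>; the contour
  supplies one. Working with \<open>w = ln z\<close> keeps the contour argument elementary: rays
  become horizontal lines, powers of \<open>z\<close> become exponentials without branch cuts,
  dilations become translations, and the truncated contour is a rectangle. The lines may run to Re w
  = -infinity, that is, the rays reach the origin without a small arc, because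
  \<open>a - b + 1 > 0\<close>. Uniqueness of Laplace transforms then replaces an inversion formula.

  In the noise term the exponent \<open>(\<alpha> - 1) / (2 * \<alpha>)\<close> is dictated by the
  target: squaring the kernel bound and multiplying by the eigenvalue to the power
  \<open>2 * \<beta>\<close> must produce the power
  \<open>\<beta> * (\<alpha> + 1) / \<alpha>\<close>. The kernel keeps the time power
  \<open>(\<alpha> - 1) / 2\<close>, which is positive, so it is bounded on the whole interval and
  no singular time integral has to be estimated.\<close>

lemma has_bochner_integral_Gamma:
  fixes z p :: real
  assumes "0 < z" "0 < p"
  shows "has_bochner_integral lborel (\<lambda>t. indicator {0<..} t * (t powr (z - 1) * exp (- p * t)))
    (Gamma z / p powr z)"
proof -
  have "has_bochner_integral lborel (\<lambda>t. indicator {0..} t * t powr (z - 1) / exp t) (Gamma z)"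
    by (rule has_bochner_integral_nn_integral)
      (use assms in \<open>auto simp: Gamma_conv_nn_integral_real intro!: AE_I2\<close>)
  then have "has_bochner_integral lborel
      (\<lambda>t. indicator {0..} (0 + p * t) * (0 + p * t) powr (z - 1) / exp (0 + p * t))
      (Gamma z /\<^sub>R \<bar>p\<bar>)"
    by (subst lborel_has_bochner_integral_real_affine_iff [symmetric]) (use assms in auto)
  \<comment> \<open>The prefactor cancels the power of \<open>p\<close> that the substitution leaves
    in the integrand.\<close>
  then have "has_bochner_integral lborel
      (\<lambda>t. p powr (1 - z) * (indicator {0..} (0 + p * t) * (0 + p * t) powr (z - 1) / exp (0 + p * t)))
      (p powr (1 - z) * (Gamma z /\<^sub>R \<bar>p\<bar>))"
    by (rule has_bochner_integral_mult_right[rotated]) 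
  also have "p powr (1 - z) * (Gamma z /\<^sub>R \<bar>p\<bar>) = Gamma z / p powr z"
    using assms by (simp add: powr_diff divide_simps)
  also have "(\<lambda>t. p powr (1 - z) * (indicator {0..} (0 + p * t) * (0 + p * t) powr (z - 1) / exp (0 + p * t)))
     = (\<lambda>t. indicator {0<..} t * (t powr (z - 1) * exp (- p * t)))"
  proof
    fix t
    show "p powr (1 - z) * (indicator {0..} (0 + p * t) * (0 + p * t) powr (z - 1) / exp (0 + p * t))
     = indicator {0<..} t * (t powr (z - 1) * exp (- p * t))"
    proof (cases "t > 0")
      case True
      have "p powr (1 - z) * p powr (z - 1) = 1"
        using assms by (simp add: powr_add [symmetric])
      with True assms show ?thesis
        by (simp add: powr_mult exp_minus field_simps)
    next
      case False
      then consider "t = 0" | "t < 0"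
        by linarith
      then show ?thesis
      proof cases
        \<comment> \<open>Since \<open>0 powr (z - 1) = 0\<close> for every \<open>z\<close>,
          including \<open>z = 1\<close>, the closed and the open half-line give the same
          integrand.\<close>
        case 1
        then show ?thesis
          using assms by simp
      next
        case 2
        then have "\<not> 0 \<le> p * t"
          using assms by (simp add: zero_le_mult_iff)
        with 2 show ?thesis
          by simp
      qed
    qed
  qed
  finally show ?thesis .
qed

text \<open>Only the part of Euler's integral over \<open>{x..x+1}\<close> is kept; there the
  integrand is at least the left-hand side. Since \<open>x\<close> is free, \<open>Gamma\<close>
  outgrows every geometric sequence.\<close>

lemma Gamma_ge_powr:
  fixes z x :: real
  assumes "1 \<le> z" "0 < x"
  shows "x powr (z - 1) * exp (- x - 1) \<le> Gamma z"
proof -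
  have G: "has_bochner_integral lborel (\<lambda>t. indicator {0<..} t * (t powr (z - 1) * exp (- t))) (Gamma z)"
    using has_bochner_integral_Gamma[of z 1] assms by simp
  have "x powr (z - 1) * exp (- x - 1) = (LINT t|lborel. indicator {x..x+1} t * (x powr (z - 1) * exp (- x - 1)))"
    by simp
  also have "\<dots> \<le> (LINT t|lborel. indicator {0<..} t * (t powr (z - 1) * exp (- t)))"
  proof (rule integral_mono)
    show "integrable lborel (\<lambda>t. indicator {0<..} t * (t powr (z - 1) * exp (- t)))"
      using G by (simp add: has_bochner_integral_iff)
    show "indicator {x..x+1} t * (x powr (z - 1) * exp (- x - 1))
        \<le> indicator {0<..} t * (t powr (z - 1) * exp (- t))" for t
      using assms by (auto simp: indicator_def intro!: mult_mono powr_mono2)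
  qed simp
  also have "\<dots> = Gamma z"
    using G by (simp add: has_bochner_integral_iff)
  finally show ?thesis .
qed

lemma summable_mittag_leffler:
  assumes "1 \<le> a" "1 \<le> b"
  shows "summable (\<lambda>k. 1 / Gamma (a * real k + b) * z ^ k :: real)"
proof (rule summable_comparison_test')
  \<comment> \<open>With \<open>x := R\<close> the Gamma bound leaves terms of size
    \<open>(\<bar>z\<bar> / R) ^ k\<close>. This choice makes the ratio less than 1 and keeps
    \<open>R \<ge> 1\<close>, so that the exponent \<open>a * k + b - 1\<close> may be lowered to
    \<open>k\<close>.\<close>
  define R where "R = 2 * (\<bar>z\<bar> + 1)"
  have R: "R \<ge> 1" "R > 0" and q: "\<bar>z\<bar> / R < 1"
    by (auto simp: R_def field_simps)
  show "summable (\<lambda>k. exp (R + 1) * (\<bar>z\<bar> / R) ^ k)"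
    using q R by (intro summable_mult summable_geometric) simp
  fix k :: nat
  have ab: "1 \<le> a * real k + b" "real k \<le> a * real k + b - 1"
    using assms mult_right_mono[of 1 a "real k"] by auto
  have "R ^ k * exp (- R - 1) \<le> R powr (a * real k + b - 1) * exp (- R - 1)"
    using R ab powr_mono[of "real k" "a * real k + b - 1" R] by (simp add: powr_realpow)
  also have "\<dots> \<le> Gamma (a * real k + b)"
    using ab R by (intro Gamma_ge_powr)
  finally have *: "R ^ k * exp (- R - 1) \<le> Gamma (a * real k + b)" .
  have "1 / Gamma (a * real k + b) \<le> 1 / (R ^ k * exp (- R - 1))"
    using * R less_le_trans[OF _ *, of 0] by (intro divide_left_mono mult_pos_pos) auto
  also have "\<dots> = exp (R + 1) / R ^ k"
    by (simp add: exp_diff exp_add exp_minus divide_simps)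
  finally have "1 / Gamma (a * real k + b) * \<bar>z\<bar> ^ k \<le> exp (R + 1) / R ^ k * \<bar>z\<bar> ^ k"
    by (intro mult_right_mono) auto
  moreover have "0 < Gamma (a * real k + b)"
    using ab by (intro Gamma_real_pos) linarith
  ultimately show "norm (1 / Gamma (a * real k + b) * z ^ k) \<le> exp (R + 1) * (\<bar>z\<bar> / R) ^ k"
    by (simp add: abs_mult power_abs power_divide)
qed

lemma continuous_on_mittag_leffler:
  assumes "1 \<le> a" "1 \<le> b"
  shows "continuous_on A (mittag_leffler a b)"
proof -
  have "isCont (\<lambda>x. \<Sum>k. 1 / Gamma (a * real k + b) * x ^ k) x" for x :: real
    by (rule isCont_powser[OF summable_mittag_leffler[OF assms, of "\<bar>x\<bar> + 1"]]) simp
  then show ?thesis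
    by (auto intro!: continuous_at_imp_continuous_on simp: mittag_leffler_def [abs_def])
qed

text \<open>Termwise the Gamma factors cancel and leave a geometric series of ratio
  \<open>- (p powr (- a))\<close>. The assumption \<open>1 < p\<close> makes it absolutely
  convergent, which justifies exchanging sum and integral.\<close>

lemma has_bochner_integral_laplace_mittag_leffler:
  fixes a b p :: real
  assumes "1 < a" "1 \<le> b" "1 < p"
  shows "has_bochner_integral lborel
    (\<lambda>t. indicator {0<..} t * (exp (- p * t) * (t powr (b - 1) * mittag_leffler a b (- (t powr a)))))
    (p powr (a - b) / (p powr a + 1))"
proof -
  define f where "f n t = (- 1) ^ n / Gamma (a * real n + b) *
     (indicator {0<..} t * (t powr (a * real n + b - 1) * exp (- p * t)))" for n :: nat and t :: real
  have pos: "0 < a * real n + b" for n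
    using assms by (intro add_nonneg_pos) auto
  have Gpos: "0 < Gamma (a * real n + b)" for n
    using pos by (rule Gamma_real_pos)
  have pa: "p powr (-a) < 1"
    using assms powr_less_mono2_neg[of "-a" 1 p] by simp
  have pw: "1 / p powr (a * real n + b) = p powr (-b) * (p powr (-a)) ^ n" for n
    using assms by (simp add: powr_add powr_minus powr_powr[symmetric] powr_realpow field_simps power_divide
        flip: powr_realpow)
  have f: "has_bochner_integral lborel (f n) (p powr (-b) * (- (p powr (-a))) ^ n)" for n
  proof -
    have "has_bochner_integral lborel (f n) ((- 1) ^ n / Gamma (a * real n + b) *
        (Gamma (a * real n + b) / p powr (a * real n + b)))"
      unfolding f_def
      by (intro has_bochner_integral_mult_right impI has_bochner_integral_Gamma) (use assms pos in auto)
    also have "(- 1) ^ n / Gamma (a * real n + b) * (Gamma (a * real n + b) / p powr (a * real n + b))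
        = (-1) ^ n * (1 / p powr (a * real n + b))"
      using Gpos[of n] by simp
    also have "\<dots> = p powr (-b) * (- (p powr (-a))) ^ n"
      unfolding pw power_minus[of "p powr (-a)"] by simp
    finally show ?thesis .
  qed
  have nf: "norm (f n t) = 1 / Gamma (a * real n + b) *
     (indicator {0<..} t * (t powr (a * real n + b - 1) * exp (- p * t)))" for n t
    using Gpos[of n] by (simp add: f_def abs_mult power_abs)
  have "has_bochner_integral lborel (\<lambda>t. norm (f n t)) (p powr (-b) * (p powr (-a)) ^ n)" for n
  proof -
    have "has_bochner_integral lborel (\<lambda>t. norm (f n t)) (1 / Gamma (a * real n + b) *
        (Gamma (a * real n + b) / p powr (a * real n + b)))"
      unfolding nf
      by (intro has_bochner_integral_mult_right impI has_bochner_integral_Gamma) (use assms pos in auto)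
    also have "1 / Gamma (a * real n + b) * (Gamma (a * real n + b) / p powr (a * real n + b))
        = 1 / p powr (a * real n + b)"
      using Gpos[of n] by simp
    finally show ?thesis
      unfolding pw .
  qed
  then have nfi: "(LINT t|lborel. norm (f n t)) = p powr (-b) * (p powr (-a)) ^ n" for n
    by (simp add: has_bochner_integral_iff)
  have ft: "f n t = indicator {0<..} t * (exp (- p * t) * t powr (b - 1)) *
      (1 / Gamma (a * real n + b) * (- (t powr a)) ^ n)" for n t
  proof (cases "t > 0")
    case True
    then have "t powr (a * real n + b - 1) = t powr (b - 1) * (t powr a) ^ n"
      by (simp add: powr_add [symmetric] powr_powr algebra_simps flip: powr_realpow)
    then show ?thesis
      by (simp add: f_def power_minus[of "t powr a"])
  qed (simp add: f_def)
  have summ: "summable (\<lambda>n. norm (f n t))" for t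
  proof -
    have "norm (f n t) = indicator {0<..} t * (exp (- p * t) * t powr (b - 1)) *
      (1 / Gamma (a * real n + b) * (t powr a) ^ n)" for n
      using Gpos[of n] unfolding ft by (simp add: abs_mult power_abs)
    then show ?thesis
      using summable_mittag_leffler[of a b "t powr a"] assms by (simp only: summable_mult)
  qed
  have fs: "(\<Sum>n. f n t) = indicator {0<..} t * (exp (- p * t) * (t powr (b - 1) * mittag_leffler a b (- (t powr a))))" for t
    unfolding ft using summable_mittag_leffler[of a b "- (t powr a)"] assms
    by (subst suminf_mult) (auto simp: mittag_leffler_def)
  have fint: "integrable lborel (f n)" for n
    using f by (simp add: has_bochner_integral_iff)
  have sumn: "summable (\<lambda>n. LINT t|lborel. norm (f n t))"
    unfolding nfi using pa by (intro summable_mult summable_geometric) auto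
  have "integrable lborel (\<lambda>t. \<Sum>n. f n t)"
    by (rule integrable_suminf[OF fint _ sumn]) (use summ in auto)
  moreover have "(LINT t|lborel. (\<Sum>n. f n t)) = (\<Sum>n. LINT t|lborel. f n t)"
    by (rule integral_suminf[OF fint _ sumn]) (use summ in auto)
  moreover have "(\<Sum>n. LINT t|lborel. f n t) = (\<Sum>n. p powr (-b) * (- (p powr (-a))) ^ n)"
    using f by (simp add: has_bochner_integral_iff)
  moreover have "\<dots> = p powr (-b) * (1 / (1 - - (p powr (-a))))"
    using pa by (subst suminf_mult) (auto intro!: summable_geometric simp: suminf_geometric)
  moreover have "p powr (-b) * (1 / (1 - - (p powr (-a)))) = p powr (a - b) / (p powr a + 1)"
    using assms by (simp add: powr_minus powr_diff field_simps add_pos_pos)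
  ultimately show ?thesis
    by (simp add: has_bochner_integral_iff fs)
qed

text \<open>Lerch's argument. With \<open>H s = exp (- 2 * s) * h s\<close>, the transforms at
  \<open>p = 2 + real i\<close> say that \<open>H\<close> is orthogonal to all polynomials in
  \<open>exp (- s)\<close>. By Weierstrass approximation on \<open>{0..1}\<close> it is orthogonal
  to every continuous function of \<open>exp (- s)\<close>, in particular to a bump around a point
  where \<open>h\<close> would not vanish.\<close>

lemma laplace_uniqueness:
  fixes h :: "real \<Rightarrow> real"
  assumes cont: "continuous_on {0<..} h"
    and laplace: "\<And>p. 2 \<le> p \<Longrightarrow>
      has_bochner_integral lborel (\<lambda>t. indicator {0<..} t * (exp (- p * t) * h t)) 0"
    and "0 < t"
  shows "h t = 0"
proof -
  define H where "H s = indicator {0<..} s * (exp (- 2 * s) * h s)" for s :: real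
  have iH: "integrable lborel H"
    using laplace[of 2] by (simp add: has_bochner_integral_iff H_def [abs_def])
  have mH: "H \<in> borel_measurable lborel"
    using iH by (rule borel_measurable_integrable)
  \<comment> \<open>The weight \<open>exp (- 2 * s)\<close> makes \<open>H\<close> integrable, so a
    uniform approximation error \<open>e\<close> costs at most \<open>e * N\<close>.\<close>
  define N where "N = (LINT s|lborel. norm (H s))"
  have N: "N \<ge> 0"
    by (simp add: N_def)
  have poly: "has_bochner_integral lborel (\<lambda>s. H s * (\<Sum>i\<le>n. a i * exp (- s) ^ i)) 0"
    for a and n :: nat
  proof -
    have "has_bochner_integral lborel (\<lambda>s. \<Sum>i\<le>n. a i * (indicator {0<..} s * (exp (- (2 + real i) * s) * h s)))
        (\<Sum>i\<le>n. a i * 0)"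
      by (intro has_bochner_integral_sum has_bochner_integral_mult_right impI laplace) auto
    moreover have "a i * (indicator {0<..} s * (exp (- (2 + real i) * s) * h s)) = H s * (a i * exp (- s) ^ i)" for i s
    proof -
      have "exp (- (2 + real i) * s) = exp (- 2 * s) * exp (- s) ^ i"
        by (simp add: exp_of_nat_mult [symmetric] exp_add [symmetric] algebra_simps)
      then show ?thesis
        by (simp add: H_def)
    qed
    ultimately show ?thesis
      by (simp only: sum_distrib_left mult_zero_right sum.neutral_const)
  qed
  have zero: "(LINT s|lborel. H s * \<phi> (exp (- s))) = 0" if \<phi>: "continuous_on UNIV \<phi>" for \<phi> :: "real \<Rightarrow> real"
  proof -
    have "\<bar>LINT s|lborel. H s * \<phi> (exp (- s))\<bar> \<le> e * N" if e: "e > 0" for e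
    proof -
      obtain g where g: "real_polynomial_function g" "\<And>x. x \<in> {0..1} \<Longrightarrow> \<bar>\<phi> x - g x\<bar> < e"
        using Stone_Weierstrass_real_polynomial_function[of "{0..1::real}" \<phi> e] e \<phi>
        by (metis compact_Icc continuous_on_subset subset_UNIV)
      then obtain a n where gn: "g = (\<lambda>x. \<Sum>i\<le>n. a i * x ^ i)"
        by (auto simp: real_polynomial_function_iff_sum)
      have gi: "has_bochner_integral lborel (\<lambda>s. H s * g (exp (- s))) 0"
        using poly gn by simp
      have m\<phi>: "(\<lambda>s. \<phi> (exp (- s))) \<in> borel_measurable lborel"
        by (simp, rule borel_measurable_continuous_onI)
          (intro continuous_on_compose2[OF \<phi>] continuous_intros, auto)
      have mg: "(\<lambda>s. g (exp (- s))) \<in> borel_measurable lborel"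
        unfolding gn by measurable
      have bd: "norm (H s * (\<phi> (exp (- s)) - g (exp (- s)))) \<le> norm (e * norm (H s))" for s
      proof (cases "s > 0")
        case True
        then have "\<bar>\<phi> (exp (- s)) - g (exp (- s))\<bar> \<le> e"
          by (intro less_imp_le g) auto
        then show ?thesis
          using e by (simp add: abs_mult mult.commute[of e] mult_left_mono)
      qed (simp add: H_def)
      have id: "integrable lborel (\<lambda>s. H s * (\<phi> (exp (- s)) - g (exp (- s))))"
        by (rule Bochner_Integration.integrable_bound[of _ "\<lambda>s. e * norm (H s)"])
          (use iH bd mH m\<phi> mg in \<open>auto intro!: borel_measurable_times borel_measurable_diff\<close>)
      have "(LINT s|lborel. H s * \<phi> (exp (- s)))
          = (LINT s|lborel. H s * (\<phi> (exp (- s)) - g (exp (- s))) + H s * g (exp (- s)))"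
        by (simp add: algebra_simps)
      also have "\<dots> = (LINT s|lborel. H s * (\<phi> (exp (- s)) - g (exp (- s))))"
        using gi id by (subst Bochner_Integration.integral_add) (auto simp: has_bochner_integral_iff)
      finally have "\<bar>LINT s|lborel. H s * \<phi> (exp (- s))\<bar>
          \<le> (LINT s|lborel. norm (H s * (\<phi> (exp (- s)) - g (exp (- s)))))"
        using integral_norm_bound[of lborel "\<lambda>s. H s * (\<phi> (exp (- s)) - g (exp (- s)))"] by simp
      also have "\<dots> \<le> (LINT s|lborel. e * norm (H s))"
        using id iH bd e by (intro integral_mono) auto
      finally show ?thesis
        by (simp add: N_def)
    qed
    note bound = this
    have "\<bar>LINT s|lborel. H s * \<phi> (exp (- s))\<bar> \<le> 0 + d" if "d > 0" for d
    proof -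
      have "\<bar>LINT s|lborel. H s * \<phi> (exp (- s))\<bar> \<le> d / (N + 1) * N"
        using that N by (intro bound) auto
      also have "\<dots> \<le> d"
        using that N by (simp add: field_simps)
      finally show ?thesis by simp
    qed
    then have "\<bar>LINT s|lborel. H s * \<phi> (exp (- s))\<bar> \<le> 0"
      by (rule field_le_epsilon)
    then show ?thesis by simp
  qed
  show ?thesis
  proof (rule ccontr)
    assume ht: "h t \<noteq> 0"
    \<comment> \<open>The sign factor makes the function positive at \<open>t\<close> in either
      case.\<close>
    define u where "u s = sgn (h t) * h s" for s
    have ut: "u t > 0"
      using ht by (simp add: u_def sgn_mult_self_eq flip: abs_sgn)
        (metis abs_sgn mult.commute zero_less_abs_iff)
    have "isCont h t"
      using cont \<open>0 < t\<close> by (simp add: continuous_on_eq_continuous_at)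
    then have "isCont u t"
      unfolding u_def by (intro continuous_intros)
    then have "\<forall>\<^sub>F s in at t. u s > 0"
      using ut by (auto simp: isCont_def dest: order_tendstoD(1))
    then obtain d where d: "d > 0" "\<And>s. s \<noteq> t \<Longrightarrow> dist s t < d \<Longrightarrow> u s > 0"
      by (auto simp: eventually_at)
    \<comment> \<open>The maximum keeps \<open>l\<close> positive; halving \<open>d\<close> keeps
      the closed interval inside the neighbourhood where \<open>u\<close> is positive.\<close>
    define l r where "l = max (t / 2) (t - d / 2)" and "r = t + d / 2"
    have lr: "0 < l" "l < t" "t < r"
      using d \<open>0 < t\<close> by (auto simp: l_def r_def)
    have us: "u s > 0" if "s \<in> {l..r}" for s
      using that d ut by (cases "s = t") (auto simp: l_def r_def dist_real_def)
    \<comment> \<open>Positive exactly for \<open>x\<close> between \<open>exp (- r)\<close> and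
      \<open>exp (- l)\<close>, that is, for \<open>s\<close> between \<open>l\<close> and
      \<open>r\<close>.\<close>
    define \<phi> where "\<phi> x = max 0 ((x - exp (- r)) * (exp (- l) - x))" for x :: real
    have c\<phi>: "continuous_on UNIV (\<lambda>x. sgn (h t) * \<phi> x)"
      unfolding \<phi>_def by (intro continuous_intros)
    have \<phi>0: "\<phi> (exp (- s)) = 0" if "s \<notin> {l..r}" for s
    proof -
      have "(exp (- s) - exp (- r)) * (exp (- l) - exp (- s)) \<le> 0"
        using that lr by (auto simp: mult_le_0_iff)
      then show ?thesis
        by (simp add: \<phi>_def)
    qed
    have \<phi>1: "\<phi> (exp (- s)) > 0" if "l < s" "s < r" for s
      using that by (auto simp: \<phi>_def)
    have eq: "H s * (sgn (h t) * \<phi> (exp (- s))) = indicator {0<..} s * exp (- 2 * s) * u s * \<phi> (exp (- s))" for s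
      by (simp add: H_def u_def)
    have nn: "H s * (sgn (h t) * \<phi> (exp (- s))) \<ge> 0" for s
    proof (cases "s \<in> {l..r}")
      case True
      then show ?thesis
        unfolding eq using us[OF True] by (simp add: \<phi>_def)
    qed (simp add: \<phi>0)
    have m\<phi>: "(\<lambda>s. sgn (h t) * \<phi> (exp (- s))) \<in> borel_measurable lborel"
      unfolding \<phi>_def by measurable
    have ii: "integrable lborel (\<lambda>s. H s * (sgn (h t) * \<phi> (exp (- s))))"
    proof (rule Bochner_Integration.integrable_bound[of _ "\<lambda>s. 4 * H s"])
      have "norm (H s * (sgn (h t) * \<phi> (exp (- s)))) \<le> norm (4 * H s)" for s
      proof (cases "s > 0")
        case True
        have e: "exp (- s) \<le> 1" "exp (- r) \<le> 1" "exp (- l) \<le> 1"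
          using True lr by auto
        have "\<bar>exp (- s) - exp (- r)\<bar> * \<bar>exp (- l) - exp (- s)\<bar> \<le> 2 * 2"
        proof (rule mult_mono)
          show "\<bar>exp (- s) - exp (- r)\<bar> \<le> 2" "\<bar>exp (- l) - exp (- s)\<bar> \<le> 2"
            using e exp_gt_zero[of "-s"] exp_gt_zero[of "-r"] exp_gt_zero[of "-l"] by linarith+
        qed auto
        then have "\<bar>\<phi> (exp (- s))\<bar> \<le> 4"
          by (auto simp: \<phi>_def max_def simp flip: abs_mult)
        then have "\<bar>sgn (h t) * \<phi> (exp (- s))\<bar> \<le> 4"
          using ht by (simp add: abs_mult abs_sgn_eq)
        then have "\<bar>H s\<bar> * \<bar>sgn (h t) * \<phi> (exp (- s))\<bar> \<le> \<bar>H s\<bar> * 4"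
          by (rule mult_left_mono) auto
        then show ?thesis
          by (simp add: abs_mult)
      qed (simp add: H_def)
      then show "AE s in lborel. norm (H s * (sgn (h t) * \<phi> (exp (- s)))) \<le> norm (4 * H s)"
        by simp
      show "(\<lambda>s. H s * (sgn (h t) * \<phi> (exp (- s)))) \<in> borel_measurable lborel"
        using mH m\<phi> by (rule borel_measurable_times)
    qed (use iH in simp)
    have "AE s in lborel. H s * (sgn (h t) * \<phi> (exp (- s))) = 0"
      using zero[OF c\<phi>] ii nn by (subst (asm) integral_nonneg_eq_0_iff_AE) auto
    then have "AE s in lborel. s \<notin> {l<..<r}"
    proof eventually_elim
      case (elim s)
      show ?case
      proof
        assume s: "s \<in> {l<..<r}"
        then have "u s > 0" "\<phi> (exp (- s)) > 0" "s > 0"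
          using us[of s] \<phi>1[of s] lr by auto
        then have "indicator {0<..} s * exp (- 2 * s) * u s * \<phi> (exp (- s)) > 0"
          by simp
        with elim show False
          unfolding eq by (metis less_irrefl)
      qed
    qed
    then have "emeasure lborel {l<..<r} = 0"
      by (subst (asm) AE_iff_measurable[of "{l<..<r}"]) auto
    then show False
      using lr by simp
  qed
qed

section \<open>Contour representation of the Mittag-Leffler function\<close>

lemma integrable_exp_neg_abs:
  fixes m :: real
  assumes "0 < m"
  shows "integrable lborel (\<lambda>x. exp (- m * \<bar>x\<bar>))"
proof -
  define f where "f x = indicator {0<..} x * (x powr (1 - 1) * exp (- m * x))" for x :: real
  have f: "integrable lborel f"
    using has_bochner_integral_Gamma[of 1 m] assms unfolding f_def has_bochner_integral_iff by auto
  have "integrable lborel (\<lambda>x. f (0 + (-1) * x))"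
    using f by (subst lborel_integrable_real_affine_iff) auto
  with f have i: "integrable lborel (\<lambda>x. f x + f (0 + (-1) * x))"
    by (rule Bochner_Integration.integrable_add)
  show ?thesis
  proof (rule Bochner_Integration.integrable_bound[OF i])
    have "AE x in lborel. x \<noteq> (0::real)"
      by (rule AE_lborel_singleton)
    then show "AE x in lborel. norm (exp (- m * \<bar>x\<bar>)) \<le> norm (f x + f (0 + (-1) * x))"
      by eventually_elim (auto simp: f_def indicator_def)
  qed measurable
qed

text \<open>Meant for \<open>q = p - z\<close> with \<open>z\<close> on the ray, where
  \<open>Re z < 0\<close>: the Laplace transform in \<open>t\<close> turns
  \<open>exp (t * z)\<close> into the Cauchy kernel \<open>1 / (p - z)\<close>.\<close>

lemma has_bochner_integral_laplace_one:
  fixes q :: complex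
  assumes "0 < Re q"
  shows "has_bochner_integral lborel (\<lambda>t. indicator {0<..} t *\<^sub>R exp (- q * of_real t)) (1 / q)"
proof -
  have q: "q \<noteq> 0"
    using assms by auto
  have si: "set_integrable lborel (einterval 0 \<infinity>) (\<lambda>t. exp (- q * of_real t))"
    unfolding set_integrable_def
  proof (rule Bochner_Integration.integrable_bound[OF integrable_exp_neg_abs[OF assms]])
    show "(\<lambda>t. indicat_real (einterval 0 \<infinity>) t *\<^sub>R exp (- q * of_real t)) \<in> borel_measurable lborel"
      by measurable
    show "AE t in lborel. norm (indicat_real (einterval 0 \<infinity>) t *\<^sub>R exp (- q * of_real t))
        \<le> norm (exp (- Re q * \<bar>t\<bar>))"
      by (auto simp: einterval_def indicator_def zero_ereal_def)
  qed
  have "(LBINT t=0..\<infinity>. exp (- q * of_real t)) = 0 - (- (1 / q))"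
  proof (rule interval_integral_FTC_integrable[where F = "\<lambda>t. - (exp (- q * of_real t) / q)"])
    show "((\<lambda>t. - (exp (- q * of_real t) / q)) has_vector_derivative exp (- q * of_real x)) (at x)" for x
      by (rule has_vector_derivative_real_field)
        (use q in \<open>auto intro!: derivative_eq_intros\<close>)
    show "(((\<lambda>t. - (exp (- q * of_real t) / q)) \<circ> real_of_ereal) \<longlongrightarrow> - (1 / q)) (at_right 0)"
    proof -
      have "((\<lambda>t. - (exp (- q * of_real t) / q)) \<longlongrightarrow> - (exp (- q * of_real 0) / q)) (at_right 0)"
        by (intro tendsto_intros) (use q in auto)
      then show ?thesis
        by (simp add: zero_ereal_def ereal_tendsto_simps)
    qed
    show "(((\<lambda>t. - (exp (- q * of_real t) / q)) \<circ> real_of_ereal) \<longlongrightarrow> 0) (at_left \<infinity>)"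
    proof -
      have "((\<lambda>t. exp (- Re q * t) / norm q) \<longlongrightarrow> 0) at_top"
        using assms q by real_asymp
      then have "((\<lambda>t. norm (- (exp (- q * of_real t) / q))) \<longlongrightarrow> 0) at_top"
        by (simp add: norm_divide)
      then show ?thesis
        using tendsto_minus[of "\<lambda>t. exp (- q * of_real t) / q" 0 at_top]
        by (simp add: ereal_tendsto_simps tendsto_norm_zero_iff)
    qed
    show "isCont (\<lambda>t. exp (- q * of_real t)) x" for x :: real
      by (intro continuous_intros)
  qed (use si in auto)
  moreover have "einterval 0 \<infinity> = {0<..}"
    by (auto simp: einterval_def zero_ereal_def)
  ultimately show ?thesis
    using si by (simp add: has_bochner_integral_iff set_integrable_def set_lebesgue_integral_def
        interval_lebesgue_integral_def)
qed

text \<open>A translation by \<open>Complex 0 y\<close> moves the segment to the real axis.\<close>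

lemma contour_integral_linepath_horizontal:
  assumes "l < r"
  shows "contour_integral (linepath (Complex l y) (Complex r y)) f = integral {l..r} (\<lambda>x. f (Complex x y))"
proof -
  have "contour_integral (linepath (Complex l y) (Complex r y)) f
      = contour_integral (linepath (of_real l) (of_real r)) (\<lambda>z. f (z + Complex 0 y))"
    unfolding contour_integral_integral
    by (intro integral_cong arg_cong2[of _ _ _ _ "(*)"] arg_cong[of _ _ f])
      (auto simp: linepath_def complex_eq_iff algebra_simps)
  also have "\<dots> = integral {Re (of_real l)..Re (of_real r)} (\<lambda>x. f (of_real x + Complex 0 y))"
    by (rule contour_integral_linepath_Reals_eq) (use assms in auto)
  also have "\<dots> = integral {l..r} (\<lambda>x. f (Complex x y))"
    by (intro arg_cong2[of _ _ _ _ integral] ext arg_cong[of _ _ f]) (auto simp: complex_eq_iff)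
  finally show ?thesis .
qed

text \<open>In the logarithmic variable \<open>w = ln z\<close>, the contour \<open>Im w = \<phi>\<close> is the ray of argument
  \<open>\<phi>\<close>. The conditions on \<open>\<phi>\<close> put this ray in the open left half-plane but before the pole
  \<open>exp (\<i> pi / a)\<close> of \<open>z\<^sup>a\<^sup>-\<^sup>b / (z\<^sup>a + 1)\<close>.\<close>

locale mittag_leffler_sector =
  fixes a b \<phi> :: real
  assumes a: "1 < a" "a < 2" and b: "1 \<le> b" "b \<le> 2" and \<phi>: "pi / 2 < \<phi>" "\<phi> * a < pi"
begin

text \<open>With \<open>z = exp w\<close> this is the function
  \<open>z powr (a - b) / (z powr a + 1)\<close> times \<open>z\<close>; the extra factor is the
  Jacobian in \<open>dz = z dw\<close>.\<close>

definition kern :: "complex \<Rightarrow> complex" where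
  "kern w = exp (of_real (a - b + 1) * w) / (exp (of_real a * w) + 1)"

definition ray_integrand :: "real \<Rightarrow> real \<Rightarrow> complex" where
  "ray_integrand t x = exp (of_real t * exp (Complex x \<phi>)) * kern (Complex x \<phi>)"

text \<open>The contour comes in along the lower ray and goes out along the upper one. If
  \<open>J\<close> is the integral over the upper ray, the lower one contributes
  \<open>- cnj J\<close>, and \<open>(J - cnj J) / (2 * pi * \<i>)\<close> equals
  \<open>Im J / pi\<close>.\<close>

definition ray_integral :: "real \<Rightarrow> real" where
  "ray_integral t = Im (LINT x|lborel. ray_integrand t x) / pi"

section \<open>Geometry of the ray and size of the kernel on it\<close>

lemma \<phi>_bounds: "0 < \<phi>" "\<phi> < pi" "pi / 2 < a * \<phi>" "a * \<phi> < pi"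
proof -
  show 0: "0 < \<phi>"
    using \<phi>(1) pi_gt_zero by linarith
  have "\<phi> \<le> \<phi> * a"
    using a 0 by simp
  then show "\<phi> < pi" "pi / 2 < a * \<phi>" "a * \<phi> < pi"
    using \<phi> by (auto simp: mult.commute)
qed

lemma cos_neg: "0 < - cos \<phi>"
  using cos_lt_zero_pi[of \<phi>] \<phi> \<phi>_bounds by auto

lemma sin_pos: "0 < sin (a * \<phi>)"
  using \<phi>_bounds sin_gt_zero[of "a * \<phi>"] pi_gt_zero by auto

lemma Re_exp_ray: "Re (exp (Complex x \<phi>)) = - ((- cos \<phi>) * exp x)"
  by (simp add: Re_exp)

text \<open>On the ray, the power of exponent \<open>a\<close> has argument
  \<open>a * \<phi>\<close>, strictly between \<open>pi / 2\<close> and \<open>pi\<close>. The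
  second bound is the imaginary part of the denominator; the first is, up to sign, its imaginary
  part after the rotation by \<open>- (a * \<phi>)\<close> that makes the power real.\<close>

lemma denominator_lower_bounds:
  shows "sin (a * \<phi>) \<le> norm (exp (of_real a * Complex x \<phi>) + 1)"
    and "sin (a * \<phi>) * exp (a * x) \<le> norm (exp (of_real a * Complex x \<phi>) + 1)"
proof -
  have e: "exp (of_real a * Complex x \<phi>) = of_real (exp (a * x)) * cis (a * \<phi>)"
    by (simp add: exp_eq_polar complex_eq_iff)
  have "sin (a * \<phi>) * exp (a * x) = Im (exp (of_real a * Complex x \<phi>) + 1)"
    unfolding e by simp
  also have "\<dots> \<le> norm (exp (of_real a * Complex x \<phi>) + 1)"
    by (rule order_trans[OF abs_ge_self abs_Im_le_cmod])
  finally show "sin (a * \<phi>) * exp (a * x) \<le> norm (exp (of_real a * Complex x \<phi>) + 1)" .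
  have "sin (a * \<phi>) = - Im (of_real (exp (a * x)) + cis (- (a * \<phi>)))"
    by simp
  also have "\<dots> \<le> norm (of_real (exp (a * x)) + cis (- (a * \<phi>)))"
    using abs_Im_le_cmod by (meson abs_le_D2)
  also have "of_real (exp (a * x)) + cis (- (a * \<phi>))
      = (exp (of_real a * Complex x \<phi>) + 1) * cis (- (a * \<phi>))"
    unfolding e by (simp add: algebra_simps cis_mult)
  also have "norm \<dots> = norm (exp (of_real a * Complex x \<phi>) + 1)"
    by (simp add: norm_mult)
  finally show "sin (a * \<phi>) \<le> norm (exp (of_real a * Complex x \<phi>) + 1)" .
qed

text \<open>One bound for each end of the line: the first decays as \<open>x\<close> tends to minus
  infinity because \<open>a - b + 1 > 0\<close>, the second does not grow for positive
  \<open>x\<close> because \<open>b \<ge> 1\<close>.\<close>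

lemma norm_kern_ray_le:
  shows "norm (kern (Complex x \<phi>)) \<le> exp ((a - b + 1) * x) / sin (a * \<phi>)"
    and "norm (kern (Complex x \<phi>)) \<le> exp ((1 - b) * x) / sin (a * \<phi>)"
proof -
  have n: "norm (kern (Complex x \<phi>))
      = exp ((a - b + 1) * x) / norm (exp (of_real a * Complex x \<phi>) + 1)"
    by (simp add: kern_def norm_divide)
  show "norm (kern (Complex x \<phi>)) \<le> exp ((a - b + 1) * x) / sin (a * \<phi>)"
    unfolding n using denominator_lower_bounds(1)[of x] sin_pos
    by (intro divide_left_mono mult_pos_pos) auto
  have "norm (kern (Complex x \<phi>)) \<le> exp ((a - b + 1) * x) / (sin (a * \<phi>) * exp (a * x))"
    unfolding n using denominator_lower_bounds(2)[of x] sin_pos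
    by (intro divide_left_mono mult_pos_pos less_le_trans[OF sin_pos denominator_lower_bounds(1)]) auto
  also have "\<dots> = exp ((1 - b) * x) / sin (a * \<phi>)"
  proof -
    have "exp ((a - b + 1) * x) = exp ((1 - b) * x) * exp (a * x)"
      by (simp add: exp_add [symmetric] algebra_simps)
    then show ?thesis by simp
  qed
  finally show "norm (kern (Complex x \<phi>)) \<le> exp ((1 - b) * x) / sin (a * \<phi>)" .
qed

lemma denominator_ray_nonzero: "exp (of_real a * Complex x \<phi>) + 1 \<noteq> 0"
  using denominator_lower_bounds(1)[of x] sin_pos by (metis norm_zero not_le)

lemma continuous_on_Complex_ray: "continuous_on A (\<lambda>x. Complex x \<phi>)"
  by (simp add: Complex_eq) (intro continuous_intros)

lemma continuous_on_kern_ray: "continuous_on A (\<lambda>x. kern (Complex x \<phi>))"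
  unfolding kern_def
  by (intro continuous_intros continuous_on_Complex_ray) (use denominator_ray_nonzero in auto)

lemma borel_measurable_Complex_ray [measurable]: "(\<lambda>x. Complex x \<phi>) \<in> borel_measurable borel"
  by (rule borel_measurable_continuous_onI) (rule continuous_on_Complex_ray)

lemma borel_measurable_kern_ray [measurable]: "(\<lambda>x. kern (Complex x \<phi>)) \<in> borel_measurable borel"
  by (rule borel_measurable_continuous_onI) (rule continuous_on_kern_ray)

lemma borel_measurable_exp_complex [measurable]: "(exp :: complex \<Rightarrow> complex) \<in> borel_measurable borel"
  by (rule borel_measurable_continuous_onI) (intro continuous_intros)

lemma norm_ray_integrand:
  "norm (ray_integrand t x) = exp (- ((- cos \<phi>) * t * exp x)) * norm (kern (Complex x \<phi>))"
  by (simp add: ray_integrand_def norm_mult Re_exp_ray del: mult_minus_left)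

lemma borel_measurable_ray_integrand [measurable]: "(\<lambda>x. ray_integrand t x) \<in> borel_measurable borel"
  unfolding ray_integrand_def by measurable

section \<open>Decay and continuity of the ray integral\<close>

lemma integrable_double_exponential:
  fixes c s :: real
  assumes "0 < c" "0 < s" "s \<le> 2"
  shows "integrable lborel (\<lambda>y. exp (- (c * exp y)) * exp (s * y))"
proof -
  define m where "m = min s 1"
  \<comment> \<open>From \<open>(c * u / 3) ^ 3 \<le> exp (c * u)\<close> one gets
    \<open>exp (- (c * u)) * u ^ 3 \<le> 27 / c ^ 3\<close>. A cubic gain pays for
    \<open>exp (s * y)\<close> with \<open>s \<le> 2\<close> and still leaves
    \<open>exp (- y)\<close>.\<close>
  define K where "K = 1 + 27 / c ^ 3"
  have m: "0 < m" "m \<le> s" "m \<le> 1"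
    using assms by (auto simp: m_def)
  have K: "1 \<le> K" "27 / c ^ 3 \<le> K"
    using assms by (auto simp: K_def)
  have bd: "exp (- (c * exp y)) * exp (s * y) \<le> K * exp (- m * \<bar>y\<bar>)" for y
  proof (cases "y \<le> 0")
    case True
    have "exp (- (c * exp y)) * exp (s * y) \<le> 1 * exp (- m * \<bar>y\<bar>)"
    proof (rule mult_mono)
      have "s * y \<le> m * y"
        using True m by (intro mult_right_mono_neg) auto
      then show "exp (s * y) \<le> exp (- m * \<bar>y\<bar>)"
        using True by simp
    qed (use assms in auto)
    also have "\<dots> \<le> K * exp (- m * \<bar>y\<bar>)"
      using K by (intro mult_right_mono) auto
    finally show ?thesis .
  next
    case False
    define u where "u = exp y"
    have u: "u > 0"
      by (simp add: u_def)
    have "(c * u / 3) ^ 3 \<le> exp (c * u / 3) ^ 3"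
      using exp_ge_add_one_self[of "c * u / 3"] assms u by (intro power_mono) (linarith, simp)
    also have "\<dots> = exp (c * u)"
      by (simp flip: exp_of_nat_mult)
    finally have "c ^ 3 * u ^ 3 / 27 \<le> exp (c * u)"
      by (simp add: power_mult_distrib power_divide)
    then have "exp (- (c * u)) * u ^ 3 \<le> 27 / c ^ 3"
      using assms by (simp add: exp_minus field_simps)
    then have 1: "exp (- (c * exp y)) * exp (3 * y) \<le> K"
      using K by (simp add: u_def flip: exp_of_nat_mult)
    have "exp (- (c * exp y)) * exp (s * y) \<le> exp (- (c * exp y)) * (exp (3 * y) * exp (- m * \<bar>y\<bar>))"
    proof (rule mult_left_mono)
      have "s * y + m * y \<le> 2 * y + 1 * y"
        using False assms m by (intro add_mono mult_right_mono) auto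
      then show "exp (s * y) \<le> exp (3 * y) * exp (- m * \<bar>y\<bar>)"
        using False by (simp add: exp_add [symmetric])
    qed simp
    also have "\<dots> = (exp (- (c * exp y)) * exp (3 * y)) * exp (- m * \<bar>y\<bar>)"
      by simp
    also have "\<dots> \<le> K * exp (- m * \<bar>y\<bar>)"
      by (intro mult_right_mono 1) simp
    finally show ?thesis .
  qed
  show ?thesis
  proof (rule Bochner_Integration.integrable_bound)
    show "integrable lborel (\<lambda>y. K * exp (- m * \<bar>y\<bar>))"
      using m by (intro integrable_mult_right integrable_exp_neg_abs)
    show "AE y in lborel. norm (exp (- (c * exp y)) * exp (s * y)) \<le> norm (K * exp (- m * \<bar>y\<bar>))"
      using bd K by (intro AE_I2) (auto simp: abs_mult)
  qed measurable
qed

lemma exponent_bounds: "0 < a - b + 1" "a - b + 1 \<le> 2"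
  using a b by auto

lemma norm_ray_integrand_le:
  "norm (ray_integrand t x) \<le> exp (- ((- cos \<phi>) * t * exp x)) * exp ((a - b + 1) * x) / sin (a * \<phi>)"
  unfolding norm_ray_integrand using norm_kern_ray_le(1)[of x]
  by (metis exp_ge_zero mult_left_mono times_divide_eq_right)

lemma integrable_ray_bound:
  assumes "0 < t"
  shows "integrable lborel (\<lambda>x. exp (- ((- cos \<phi>) * t * exp x)) * exp ((a - b + 1) * x) / sin (a * \<phi>))"
  using integrable_double_exponential[of "(- cos \<phi>) * t" "a - b + 1"] assms cos_neg exponent_bounds
  by (intro integrable_divide) (auto simp: mult_less_0_iff)

lemma integrable_ray_integrand:
  assumes "0 < t"
  shows "integrable lborel (ray_integrand t)"
  by (rule Bochner_Integration.integrable_bound[OF integrable_ray_bound[OF assms]])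
    (use norm_ray_integrand_le sin_pos in \<open>auto simp: abs_mult intro!: AE_I2\<close>)

text \<open>Dilating the ray by \<open>1 / t\<close> means translating \<open>x\<close> by
  \<open>- ln t\<close>. This removes \<open>t\<close> from the double exponential and leaves the
  power of \<open>t\<close> in front of the fixed integral of \<open>B 1\<close>.\<close>

lemma ray_integral_bound:
  obtains C where "0 \<le> C" "\<And>t. 0 < t \<Longrightarrow> \<bar>ray_integral t\<bar> \<le> C * t powr (- (a - b + 1))"
proof
  define B where "B t x = exp (- ((- cos \<phi>) * t * exp x)) * exp ((a - b + 1) * x) / sin (a * \<phi>)" for t x
  define C where "C = (LINT x|lborel. B 1 x) / pi"
  have "0 \<le> (LINT x|lborel. B 1 x)"
    by (rule Bochner_Integration.integral_nonneg) (use sin_pos in \<open>auto simp: B_def\<close>)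
  then show "0 \<le> C"
    by (simp add: C_def)
  fix t :: real assume t: "0 < t"
  have B: "B t (- ln t + x) = t powr (- (a - b + 1)) * B 1 x" for x
  proof -
    have "exp ((a - b + 1) * (- ln t + x)) = t powr (- (a - b + 1)) * exp ((a - b + 1) * x)"
      using t by (simp add: powr_def algebra_simps flip: exp_add)
    moreover have "t * exp (- ln t + x) = exp x"
      using t by (simp add: exp_add exp_diff exp_minus)
    ultimately show ?thesis
      by (simp add: B_def mult.assoc)
  qed
  have "(LINT x|lborel. B t x) = (LINT x|lborel. B t (- ln t + 1 * x))"
    by (subst lborel_integral_real_affine[of 1 _ "- ln t"]) auto
  also have "\<dots> = t powr (- (a - b + 1)) * (LINT x|lborel. B 1 x)"
    by (simp only: mult_1 B integral_mult_right_zero)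
  finally have BB: "(LINT x|lborel. B t x) = t powr (- (a - b + 1)) * (LINT x|lborel. B 1 x)" .
  have "\<bar>Im (LINT x|lborel. ray_integrand t x)\<bar> \<le> norm (LINT x|lborel. ray_integrand t x)"
    by (rule abs_Im_le_cmod)
  also have "\<dots> \<le> (LINT x|lborel. norm (ray_integrand t x))"
    by (rule integral_norm_bound)
  also have "\<dots> \<le> (LINT x|lborel. B t x)"
    using integrable_ray_integrand[OF t] integrable_ray_bound[OF t] norm_ray_integrand_le
    unfolding B_def by (intro integral_mono integrable_norm)
  finally show "\<bar>ray_integral t\<bar> \<le> C * t powr (- (a - b + 1))"
    unfolding BB by (simp add: ray_integral_def C_def divide_right_mono mult.commute)
qed

lemma continuous_on_ray_integral: "continuous_on {0<..} ray_integral"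
proof -
  \<comment> \<open>The majorant at \<open>t = l\<close> dominates the integrands for all
    \<open>t \<ge> l\<close>, so dominated convergence is applied on \<open>{l..}\<close> and
    continuity at a point is then local.\<close>
  have "continuous_on {l..} ray_integral" if l: "0 < l" for l
    unfolding ray_integral_def
  proof (intro continuous_intros)
    show "continuous_on {l..} (\<lambda>t. LINT x|lborel. ray_integrand t x)"
      unfolding continuous_on_sequentially comp_def
    proof safe
      fix u :: "nat \<Rightarrow> real" and t
      assume u: "\<forall>n. u n \<in> {l..}" "u \<longlonglongrightarrow> t"
      show "(\<lambda>n. LINT x|lborel. ray_integrand (u n) x) \<longlonglongrightarrow> (LINT x|lborel. ray_integrand t x)"
      proof (rule integral_dominated_convergence[OF _ _ integrable_ray_bound[OF l]])
        show "AE x in lborel. (\<lambda>n. ray_integrand (u n) x) \<longlonglongrightarrow> ray_integrand t x"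
          unfolding ray_integrand_def by (intro AE_I2 tendsto_intros u)
        show "AE x in lborel. norm (ray_integrand (u n) x)
            \<le> exp (- ((- cos \<phi>) * l * exp x)) * exp ((a - b + 1) * x) / sin (a * \<phi>)" for n
        proof (rule AE_I2, rule order_trans[OF norm_ray_integrand_le])
          fix x
          have "(- cos \<phi>) * l * exp x \<le> (- cos \<phi>) * u n * exp x"
            using u cos_neg by (intro mult_right_mono mult_left_mono) auto
          then show "exp (- ((- cos \<phi>) * u n * exp x)) * exp ((a - b + 1) * x) / sin (a * \<phi>)
              \<le> exp (- ((- cos \<phi>) * l * exp x)) * exp ((a - b + 1) * x) / sin (a * \<phi>)"
            using sin_pos by (intro divide_right_mono mult_right_mono) auto
        qed
      qed auto
    qed
  qed simp
  note * = this
  show ?thesis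
  proof (rule continuous_at_imp_continuous_on, rule ballI)
    fix t :: real assume t: "t \<in> {0<..}"
    then have "continuous_on {t / 2..} ray_integral"
      by (intro *) auto
    moreover have "t \<in> interior {t / 2..}"
      using t by simp
    ultimately show "isCont ray_integral t"
      by (rule continuous_on_interior)
  qed
qed

section \<open>Laplace transform of the ray integral\<close>

lemma integrable_ray_laplace_bound:
  assumes "1 \<le> p"
  shows "integrable lborel (\<lambda>x. norm (kern (Complex x \<phi>)) / (p + (- cos \<phi>) * exp x))"
proof -
  define c where "c = - cos \<phi>"
  \<comment> \<open>A decay rate valid at both ends: the function decays like
    \<open>exp ((a - b + 1) * x)\<close> on the left and like \<open>exp (- b * x)\<close> on the
    right, with \<open>b \<ge> 1\<close>.\<close>
  define m where "m = min (a - b + 1) 1"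
  define K where "K = (1 + 1 / c) / sin (a * \<phi>)"
  have c: "c > 0" and m: "0 < m" "m \<le> a - b + 1" "m \<le> 1"
    using cos_neg exponent_bounds by (auto simp: c_def m_def)
  have K: "0 \<le> K"
    using c sin_pos by (simp add: K_def)
  have bd: "norm (kern (Complex x \<phi>)) / (p + c * exp x) \<le> K * exp (- m * \<bar>x\<bar>)" for x
  proof (cases "x \<le> 0")
    case True
    have "norm (kern (Complex x \<phi>)) / (p + c * exp x) \<le> norm (kern (Complex x \<phi>)) / 1"
      using assms c by (intro divide_left_mono) (auto intro: add_increasing2 add_pos_pos)
    also have "\<dots> \<le> exp ((a - b + 1) * x) / sin (a * \<phi>)"
      using norm_kern_ray_le(1) by simp
    also have "\<dots> \<le> exp (- m * \<bar>x\<bar>) / sin (a * \<phi>)"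
      using True m sin_pos mult_right_mono_neg[of m "a - b + 1" x] by (intro divide_right_mono) auto
    also have "\<dots> = 1 / sin (a * \<phi>) * exp (- m * \<bar>x\<bar>)"
      by simp
    also have "\<dots> \<le> K * exp (- m * \<bar>x\<bar>)"
      unfolding K_def using c sin_pos by (intro mult_right_mono divide_right_mono) auto
    finally show ?thesis .
  next
    case False
    have "norm (kern (Complex x \<phi>)) / (p + c * exp x) \<le> norm (kern (Complex x \<phi>)) / (c * exp x)"
      using assms c by (intro divide_left_mono) (auto intro!: add_pos_pos mult_pos_pos)
    also have "\<dots> \<le> (exp ((1 - b) * x) / sin (a * \<phi>)) / (c * exp x)"
      using norm_kern_ray_le(2) c by (intro divide_right_mono) auto
    also have "\<dots> = (1 / c) / sin (a * \<phi>) * (exp ((1 - b) * x) / exp x)"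
      by simp
    also have "\<dots> \<le> (1 / c) / sin (a * \<phi>) * exp (- m * \<bar>x\<bar>)"
    proof (rule mult_left_mono)
      have "(1 - b) * x - x \<le> - m * x"
        using False b m mult_right_mono[of m b x] by (simp add: algebra_simps)
      then show "exp ((1 - b) * x) / exp x \<le> exp (- m * \<bar>x\<bar>)"
        using False by (simp add: exp_diff [symmetric])
    qed (use c sin_pos in auto)
    also have "\<dots> \<le> K * exp (- m * \<bar>x\<bar>)"
      unfolding K_def using c sin_pos by (intro mult_right_mono divide_right_mono) auto
    finally show ?thesis .
  qed
  have pos: "0 < p + c * exp x" for x
    using assms c by (auto intro!: add_pos_pos)
  show ?thesis
    unfolding c_def [symmetric]
  proof (rule Bochner_Integration.integrable_bound)
    show "integrable lborel (\<lambda>x. K * exp (- m * \<bar>x\<bar>))"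
      using m by (intro integrable_mult_right integrable_exp_neg_abs)
    show "AE x in lborel. norm (norm (kern (Complex x \<phi>)) / (p + c * exp x)) \<le> norm (K * exp (- m * \<bar>x\<bar>))"
      using bd K pos by (intro AE_I2) (auto simp: abs_mult abs_of_pos)
  qed measurable
qed

text \<open>The Cauchy kernel at \<open>p\<close>, written in the logarithmic variable; the Jacobian
  is already part of \<open>kern\<close>.\<close>

definition resolvent :: "real \<Rightarrow> complex \<Rightarrow> complex" where
  "resolvent p w = kern w / (of_real p - exp w)"

lemma integrable_resolvent_ray:
  assumes "1 \<le> p"
  shows "integrable lborel (\<lambda>x. resolvent p (Complex x \<phi>))"
proof (rule Bochner_Integration.integrable_bound[OF integrable_ray_laplace_bound[OF assms]])
  show "(\<lambda>x. resolvent p (Complex x \<phi>)) \<in> borel_measurable lborel"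
    unfolding resolvent_def by measurable
  have "norm (resolvent p (Complex x \<phi>)) \<le> norm (norm (kern (Complex x \<phi>)) / (p + (- cos \<phi>) * exp x))" for x
  proof -
    have "0 < (- cos \<phi>) * exp x"
      using cos_neg by (intro mult_pos_pos) auto
    then have pos: "0 < p + (- cos \<phi>) * exp x"
      using assms by (intro add_pos_pos) auto
    have "p + (- cos \<phi>) * exp x = Re (of_real p - exp (Complex x \<phi>))"
      unfolding minus_complex.simps Re_exp_ray by simp
    also have "\<dots> \<le> norm (of_real p - exp (Complex x \<phi>))"
      by (rule complex_Re_le_cmod)
    finally have "norm (kern (Complex x \<phi>)) / norm (of_real p - exp (Complex x \<phi>))
        \<le> norm (kern (Complex x \<phi>)) / (p + (- cos \<phi>) * exp x)"
      using pos by (intro divide_left_mono) (auto intro!: mult_pos_pos)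
    then show ?thesis
      using pos by (simp add: resolvent_def norm_divide)
  qed
  then show "AE x in lborel. norm (resolvent p (Complex x \<phi>))
      \<le> norm (norm (kern (Complex x \<phi>)) / (p + (- cos \<phi>) * exp x))"
    by simp
qed

lemma has_bochner_integral_laplace_ray_integral:
  assumes "1 \<le> p"
  shows "has_bochner_integral lborel (\<lambda>t. indicator {0<..} t * (exp (- p * t) * ray_integral t))
    (Im (LINT x|lborel. resolvent p (Complex x \<phi>)) / pi)"
proof -
  define f where "f = (\<lambda>x t. indicator {0<..} t *\<^sub>R (exp (- of_real p * of_real t) * ray_integrand t x))"
  define q where "q x = of_real p - exp (Complex x \<phi>)" for x
  have cpos: "0 < (- cos \<phi>) * exp x" for x
    using cos_neg by (intro mult_pos_pos) auto
  have qpos: "0 < p + (- cos \<phi>) * exp x" for x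
    using assms cpos by (intro add_pos_pos) auto
  have Rq: "Re (q x) = p + (- cos \<phi>) * exp x" for x
    unfolding q_def minus_complex.simps Re_exp_ray by simp
  have fq: "f x t = (indicator {0<..} t *\<^sub>R exp (- q x * of_real t)) * kern (Complex x \<phi>)" for x t
    by (simp add: f_def q_def ray_integrand_def exp_add [symmetric] algebra_simps flip: mult.assoc)
  have fx: "has_bochner_integral lborel (f x) (1 / q x * kern (Complex x \<phi>))" for x
    unfolding fq using has_bochner_integral_laplace_one[of "q x"] Rq qpos
    by (intro has_bochner_integral_mult_left impI) auto
  \<comment> \<open>The factor \<open>t powr (1 - 1)\<close> brings the norm into the form of
    Euler's integral with \<open>z = 1\<close>.\<close>
  have nf: "norm (f x t) = (indicator {0<..} t * (t powr (1 - 1) * exp (- Re (q x) * t))) * norm (kern (Complex x \<phi>))" for x t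
    unfolding fq by (auto simp: norm_mult indicator_def)
  have "has_bochner_integral lborel (\<lambda>t. norm (f x t)) (Gamma 1 / Re (q x) powr 1 * norm (kern (Complex x \<phi>)))" for x
    unfolding nf using Rq qpos
    by (intro has_bochner_integral_mult_left impI has_bochner_integral_Gamma) auto
  then have nfx: "(LINT t|lborel. norm (f x t)) = norm (kern (Complex x \<phi>)) / (p + (- cos \<phi>) * exp x)" for x
    using qpos[of x] by (simp add: has_bochner_integral_iff Rq)
  have mf [measurable]: "case_prod f \<in> borel_measurable (lborel \<Otimes>\<^sub>M lborel)"
    unfolding f_def ray_integrand_def by measurable
  \<comment> \<open>Integrating the norm over \<open>t\<close> first gives the function of
    \<open>integrable_ray_laplace_bound\<close>; this is the absolute integrability that Fubini
    requires.\<close>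
  have int: "integrable (lborel \<Otimes>\<^sub>M lborel) (case_prod f)"
  proof (rule lborel_pair.Fubini_integrable[OF mf])
    show "integrable lborel (\<lambda>x. LINT t|lborel. norm (case (x, t) of (x, t) \<Rightarrow> f x t))"
      using integrable_ray_laplace_bound[OF assms] by (simp add: nfx)
    show "AE x in lborel. integrable lborel (\<lambda>t. case (x, t) of (x, t) \<Rightarrow> f x t)"
      using fx by (simp add: has_bochner_integral_iff)
  qed
  have "integrable lborel (\<lambda>t. LINT x|lborel. f x t)"
    using lborel_pair.integrable_snd[OF int] by simp
  moreover have "(LINT t|lborel. LINT x|lborel. f x t) = (LINT x|lborel. LINT t|lborel. f x t)"
    by (rule lborel_pair.Fubini_integral[OF int])
  moreover have "(LINT x|lborel. LINT t|lborel. f x t) = (LINT x|lborel. resolvent p (Complex x \<phi>))"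
    using fx by (simp add: has_bochner_integral_iff resolvent_def q_def)
  moreover have "(LINT x|lborel. f x t)
      = of_real (indicator {0<..} t * exp (- p * t)) * (LINT x|lborel. ray_integrand t x)" for t
  proof -
    have "(LINT x|lborel. f x t) = (LINT x|lborel. of_real (indicator {0<..} t * exp (- p * t)) * ray_integrand t x)"
      by (simp add: f_def scaleR_conv_of_real exp_of_real [symmetric])
    then show ?thesis
      by simp
  qed
  ultimately have "has_bochner_integral lborel
      (\<lambda>t. of_real (indicator {0<..} t * exp (- p * t)) * (LINT x|lborel. ray_integrand t x))
      (LINT x|lborel. resolvent p (Complex x \<phi>))"
    by (simp add: has_bochner_integral_iff)
  then have "has_bochner_integral lborel
      (\<lambda>t. Im (of_real (indicator {0<..} t * exp (- p * t)) * (LINT x|lborel. ray_integrand t x)) / pi)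
      (Im (LINT x|lborel. resolvent p (Complex x \<phi>)) / pi)"
    by (intro has_bochner_integral_divide has_bochner_integral_Im)
  then show ?thesis
    by (simp add: ray_integral_def mult.assoc)
qed

section \<open>Residue calculus in the logarithmic strip\<close>

abbreviation strip :: "complex set" where
  "strip \<equiv> {w. - (pi / a) < Im w} \<inter> {w. Im w < pi / a}"

lemma strip_bounds: "pi / a < pi" "\<phi> < pi / a"
  using a \<phi>_bounds by (auto simp: field_simps)

text \<open>The boundary lines of \<open>strip\<close> carry the zeros of the denominator nearest to
  the real axis. For \<open>w\<close> inside, \<open>a * w\<close> lies in the domain where
  \<open>Ln\<close> inverts \<open>exp\<close>, and \<open>Ln (-1)\<close> has imaginary part
  \<open>pi\<close>, which is not reached.\<close>

lemma kern_denominator_nonzero: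
  assumes "w \<in> strip"
  shows "exp (of_real a * w) + 1 \<noteq> 0"
proof
  assume "exp (of_real a * w) + 1 = 0"
  then have "exp (of_real a * w) = -1"
    by (simp add: add_eq_0_iff2)
  moreover have "- pi < a * Im w" "a * Im w < pi"
    using assms a by (auto simp: field_simps)
  ultimately have "Ln (-1) = of_real a * w"
    using Ln_exp[of "of_real a * w"] by simp
  then have "pi = a * Im w"
    by (metis Im_complex_of_real Ln_minus1 Re_complex_of_real add.right_neutral imaginary_unit.sel
        mult.right_neutral mult_eq_0_iff times_complex.sel(2) mult.commute mult_1)
  then show False
    using \<open>a * Im w < pi\<close> by simp
qed

lemma exp_eq_on_strip:
  assumes "w \<in> strip" "0 < p" "exp w = of_real p"
  shows "w = of_real (ln p)"
proof -
  have "- pi < Im w" "Im w \<le> pi"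
    using assms strip_bounds by auto
  then have "w = Ln (exp w)"
    by simp
  then show ?thesis
    using assms by (simp add: Ln_of_real)
qed

lemma holomorphic_on_kern: "kern holomorphic_on strip"
  unfolding kern_def by (intro holomorphic_intros) (use kern_denominator_nonzero in auto)

lemma open_strip: "open strip"
  by (intro open_Int open_halfspace_Im_gt open_halfspace_Im_lt)

lemma connected_strip: "connected strip"
  by (intro convex_connected convex_Int convex_halfspace_Im_gt convex_halfspace_Im_lt)

lemma holomorphic_on_resolvent:
  assumes "0 < p"
  shows "resolvent p holomorphic_on strip - {of_real (ln p)}"
  unfolding resolvent_def
  by (intro holomorphic_intros holomorphic_on_subset[OF holomorphic_on_kern])
    (use exp_eq_on_strip[OF _ assms] in auto)

lemma ln_in_strip: "complex_of_real r \<in> strip"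
  using a by (auto simp: field_simps)

text \<open>A simple pole: the difference quotient of \<open>exp\<close> at \<open>ln p\<close>
  tends to \<open>p\<close>, and the minus sign comes from \<open>p - exp w\<close>.\<close>

lemma residue_resolvent:
  assumes "0 < p"
  shows "residue (resolvent p) (of_real (ln p)) = - (kern (of_real (ln p)) / of_real p)"
proof (rule residue_simple'[OF open_strip ln_in_strip holomorphic_on_resolvent[OF assms]])
  define z where "z = complex_of_real (ln p)"
  have ez: "exp z = of_real p"
    using assms by (simp add: z_def exp_of_real)
  have "isCont kern z"
    using holomorphic_on_imp_continuous_on[OF holomorphic_on_kern] open_strip ln_in_strip
    by (simp add: continuous_on_eq_continuous_at z_def)
  then have k: "(kern \<longlongrightarrow> kern z) (at z)"
    by (simp add: isCont_def)
  have "(exp has_field_derivative exp z) (at z)"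
    by (rule DERIV_exp)
  then have "((\<lambda>w. (exp w - exp z) / (w - z)) \<longlongrightarrow> exp z) (at z)"
    by (simp add: has_field_derivative_iff)
  then have "((\<lambda>w. - (kern w / ((exp w - exp z) / (w - z)))) \<longlongrightarrow> - (kern z / exp z)) (at z)"
    by (intro tendsto_intros k) auto
  moreover have "- (kern w / ((exp w - exp z) / (w - z))) = resolvent p w * (w - z)" for w
    unfolding resolvent_def ez [symmetric]
    by (metis (no_types, lifting) divide_divide_eq_right minus_diff_eq minus_divide_right times_divide_eq_left)
  ultimately show "((\<lambda>w. resolvent p w * (w - complex_of_real (ln p)))
      \<longlongrightarrow> - (kern (of_real (ln p)) / of_real p)) (at (of_real (ln p)))"
    by (simp add: ez z_def [symmetric])
qed

lemma resolvent_cnj: "resolvent p (cnj w) = cnj (resolvent p w)"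
  by (simp add: resolvent_def kern_def exp_cnj)

text \<open>Bounds for the two vertical sides, uniform in \<open>Im w\<close>. Far to the right each
  factor of the denominator is at least half of its dominant exponential; far to the left each is at
  least \<open>1 / 2\<close>. Hence the constant 4 in both cases.\<close>

lemma norm_resolvent_le:
  assumes "1 < p" "w \<in> strip"
  shows "2 * p \<le> exp (Re w) \<Longrightarrow> 2 \<le> exp (a * Re w) \<Longrightarrow>
      norm (resolvent p w) \<le> 4 * exp (- Re w)"
    and "2 * exp (Re w) \<le> 1 \<Longrightarrow> 2 * exp (a * Re w) \<le> 1 \<Longrightarrow>
      norm (resolvent p w) \<le> 4 * exp ((a - b + 1) * Re w)"
proof -
  have n: "norm (resolvent p w) = exp ((a - b + 1) * Re w)
      / (norm (exp (of_real a * w) + 1) * norm (of_real p - exp w))"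
    by (simp add: resolvent_def kern_def norm_divide norm_mult)
  have n1: "norm (exp (of_real a * w)) - 1 \<le> norm (exp (of_real a * w) + 1)"
    "1 - norm (exp (of_real a * w)) \<le> norm (exp (of_real a * w) + 1)"
    using norm_triangle_ineq2[of "exp (of_real a * w)" "-1"]
      norm_triangle_ineq2[of "1" "- exp (of_real a * w)"] by (auto simp: add.commute)
  have n2: "norm (exp w) - p \<le> norm (of_real p - exp w)" "p - norm (exp w) \<le> norm (of_real p - exp w)"
    using norm_triangle_ineq2[of "exp w" "of_real p"] norm_triangle_ineq2[of "of_real p" "exp w"] assms
    by (auto simp: norm_minus_commute)
  show "norm (resolvent p w) \<le> 4 * exp (- Re w)"
    if "2 * p \<le> exp (Re w)" "2 \<le> exp (a * Re w)"
  proof -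
    have "exp (a * Re w) / 2 \<le> norm (exp (of_real a * w) + 1)"
      using n1 that by simp
    moreover have "exp (Re w) / 2 \<le> norm (of_real p - exp w)"
      using n2 that by simp
    ultimately have "exp (a * Re w) / 2 * (exp (Re w) / 2)
        \<le> norm (exp (of_real a * w) + 1) * norm (of_real p - exp w)"
      by (intro mult_mono) auto
    then have "norm (resolvent p w) \<le> exp ((a - b + 1) * Re w) / (exp (a * Re w) / 2 * (exp (Re w) / 2))"
      unfolding n by (intro divide_left_mono mult_pos_pos less_le_trans[OF _ \<open>_ \<le> norm (_ + 1) * _\<close>]) auto
    also have "\<dots> = 4 * exp ((a - b + 1) * Re w - a * Re w - Re w)"
      by (simp add: exp_diff)
    also have "\<dots> \<le> 4 * exp (- Re w)"
    proof -
      have "1 \<le> exp (Re w)"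
        using that assms by linarith
      then have "0 \<le> Re w"
        by simp
      then have "0 \<le> (b - 1) * Re w"
        using b by simp
      then show ?thesis
        by (simp add: algebra_simps)
    qed
    finally show ?thesis .
  qed
  show "norm (resolvent p w) \<le> 4 * exp ((a - b + 1) * Re w)"
    if "2 * exp (Re w) \<le> 1" "2 * exp (a * Re w) \<le> 1"
  proof -
    have "1 / 2 \<le> norm (exp (of_real a * w) + 1)"
      using n1 that by simp
    moreover have "1 / 2 \<le> norm (of_real p - exp w)"
      using n2 that assms by simp
    ultimately have "1 / 2 * (1 / 2) \<le> norm (exp (of_real a * w) + 1) * norm (of_real p - exp w)"
      by (intro mult_mono) auto
    then have "norm (resolvent p w) \<le> exp ((a - b + 1) * Re w) / (1 / 2 * (1 / 2))"
      unfolding n by (intro divide_left_mono mult_pos_pos less_le_trans[OF _ \<open>_ \<le> norm (_ + 1) * _\<close>]) auto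
    then show ?thesis
      by simp
  qed
qed

text \<open>The rectangle has its horizontal sides on \<open>Im w = \<phi>\<close> and
  \<open>Im w = - \<phi>\<close>. Counterclockwise, the top contributes \<open>- J\<close> and the
  bottom, by reflection, \<open>cnj J\<close>. The condition \<open>ln p < R\<close> puts the only
  pole inside.\<close>

lemma residue_identity:
  assumes p: "1 < p" and R: "ln p < R"
  defines "V y \<equiv> contour_integral (linepath (Complex y (- \<phi>)) (Complex y \<phi>)) (resolvent p)"
  defines "J \<equiv> integral {- R..R} (\<lambda>x. resolvent p (Complex x \<phi>))"
  shows "cnj J - J + V R - V (- R) = - (2 * pi * \<i> * (kern (of_real (ln p)) / of_real p))"
    and "resolvent p contour_integrable_on linepath (Complex R (- \<phi>)) (Complex R \<phi>)"
    and "resolvent p contour_integrable_on linepath (Complex (- R) (- \<phi>)) (Complex (- R) \<phi>)"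
proof -
  define z where "z = complex_of_real (ln p)"
  have lnp: "0 < ln p" "0 < R" "0 < p"
    using p R ln_gt_zero[OF p] by linarith+
  define a1 a2 a3 a4 where "a1 = Complex (- R) (- \<phi>)" and "a2 = Complex R (- \<phi>)"
    and "a3 = Complex R \<phi>" and "a4 = Complex (- R) \<phi>"
  note as = a1_def a2_def a3_def a4_def
  have zbox: "z \<in> box a1 a3"
  proof -
    have "- R < ln p"
      using lnp by linarith
    then show ?thesis
      unfolding in_box_complex_iff z_def as complex.sel Re_complex_of_real Im_complex_of_real
        greaterThanLessThan_iff
      using R \<phi>_bounds(1) by (intro conjI) linarith+
  qed
  have "cbox a1 a3 \<subseteq> strip"
    using strip_bounds by (auto simp: in_cbox_complex_iff as)
  moreover have pim: "path_image (rectpath a1 a3) = cbox a1 a3 - box a1 a3"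
    using lnp \<phi>_bounds by (intro path_image_rectpath_cbox_minus_box) (auto simp: as)
  ultimately have sub: "path_image (rectpath a1 a3) \<subseteq> strip - {z}"
    using zbox by auto
  have "contour_integral (rectpath a1 a3) (resolvent p)
      = 2 * pi * \<i> * (\<Sum>w\<in>{z}. winding_number (rectpath a1 a3) w * residue (resolvent p) w)"
  proof (rule Residue_theorem[OF open_strip connected_strip])
    show "resolvent p holomorphic_on strip - {z}"
      unfolding z_def by (rule holomorphic_on_resolvent) (use p in auto)
    show "\<forall>w. w \<notin> strip \<longrightarrow> winding_number (rectpath a1 a3) w = 0"
      using \<open>cbox a1 a3 \<subseteq> strip\<close> lnp \<phi>_bounds
      by (intro allI impI winding_number_rectpath_outside) (auto simp: as)
  qed (use sub in auto)
  also have "\<dots> = - (2 * pi * \<i> * (kern z / of_real p))"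
    using winding_number_rectpath[OF zbox] residue_resolvent[OF lnp(3)] by (simp add: z_def)
  finally have res: "contour_integral (rectpath a1 a3) (resolvent p) = - (2 * pi * \<i> * (kern z / of_real p))" .
  have rp: "rectpath a1 a3 = linepath a1 a2 +++ linepath a2 a3 +++ linepath a3 a4 +++ linepath a4 a1"
    by (simp add: rectpath_def as Let_def)
  have cs: "closed_segment a1 a2 \<subseteq> strip - {z}" "closed_segment a2 a3 \<subseteq> strip - {z}"
    "closed_segment a3 a4 \<subseteq> strip - {z}" "closed_segment a4 a1 \<subseteq> strip - {z}"
    using sub unfolding rp by (auto simp: path_image_join)
  have cont: "continuous_on (strip - {z}) (resolvent p)"
    using holomorphic_on_imp_continuous_on[OF holomorphic_on_resolvent[OF lnp(3)]] by (simp add: z_def)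
  have ci: "resolvent p contour_integrable_on linepath a1 a2" "resolvent p contour_integrable_on linepath a2 a3"
    "resolvent p contour_integrable_on linepath a3 a4" "resolvent p contour_integrable_on linepath a4 a1"
    by (intro contour_integrable_continuous_linepath continuous_on_subset[OF cont] cs)+
  then show "resolvent p contour_integrable_on linepath (Complex R (- \<phi>)) (Complex R \<phi>)"
    by (simp add: as)
  show "resolvent p contour_integrable_on linepath (Complex (- R) (- \<phi>)) (Complex (- R) \<phi>)"
    using contour_integrable_continuous_linepath[OF continuous_on_subset[OF cont], of a1 a4] cs(4)
    by (simp add: as closed_segment_commute)
  have "contour_integral (rectpath a1 a3) (resolvent p)
     = contour_integral (linepath a1 a2) (resolvent p) + contour_integral (linepath a2 a3) (resolvent p)
       + contour_integral (linepath a3 a4) (resolvent p) + contour_integral (linepath a4 a1) (resolvent p)"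
    unfolding rp using ci by (simp add: contour_integrable_join add.assoc)
  moreover have "contour_integral (linepath a3 a4) (resolvent p) = - J"
    using lnp cs by (subst contour_integral_reverse_linepath)
      (auto simp: as J_def contour_integral_linepath_horizontal intro: continuous_on_subset[OF cont])
  moreover have "contour_integral (linepath a1 a2) (resolvent p) = cnj J"
  proof -
    have "resolvent p (Complex x (- \<phi>)) = cnj (resolvent p (Complex x \<phi>))" for x
      using resolvent_cnj[of p "Complex x \<phi>"] by (simp add: complex_cnj)
    then show ?thesis
      using lnp by (simp add: as contour_integral_linepath_horizontal J_def integral_cnj)
  qed
  moreover have "contour_integral (linepath a4 a1) (resolvent p) = - V (- R)"
    using cs by (subst contour_integral_reverse_linepath)
      (auto simp: as V_def intro: continuous_on_subset[OF cont])
  moreover have "contour_integral (linepath a2 a3) (resolvent p) = V R"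
    by (simp add: as V_def)
  ultimately show "cnj J - J + V R - V (- R) = - (2 * pi * \<i> * (kern (of_real (ln p)) / of_real p))"
    using res by (simp add: z_def algebra_simps)
qed

text \<open>Both vertical sides vanish as the rectangle grows, the left one because
  \<open>a - b + 1 > 0\<close>. What remains is \<open>cnj T - T\<close>, whose imaginary part is
  \<open>- 2 * Im T\<close>.\<close>

lemma Im_integral_resolvent:
  assumes p: "1 < p"
  shows "Im (LINT x|lborel. resolvent p (Complex x \<phi>)) = pi * (p powr (a - b) / (p powr a + 1))"
proof -
  define V where "V y = contour_integral (linepath (Complex y (- \<phi>)) (Complex y \<phi>)) (resolvent p)" for y
  define J where "J n = integral {- real n..real n} (\<lambda>x. resolvent p (Complex x \<phi>))" for n
  define T where "T = (LINT x|lborel. resolvent p (Complex x \<phi>))"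
  have int: "integrable lborel (\<lambda>x. resolvent p (Complex x \<phi>))"
    using p by (intro integrable_resolvent_ray) auto
  have "J \<longlonglongrightarrow> T"
  proof -
    have "(\<lambda>n. LINT x|lborel. indicator {- real n..real n} x *\<^sub>R resolvent p (Complex x \<phi>)) \<longlonglongrightarrow> T"
      unfolding T_def
    proof (rule integral_dominated_convergence[OF _ _ integrable_norm[OF int]])
      show "AE x in lborel. (\<lambda>n. indicator {- real n..real n} x *\<^sub>R resolvent p (Complex x \<phi>))
          \<longlonglongrightarrow> resolvent p (Complex x \<phi>)"
      proof (rule AE_I2, rule tendsto_eventually)
        fix x :: real
        show "\<forall>\<^sub>F n in sequentially. indicator {- real n..real n} x *\<^sub>R resolvent p (Complex x \<phi>)
            = resolvent p (Complex x \<phi>)"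
          using eventually_ge_at_top[of "nat \<lceil>\<bar>x\<bar>\<rceil>"]
        proof eventually_elim
          case (elim n)
          then have "\<bar>x\<bar> \<le> real n"
            by linarith
          then show ?case
            by (auto simp: indicator_def)
        qed
      qed
    qed (use int in \<open>auto simp: indicator_def\<close>)
    moreover have "J n = (LINT x|lborel. indicator {- real n..real n} x *\<^sub>R resolvent p (Complex x \<phi>))" for n
    proof -
      have "set_integrable lborel {- real n..real n} (\<lambda>x. resolvent p (Complex x \<phi>))"
        unfolding set_integrable_def using int by (intro integrable_mult_indicator) auto
      then show ?thesis
        by (simp add: J_def set_borel_integral_eq_integral(2) [symmetric] set_lebesgue_integral_def)
    qed
    ultimately show ?thesis
      by presburger
  qed
  \<comment> \<open>The length of a vertical side is \<open>2 * \<phi>\<close>, independent of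
    \<open>y\<close>.\<close>
  have nV: "norm (V y) \<le> B * (2 * \<phi>)"
    if "resolvent p contour_integrable_on linepath (Complex y (- \<phi>)) (Complex y \<phi>)"
      "0 \<le> B" "\<And>w. w \<in> strip \<Longrightarrow> Re w = y \<Longrightarrow> norm (resolvent p w) \<le> B" for y B
  proof -
    have "norm (V y) \<le> B * norm (Complex y \<phi> - Complex y (- \<phi>))"
      unfolding V_def
    proof (rule contour_integral_bound_linepath[OF that(1,2)])
      fix w assume "w \<in> closed_segment (Complex y (- \<phi>)) (Complex y \<phi>)"
      then show "norm (resolvent p w) \<le> B"
        using \<phi>_bounds strip_bounds
        by (intro that(3)) (auto simp: closed_segment_same_Re closed_segment_eq_real_ivl)
    qed
    also have "norm (Complex y \<phi> - Complex y (- \<phi>)) = 2 * \<phi>"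
      using \<phi>_bounds by (simp add: cmod_def real_sqrt_mult)
    finally show ?thesis .
  qed
  have le: "\<forall>\<^sub>F n in sequentially. M \<le> exp (s * real n)" if "0 < s" for M s :: real
  proof -
    have "filterlim (\<lambda>n. exp (s * real n)) at_top sequentially"
      using that by real_asymp
    then show ?thesis
      by (simp add: filterlim_at_top)
  qed
  have R: "\<forall>\<^sub>F n in sequentially. ln p < real n"
    using eventually_gt_at_top[of "nat \<lceil>ln p\<rceil>"] by eventually_elim linarith
  have "(\<lambda>n. V (real n)) \<longlonglongrightarrow> 0"
  proof (rule Lim_null_comparison)
    show "\<forall>\<^sub>F n in sequentially. norm (V (real n)) \<le> 4 * exp (- real n) * (2 * \<phi>)"
    proof -
      have "\<forall>\<^sub>F n in sequentially. 2 * p \<le> exp (1 * real n)" "\<forall>\<^sub>F n in sequentially. 2 \<le> exp (a * real n)"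
        using a by (intro le; simp)+
      then show ?thesis
        using R
      proof eventually_elim
        case (elim n)
        show ?case
        proof (intro nV residue_identity(2)[OF p elim(3)])
          fix w assume "w \<in> strip" "Re w = real n"
          then show "norm (resolvent p w) \<le> 4 * exp (- real n)"
            using norm_resolvent_le(1)[OF p, of w] elim by simp
        qed auto
      qed
    qed
    show "(\<lambda>n. 4 * exp (- real n) * (2 * \<phi>)) \<longlonglongrightarrow> 0"
      by real_asymp
  qed
  moreover have "(\<lambda>n. V (- real n)) \<longlonglongrightarrow> 0"
  proof (rule Lim_null_comparison)
    have "\<forall>\<^sub>F n in sequentially. 2 \<le> exp (1 * real n)" "\<forall>\<^sub>F n in sequentially. 2 \<le> exp (a * real n)"
      using a by (intro le; simp)+
    then show "\<forall>\<^sub>F n in sequentially. norm (V (- real n)) \<le> 4 * exp ((a - b + 1) * (- real n)) * (2 * \<phi>)"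
      using R
    proof eventually_elim
      case (elim n)
      show ?case
      proof (intro nV residue_identity(3)[OF p elim(3)])
        fix w assume "w \<in> strip" "Re w = - real n"
        then show "norm (resolvent p w) \<le> 4 * exp ((a - b + 1) * (- real n))"
          using norm_resolvent_le(2)[OF p, of w] elim by (auto simp: exp_minus field_simps)
      qed auto
    qed
    show "(\<lambda>n. 4 * exp ((a - b + 1) * (- real n)) * (2 * \<phi>)) \<longlonglongrightarrow> 0"
      using exponent_bounds(1) by real_asymp
  qed
  ultimately have "(\<lambda>n. cnj (J n) - J n + V (real n) - V (- real n)) \<longlonglongrightarrow> cnj T - T + 0 - 0"
    using \<open>J \<longlonglongrightarrow> T\<close> by (intro tendsto_intros)
  moreover have "\<forall>\<^sub>F n in sequentially. cnj (J n) - J n + V (real n) - V (- real n)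
      = - (2 * pi * \<i> * (kern (of_real (ln p)) / of_real p))"
    using R
  proof eventually_elim
    case (elim n)
    show ?case
      using residue_identity(1)[OF p elim] unfolding J_def V_def by simp
  qed
  ultimately have "cnj T - T + 0 - 0 = - (2 * pi * \<i> * (kern (of_real (ln p)) / of_real p))"
    by (intro LIMSEQ_const_iff [THEN iffD1, symmetric]) (rule Lim_transform_eventually)
  then have "Im (cnj T - T) = Im (- (2 * pi * \<i> * (kern (of_real (ln p)) / of_real p)))"
    by simp
  also have "kern (of_real (ln p)) / of_real p = of_real (p powr (a - b) / (p powr a + 1))"
  proof -
    have e: "exp (of_real r * of_real (ln p)) = complex_of_real (p powr r)" for r
      using p by (simp add: powr_def flip: of_real_mult exp_of_real)
    have "p powr (a - b + 1) = p powr (a - b) * p"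
      using p by (simp add: powr_add)
    then show ?thesis
      unfolding kern_def e using p by simp
  qed
  finally show ?thesis
    by (simp add: T_def)
qed

section \<open>The Mittag-Leffler function as a ray integral, and its decay\<close>

lemma mittag_leffler_eq_ray_integral:
  assumes "0 < t"
  shows "t powr (b - 1) * mittag_leffler a b (- (t powr a)) = ray_integral t"
proof -
  define h where "h t = t powr (b - 1) * mittag_leffler a b (- (t powr a)) - ray_integral t" for t
  have "h t = 0"
  proof (rule laplace_uniqueness[OF _ _ assms])
    show "continuous_on {0<..} h"
      unfolding h_def using a b
      by (intro continuous_intros continuous_on_ray_integral
        continuous_on_compose2[OF continuous_on_mittag_leffler[of a b UNIV]]) auto
    fix p :: real assume p: "2 \<le> p"
    have "has_bochner_integral lborel
      (\<lambda>t. indicator {0<..} t * (exp (- p * t) * (t powr (b - 1) * mittag_leffler a b (- (t powr a))))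
        - indicator {0<..} t * (exp (- p * t) * ray_integral t))
      (p powr (a - b) / (p powr a + 1) - Im (LINT x|lborel. resolvent p (Complex x \<phi>)) / pi)"
      using a b p by (intro has_bochner_integral_diff has_bochner_integral_laplace_mittag_leffler
        has_bochner_integral_laplace_ray_integral) auto
    then show "has_bochner_integral lborel (\<lambda>t. indicator {0<..} t * (exp (- p * t) * h t)) 0"
      using p by (simp add: Im_integral_resolvent h_def right_diff_distrib)
  qed
  then show ?thesis
    by (simp add: h_def)
qed

lemma mittag_leffler_sector_bound: "\<exists>D>0. \<forall>x\<ge>0. \<bar>mittag_leffler a b (- x)\<bar> \<le> D / (1 + x)"
proof -
  obtain C where C: "0 \<le> C" "\<And>t. 0 < t \<Longrightarrow> \<bar>ray_integral t\<bar> \<le> C * t powr (- (a - b + 1))"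
    by (rule ray_integral_bound) blast
  have far: "\<bar>mittag_leffler a b (- x)\<bar> \<le> C / x" if "0 < x" for x
  proof -
    \<comment> \<open>This turns the argument into \<open>- (t powr a)\<close>; the powers
      \<open>1 - b\<close> and \<open>- (a - b + 1)\<close> of \<open>t\<close> then add up to
      \<open>- a\<close>, which is \<open>1 / x\<close>.\<close>
    define t where "t = x powr (1 / a)"
    have t: "0 < t" "t powr a = x"
      using that a by (auto simp: t_def powr_powr)
    have "mittag_leffler a b (- x) = t powr (1 - b) * ray_integral t"
      unfolding mittag_leffler_eq_ray_integral[OF t(1), symmetric] t(2) mult.assoc [symmetric]
      using t(1) by (simp flip: powr_add)
    also have "\<bar>\<dots>\<bar> \<le> t powr (1 - b) * (C * t powr (- (a - b + 1)))"
      using C(2)[OF t(1)] by (simp add: abs_mult mult_left_mono)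
    also have "\<dots> = C * (t powr (1 - b) * t powr (- (a - b + 1)))"
      by simp
    also have "t powr (1 - b) * t powr (- (a - b + 1)) = 1 / x"
      unfolding t(2) [symmetric] using t(1) by (simp add: powr_add [symmetric] powr_minus_divide [symmetric])
    finally show ?thesis
      by simp
  qed
  have "compact (mittag_leffler a b ` {-1..0})"
    using a b by (intro compact_continuous_image continuous_on_mittag_leffler) auto
  then obtain B where B: "\<And>y. y \<in> {-1..0} \<Longrightarrow> \<bar>mittag_leffler a b y\<bar> \<le> B"
    using compact_imp_bounded[of "mittag_leffler a b ` {-1..0}"] by (force simp: bounded_iff)
  \<comment> \<open>The 2 covers \<open>1 + x \<le> 2\<close> on \<open>{0..1}\<close> and
    \<open>1 + x \<le> 2 * x\<close> beyond; the final 1 makes \<open>D\<close> positive.\<close>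
  define D where "D = 2 * (\<bar>B\<bar> + C) + 1"
  have "\<bar>mittag_leffler a b (- x)\<bar> \<le> D / (1 + x)" if x: "0 \<le> x" for x
  proof (cases "x \<le> 1")
    case True
    then have "\<bar>mittag_leffler a b (- x)\<bar> \<le> \<bar>B\<bar>"
      using x B[of "- x"] by auto
    then have "\<bar>mittag_leffler a b (- x)\<bar> * (1 + x) \<le> \<bar>B\<bar> * 2"
      using x True by (intro mult_mono) auto
    also have "\<dots> \<le> D"
      using C by (simp add: D_def)
    finally show ?thesis
      using x by (simp add: field_simps)
  next
    case False
    have "\<bar>mittag_leffler a b (- x)\<bar> \<le> C / x"
      using False by (intro far) auto
    then have "\<bar>mittag_leffler a b (- x)\<bar> * x \<le> C"
      using False by (simp add: field_simps)
    moreover have "\<bar>mittag_leffler a b (- x)\<bar> * 1 \<le> \<bar>mittag_leffler a b (- x)\<bar> * x"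
      using False by (intro mult_left_mono) auto
    ultimately have "\<bar>mittag_leffler a b (- x)\<bar> * (1 + x) \<le> 2 * C"
      by (simp add: algebra_simps)
    also have "\<dots> \<le> D"
      using C by (simp add: D_def)
    finally show ?thesis
      using False by (simp add: field_simps)
  qed
  moreover have "0 < D"
    using C by (simp add: D_def)
  ultimately show ?thesis
    by blast
qed

end

theorem mittag_leffler_bound:
  assumes "1 < a" "a < 2" "1 \<le> b" "b \<le> 2"
  shows "\<exists>D>0. \<forall>x\<ge>0. \<bar>mittag_leffler a b (- x)\<bar> \<le> D / (1 + x)"
proof -
  \<comment> \<open>The midpoint of the interval from \<open>pi / 2\<close> to
    \<open>pi / a\<close>, which is nonempty because \<open>a < 2\<close>.\<close>
  interpret mittag_leffler_sector a b "(pi / 2 + pi / a) / 2"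
  proof
    have "pi / 2 < pi / a"
      using assms by (intro divide_strict_left_mono) auto
    then show "pi / 2 < (pi / 2 + pi / a) / 2"
      using field_sum_of_halves[of "pi / 2"] by argo
    have "(pi / 2 + pi / a) / 2 * a = (pi * (a / 2) + pi) / 2"
      using assms by (simp add: field_simps)
    also have "\<dots> < pi"
      using assms by simp
    finally show "(pi / 2 + pi / a) / 2 * a < pi" .
  qed (use assms in auto)
  show ?thesis
    by (rule mittag_leffler_sector_bound)
qed

section \<open>Series of eigenfunctions in \<open>L\<^sup>2(0,1)\<close>\<close>

lemma L2_representative:
  obtains f where "square_integrable01 f" "u = abs_L2 f"
  by (induction u rule: L2.abs_induct) (auto simp: L2_rel_def)

lemma L2_rel_refl: "square_integrable01 f \<Longrightarrow> L2_rel f f"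
  by (simp add: L2_rel_def)

lemma square_integrable01_diff:
  assumes "square_integrable01 f" "square_integrable01 g"
  shows "square_integrable01 (\<lambda>x. f x - g x)"
  using square_integrable01_add[OF assms(1) square_integrable01_scale[OF assms(2), of "-1"]] by simp

lemma abs_L2_diff:
  assumes "square_integrable01 f" "square_integrable01 g"
  shows "abs_L2 f - abs_L2 g = abs_L2 (\<lambda>x. f x - g x)"
proof -
  have g: "square_integrable01 (\<lambda>x. - g x)"
    using square_integrable01_scale[OF assms(2), of "-1"] by simp
  show ?thesis
    unfolding minus_L2_def
    using uminus_L2.abs_eq[OF L2_rel_refl[OF assms(2)]]
      plus_L2.abs_eq[OF L2_rel_refl[OF assms(1)] L2_rel_refl[OF g]] by simp
qed

lemma norm_abs_L2_power2:
  assumes "square_integrable01 f"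
  shows "(norm (abs_L2 f))\<^sup>2 = (\<integral>x. (f x)\<^sup>2 \<partial>unit_interval_measure)"
  using inner_L2.abs_eq[OF L2_rel_refl[OF assms] L2_rel_refl[OF assms]]
  unfolding power2_norm_eq_inner by (simp add: power2_eq_square)

lemma borel_measurable_square_integrable01:
  "square_integrable01 f \<Longrightarrow> f \<in> borel_measurable unit_interval_measure"
  by (simp add: square_integrable01_def)

lemma nn_integral_power2_abs_L2:
  assumes "square_integrable01 f"
  shows "(\<integral>\<^sup>+x. ennreal ((f x)\<^sup>2) \<partial>unit_interval_measure) = ennreal ((norm (abs_L2 f))\<^sup>2)"
  unfolding norm_abs_L2_power2[OF assms]
  using assms by (intro nn_integral_eq_integral) (auto simp: square_integrable01_def)

text \<open>Pointwise \<open>\<bar>f x\<bar> \<le> (f x)\<^sup>2 / \<epsilon> + \<epsilon>\<close>,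
  and the interval has measure 1, so each summand integrates to at most
  \<open>\<epsilon>\<close>.\<close>

lemma nn_integral_abs_le:
  assumes f: "square_integrable01 f" and "norm (abs_L2 f) \<le> \<epsilon>" "0 < \<epsilon>"
  shows "(\<integral>\<^sup>+x. ennreal \<bar>f x\<bar> \<partial>unit_interval_measure) \<le> ennreal (2 * \<epsilon>)"
proof -
  have bd: "ennreal \<bar>f x\<bar> \<le> ennreal ((f x)\<^sup>2 / \<epsilon>) + ennreal \<epsilon>" for x
  proof -
    have "0 \<le> (\<bar>f x\<bar> - \<epsilon>)\<^sup>2" "0 \<le> \<bar>f x\<bar> * \<epsilon>"
      using assms by auto
    then have "\<bar>f x\<bar> * \<epsilon> \<le> (f x)\<^sup>2 + \<epsilon>\<^sup>2"
      by (simp add: power2_diff)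
    then have "\<bar>f x\<bar> \<le> (f x)\<^sup>2 / \<epsilon> + \<epsilon>"
      using assms(3) by (simp add: field_simps power2_eq_square)
    then show ?thesis
      using assms(3) by (simp add: ennreal_plus [symmetric] del: ennreal_plus)
  qed
  have mf: "f \<in> borel_measurable unit_interval_measure"
    using f by (rule borel_measurable_square_integrable01)
  have "(\<integral>\<^sup>+x. ennreal \<bar>f x\<bar> \<partial>unit_interval_measure)
      \<le> (\<integral>\<^sup>+x. (ennreal ((f x)\<^sup>2 / \<epsilon>) + ennreal \<epsilon>) \<partial>unit_interval_measure)"
    by (intro nn_integral_mono bd)
  also have "\<dots> = (\<integral>\<^sup>+x. ennreal ((f x)\<^sup>2 / \<epsilon>) \<partial>unit_interval_measure)
      + (\<integral>\<^sup>+x. ennreal \<epsilon> \<partial>unit_interval_measure)"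
    using mf by (intro nn_integral_add) auto
  also have "(\<integral>\<^sup>+x. ennreal \<epsilon> \<partial>unit_interval_measure) = ennreal \<epsilon>"
    by (simp add: emeasure_restrict_space)
  also have "(\<integral>\<^sup>+x. ennreal ((f x)\<^sup>2 / \<epsilon>) \<partial>unit_interval_measure)
      = (\<integral>\<^sup>+x. ennreal ((f x)\<^sup>2) / ennreal \<epsilon> \<partial>unit_interval_measure)"
    using assms(3) by (simp add: divide_ennreal)
  also have "\<dots> = ennreal ((norm (abs_L2 f))\<^sup>2) / ennreal \<epsilon>"
    using mf nn_integral_power2_abs_L2[OF f] by (subst nn_integral_divide) auto
  also have "\<dots> = ennreal ((norm (abs_L2 f))\<^sup>2 / \<epsilon>)"
    using assms(3) by (simp add: divide_ennreal)
  also have "\<dots> \<le> ennreal \<epsilon>"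
  proof (rule ennreal_leI)
    have "(norm (abs_L2 f))\<^sup>2 \<le> \<epsilon>\<^sup>2"
      using assms(2) by (intro power_mono) auto
    then show "(norm (abs_L2 f))\<^sup>2 / \<epsilon> \<le> \<epsilon>"
      using assms(3) by (simp add: field_simps power2_eq_square)
  qed
  finally show ?thesis
    using assms(3) by (simp add: ennreal_plus [symmetric] del: ennreal_plus)
qed

lemma Cauchy_fast_subsequence:
  fixes X :: "nat \<Rightarrow> 'a::metric_space"
  assumes "Cauchy X"
  obtains r where "strict_mono r" "\<And>k. dist (X (r (Suc k))) (X (r k)) \<le> (1 / 2) ^ k"
proof -
  have "\<exists>N. \<forall>m\<ge>N. \<forall>n\<ge>N. dist (X m) (X n) < (1 / 2) ^ k" for k :: nat
    using assms by (auto simp: Cauchy_def)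
  then obtain N where N: "\<And>k m n. m \<ge> N k \<Longrightarrow> n \<ge> N k \<Longrightarrow> dist (X m) (X n) < (1 / 2 :: real) ^ k"
    by metis
  \<comment> \<open>The sum dominates \<open>N k\<close>; adding \<open>k\<close> makes the sequence
    strictly increasing.\<close>
  define r where "r k = (\<Sum>j\<le>k. N j) + k" for k
  have "strict_mono r"
    by (rule strict_monoI_Suc) (simp add: r_def)
  moreover have "dist (X (r (Suc k))) (X (r k)) \<le> (1 / 2) ^ k" for k
  proof -
    have "N k \<le> r k" "r k \<le> r (Suc k)"
      using \<open>strict_mono r\<close> strict_mono_leD[of r k "Suc k"]
      by (auto simp: r_def intro!: trans_le_add1 member_le_sum)
    then show ?thesis
      using N[of k "r (Suc k)" "r k"] by simp
  qed
  ultimately show ?thesis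
    by (rule that)
qed

text \<open>The Riesz-Fischer argument. Along a fast subsequence the increments have summable
  integrals of absolute values, so representatives converge almost everywhere; Fatou's lemma shows
  that the pointwise limit is also the limit in norm.\<close>

theorem L2_Cauchy_convergent:
  fixes X :: "nat \<Rightarrow> L2"
  assumes X: "Cauchy X"
  shows "convergent X"
proof -
  have "\<forall>n. \<exists>f. square_integrable01 f \<and> X n = abs_L2 f"
    by (metis L2_representative)
  then obtain F where F: "\<And>n. square_integrable01 (F n)" "\<And>n. X n = abs_L2 (F n)"
    by metis
  obtain r where r: "strict_mono r" "\<And>k. dist (X (r (Suc k))) (X (r k)) \<le> (1 / 2) ^ k"
    using Cauchy_fast_subsequence[OF X] by blast
  define G where "G k = F (r k)" for k
  have G: "square_integrable01 (G k)" for k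
    by (simp add: G_def F)
  have mF: "F n \<in> borel_measurable unit_interval_measure" for n
    using F by (intro borel_measurable_square_integrable01)
  have mG: "G n \<in> borel_measurable unit_interval_measure" for n
    using G by (rule borel_measurable_square_integrable01)
  have l1: "(\<integral>\<^sup>+x. ennreal \<bar>G (Suc k) x - G k x\<bar> \<partial>unit_interval_measure) \<le> ennreal (2 * (1 / 2) ^ k)" for k
    using r(2)[of k] by (intro nn_integral_abs_le square_integrable01_diff G)
      (simp_all add: dist_norm F abs_L2_diff G_def)
  have "(\<integral>\<^sup>+x. (\<Sum>k. ennreal \<bar>G (Suc k) x - G k x\<bar>) \<partial>unit_interval_measure)
      = (\<Sum>k. \<integral>\<^sup>+x. ennreal \<bar>G (Suc k) x - G k x\<bar> \<partial>unit_interval_measure)"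
    using mG by (intro nn_integral_suminf) auto
  also have "\<dots> \<le> (\<Sum>k. ennreal (2 * (1 / 2) ^ k))"
    by (intro suminf_le l1) auto
  also have "\<dots> < \<infinity>"
    by (subst suminf_ennreal2) (auto intro!: summable_mult summable_geometric)
  finally have "AE x in unit_interval_measure. (\<Sum>k. ennreal \<bar>G (Suc k) x - G k x\<bar>) \<noteq> \<infinity>"
    using mG by (intro nn_integral_noteq_infinite) auto
  then have conv: "AE x in unit_interval_measure. convergent (\<lambda>k. G k x)"
  proof eventually_elim
    case (elim x)
    then have "summable (\<lambda>k. \<bar>G (Suc k) x - G k x\<bar>)"
      by (intro summable_suminf_not_top) auto
    then have "summable (\<lambda>k. G (Suc k) x - G k x)"
      by (rule summable_rabs_cancel)
    then have "convergent (\<lambda>n. \<Sum>k<n. G (Suc k) x - G k x)"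
      by (simp add: summable_iff_convergent)
    then have "convergent (\<lambda>n. G n x - G 0 x)"
      by (simp add: sum_lessThan_telescope[of "\<lambda>n. G n x"])
    then show ?case
      using convergent_add[of "\<lambda>n. G n x - G 0 x" "\<lambda>n. G 0 x"] by (simp add: convergent_const)
  qed
  define f where "f x = lim (\<lambda>k. G k x)" for x
  have mf: "f \<in> borel_measurable unit_interval_measure"
    unfolding f_def using mG by (rule borel_measurable_lim_metric)
  have lim: "AE x in unit_interval_measure. (\<lambda>k. G k x) \<longlonglongrightarrow> f x"
    using conv by eventually_elim (simp add: f_def convergent_LIMSEQ_iff)
  \<comment> \<open>Used twice: with \<open>e = 1\<close> to see that \<open>f\<close> is square
    integrable, and with \<open>e / 2\<close> for the convergence of the whole sequence.\<close>
  have fatou: "(\<integral>\<^sup>+x. ennreal ((F n x - f x)\<^sup>2) \<partial>unit_interval_measure) \<le> ennreal (e\<^sup>2)"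
    if n: "\<And>m. m \<ge> N \<Longrightarrow> dist (X n) (X m) \<le> e" and e: "0 \<le> e" for n N e
  proof -
    have "(\<integral>\<^sup>+x. ennreal ((F n x - f x)\<^sup>2) \<partial>unit_interval_measure)
        = (\<integral>\<^sup>+x. liminf (\<lambda>k. ennreal ((F n x - G k x)\<^sup>2)) \<partial>unit_interval_measure)"
    proof (rule nn_integral_cong_AE)
      show "AE x in unit_interval_measure. ennreal ((F n x - f x)\<^sup>2) = liminf (\<lambda>k. ennreal ((F n x - G k x)\<^sup>2))"
        using lim
      proof eventually_elim
        case (elim x)
        then have "(\<lambda>k. ennreal ((F n x - G k x)\<^sup>2)) \<longlonglongrightarrow> ennreal ((F n x - f x)\<^sup>2)"
          by (intro tendsto_intros)
        then show ?case
          by (intro lim_imp_Liminf [symmetric]) auto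
      qed
    qed
    also have "\<dots> \<le> liminf (\<lambda>k. \<integral>\<^sup>+x. ennreal ((F n x - G k x)\<^sup>2) \<partial>unit_interval_measure)"
      using mF mG by (intro nn_integral_liminf) auto
    also have "\<dots> \<le> ennreal (e\<^sup>2)"
    proof (rule Liminf_le)
      have "\<forall>\<^sub>F k in sequentially. N \<le> r k"
        using filterlim_subseq[OF r(1)] by (simp add: filterlim_at_top)
      then show "\<forall>\<^sub>F k in sequentially. (\<integral>\<^sup>+x. ennreal ((F n x - G k x)\<^sup>2) \<partial>unit_interval_measure) \<le> ennreal (e\<^sup>2)"
      proof eventually_elim
        case (elim k)
        have "(\<integral>\<^sup>+x. ennreal ((F n x - G k x)\<^sup>2) \<partial>unit_interval_measure) = ennreal ((dist (X n) (X (r k)))\<^sup>2)"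
          using F G by (simp add: nn_integral_power2_abs_L2 square_integrable01_diff dist_norm abs_L2_diff G_def)
        also have "\<dots> \<le> ennreal (e\<^sup>2)"
          using n[OF elim] by (intro ennreal_leI power_mono) auto
        finally show ?case .
      qed
    qed simp
    finally show ?thesis .
  qed
  have sqi: "square_integrable01 (\<lambda>x. F n x - f x)"
    if "(\<integral>\<^sup>+x. ennreal ((F n x - f x)\<^sup>2) \<partial>unit_interval_measure) \<le> ennreal (e\<^sup>2)" for n e
    unfolding square_integrable01_def using mF mf that
    by (auto intro!: integrableI_bounded simp: le_less_trans[OF _ ennreal_less_top])
  obtain N1 where N1: "\<And>m n. m \<ge> N1 \<Longrightarrow> n \<ge> N1 \<Longrightarrow> dist (X m) (X n) < 1"
    using X unfolding Cauchy_def by (metis zero_less_one)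
  have "square_integrable01 (\<lambda>x. F N1 x - f x)"
    by (rule sqi[of _ 1], rule fatou[of N1]) (use N1 in \<open>auto intro: less_imp_le\<close>)
  then have "square_integrable01 (\<lambda>x. F N1 x - (F N1 x - f x))"
    by (rule square_integrable01_diff[OF F(1)])
  then have f: "square_integrable01 f"
    by simp
  have "X \<longlonglongrightarrow> abs_L2 f"
  proof (rule LIMSEQ_I)
    fix e :: real assume e: "0 < e"
    then obtain N where N: "\<And>m n. m \<ge> N \<Longrightarrow> n \<ge> N \<Longrightarrow> dist (X m) (X n) < e / 2"
      using X unfolding Cauchy_def by (metis half_gt_zero)
    have "norm (X n - abs_L2 f) < e" if "n \<ge> N" for n
    proof -
      have "(\<integral>\<^sup>+x. ennreal ((F n x - f x)\<^sup>2) \<partial>unit_interval_measure) \<le> ennreal ((e / 2)\<^sup>2)"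
        by (rule fatou[of N]) (use N e that in \<open>auto intro: less_imp_le\<close>)
      then have "ennreal ((norm (abs_L2 (\<lambda>x. F n x - f x)))\<^sup>2) \<le> ennreal ((e / 2)\<^sup>2)"
        using F f by (simp add: nn_integral_power2_abs_L2 square_integrable01_diff)
      then have "norm (abs_L2 (\<lambda>x. F n x - f x)) \<le> e / 2"
        using e by (simp add: ennreal_le_iff abs_le_square_iff [symmetric])
      then show ?thesis
        using F f e by (simp add: abs_L2_diff)
    qed
    then show "\<exists>N. \<forall>n\<ge>N. norm (X n - abs_L2 f) < e"
      by blast
  qed
  then show ?thesis
    by (rule convergentI)
qed

section \<open>Orthonormality and series of eigenfunctions\<close>

lemma has_integral_cos_multiple_pi:
  fixes d :: int
  assumes "d \<noteq> 0"
  shows "((\<lambda>x. cos (of_int d * pi * x)) has_integral 0) {0..1}"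
proof -
  have "((\<lambda>x. cos (of_int d * pi * x)) has_integral
      (sin (of_int d * pi * 1) / (of_int d * pi) - sin (of_int d * pi * 0) / (of_int d * pi))) {0..1}"
    by (rule fundamental_theorem_of_calculus)
      (use assms in \<open>auto intro!: derivative_eq_intros simp: has_real_derivative_iff_has_vector_derivative [symmetric]\<close>)
  moreover have "sin (of_int d * pi) = 0"
    using sin_integer_2pi sin_zero_iff_int2 by blast
  ultimately show ?thesis
    by simp
qed

text \<open>The product formula turns the integrand into a difference of cosines of frequencies
  \<open>j - k\<close> and \<open>j + k\<close>. The first may be negative, hence the integers; the
  second is nonzero because \<open>j\<close> and \<open>k\<close> start at 1.\<close>

lemma inner_eigenfun_eigenfun:
  assumes "1 \<le> j" "1 \<le> k"
  shows "inner (eigenfun j) (eigenfun k) = (if j = k then 1 else 0)"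
proof -
  define s where "s k = (\<lambda>x. sqrt 2 * sin (real k * pi * x))" for k
  have s: "square_integrable01 (s k)" for k
    unfolding s_def by (rule square_integrable01_sin)
  have "inner (eigenfun j) (eigenfun k) = (\<integral>x. s j x * s k x \<partial>unit_interval_measure)"
    unfolding eigenfun_def s_def [symmetric]
    using inner_L2.abs_eq[OF L2_rel_refl[OF s] L2_rel_refl[OF s]] by (simp add: s_def)
  also have "\<dots> = integral {0<..<1} (\<lambda>x. s j x * s k x)"
    by (rule lebesgue_integral_eq_integral) (auto intro: square_integrable01_mult s)
  also have "\<dots> = integral {0..1} (\<lambda>x. s j x * s k x)"
    using integral_open_interval[of 0 1 "\<lambda>x. s j x * s k x"] by (simp add: cbox_interval box_real)
  also have "(\<lambda>x. s j x * s k x)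
      = (\<lambda>x. cos (of_int (int j - int k) * pi * x) - cos (of_int (int j + int k) * pi * x))"
    by (rule ext) (simp add: s_def left_diff_distrib distrib_right cos_diff cos_add)
  also have "integral {0..1} \<dots> = (if j = k then 1 else 0)"
  proof (rule integral_unique)
    have 1: "((\<lambda>x. cos (of_int (int j + int k) * pi * x)) has_integral 0) {0..1}"
      by (rule has_integral_cos_multiple_pi) (use assms in auto)
    have 2: "((\<lambda>x. cos (of_int (int j - int k) * pi * x)) has_integral (if j = k then 1 else 0)) {0..1}"
    proof (cases "j = k")
      case True
      then show ?thesis
        using has_integral_const_real[of "1::real" 0 1] by simp
    next
      case False
      then show ?thesis
        using has_integral_cos_multiple_pi[of "int j - int k"] by simp
    qed
    show "((\<lambda>x. cos (of_int (int j - int k) * pi * x) - cos (of_int (int j + int k) * pi * x))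
        has_integral (if j = k then 1 else 0)) {0..1}"
      using has_integral_diff[OF 2 1] by simp
  qed
  finally show ?thesis .
qed

lemma norm_sum_eigenfun_power2:
  assumes "finite A"
  shows "(norm (\<Sum>k\<in>A. c k *\<^sub>R eigenfun (Suc k)))\<^sup>2 = (\<Sum>k\<in>A. (c k)\<^sup>2)"
proof -
  have "(norm (\<Sum>k\<in>A. c k *\<^sub>R eigenfun (Suc k)))\<^sup>2
      = (\<Sum>j\<in>A. \<Sum>k\<in>A. c j * (c k * (if j = k then 1 else 0)))"
    unfolding power2_norm_eq_inner inner_sum_left inner_sum_right inner_scaleR_left inner_scaleR_right
    by (simp add: inner_eigenfun_eigenfun sum_distrib_left eq_commute cong: if_cong)
  also have "\<dots> = (\<Sum>j\<in>A. \<Sum>k\<in>A. if j = k then (c j)\<^sup>2 else 0)"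
    by (intro sum.cong) (auto simp: power2_eq_square)
  also have "\<dots> = (\<Sum>j\<in>A. (c j)\<^sup>2)"
    using assms by simp
  finally show ?thesis .
qed

text \<open>By orthonormality the squared distance of two partial sums equals the distance of the
  scalar partial sums, so completeness applies. \<open>suminf\<close> in \<open>L2\<close> is
  meaningful only once this convergence is known.\<close>

lemma summable_eigenfun_series:
  assumes "summable (\<lambda>k. (c k)\<^sup>2)"
  shows "summable (\<lambda>k. c k *\<^sub>R eigenfun (Suc k))"
proof -
  define S where "S n = (\<Sum>k<n. c k *\<^sub>R eigenfun (Suc k))" for n
  define s where "s n = (\<Sum>k<n. (c k)\<^sup>2)" for n
  have le: "(norm (S m - S n))\<^sup>2 = \<bar>s m - s n\<bar>" if "n \<le> m" for m n
  proof -
    have eq: "{..<m} - {..<n} = {n..<m}" "{..<n} \<subseteq> {..<m}"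
      using that by auto
    have "S m - S n = (\<Sum>k\<in>{n..<m}. c k *\<^sub>R eigenfun (Suc k))"
      unfolding S_def using sum_diff[OF _ eq(2), of "\<lambda>k. c k *\<^sub>R eigenfun (Suc k)"] eq(1) by simp
    moreover have "s m - s n = (\<Sum>k\<in>{n..<m}. (c k)\<^sup>2)"
      unfolding s_def using sum_diff[OF _ eq(2), of "\<lambda>k. (c k)\<^sup>2"] eq(1) by simp
    ultimately show ?thesis
      by (simp add: norm_sum_eigenfun_power2 sum_nonneg)
  qed
  have eq: "(norm (S m - S n))\<^sup>2 = \<bar>s m - s n\<bar>" for m n
    using le[of n m] le[of m n] by (cases "n \<le> m") (auto simp: norm_minus_commute abs_minus_commute)
  have "Cauchy s"
    using assms unfolding s_def summable_iff_convergent by (rule convergent_Cauchy)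
  have "Cauchy S"
  proof (rule CauchyI)
    fix e :: real assume e: "0 < e"
    then obtain M where M: "\<And>m n. m \<ge> M \<Longrightarrow> n \<ge> M \<Longrightarrow> norm (s m - s n) < e\<^sup>2"
      using CauchyD[OF \<open>Cauchy s\<close>, of "e\<^sup>2"] by auto
    have "norm (S m - S n) < e" if "m \<ge> M" "n \<ge> M" for m n
      using M[OF that] e by (intro power2_less_imp_less[of _ e]) (auto simp: eq)
    then show "\<exists>M. \<forall>m\<ge>M. \<forall>n\<ge>M. norm (S m - S n) < e"
      by blast
  qed
  then show ?thesis
    unfolding summable_iff_convergent S_def by (rule L2_Cauchy_convergent)
qed

lemma inner_eigenfun_series:
  assumes "summable (\<lambda>k. (c k)\<^sup>2)"
  shows "inner (\<Sum>k. c k *\<^sub>R eigenfun (Suc k)) (eigenfun (Suc j)) = c j"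
proof -
  have "inner (\<Sum>k. c k *\<^sub>R eigenfun (Suc k)) (eigenfun (Suc j))
      = (\<Sum>k. inner (c k *\<^sub>R eigenfun (Suc k)) (eigenfun (Suc j)))"
    by (rule bounded_linear.suminf[OF bounded_linear_inner_left summable_eigenfun_series[OF assms]])
  also have "\<dots> = (\<Sum>k. if k = j then c j else 0)"
    by (intro suminf_cong) (auto simp: inner_eigenfun_eigenfun)
  also have "\<dots> = c j"
    using suminf_finite[of "{j}" "\<lambda>k. if k = j then c j else 0"] by simp
  finally show ?thesis .
qed

lemma norm_eigenfun_series_power2:
  assumes "summable (\<lambda>k. (c k)\<^sup>2)"
  shows "(norm (\<Sum>k. c k *\<^sub>R eigenfun (Suc k)))\<^sup>2 = (\<Sum>k. (c k)\<^sup>2)"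
proof -
  have "(\<lambda>n. (norm (\<Sum>k<n. c k *\<^sub>R eigenfun (Suc k)))\<^sup>2) \<longlonglongrightarrow> (norm (\<Sum>k. c k *\<^sub>R eigenfun (Suc k)))\<^sup>2"
    by (intro tendsto_intros summable_LIMSEQ summable_eigenfun_series assms)
  then have "(\<lambda>n. \<Sum>k<n. (c k)\<^sup>2) \<longlonglongrightarrow> (norm (\<Sum>k. c k *\<^sub>R eigenfun (Suc k)))\<^sup>2"
    by (simp add: norm_sum_eigenfun_power2)
  then show ?thesis
    using summable_LIMSEQ[OF assms] LIMSEQ_unique by blast
qed

section \<open>Measurability of the coordinates of random data\<close>

lemma eigenval_ge_1: "1 \<le> eigenval (Suc k)"
proof -
  have "1 * 1 \<le> (real (Suc k))\<^sup>2 * pi\<^sup>2"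
    using pi_ge_two by (intro mult_mono one_le_power) auto
  then show ?thesis
    by (simp add: eigenval_def)
qed

text \<open>Each coordinate is continuous for the norm of order \<open>q\<close>, because one term
  of the series is at most the whole squared norm; so the sets below a level are among the open
  generators.\<close>

lemma borel_measurable_inner_eigenfun:
  "(\<lambda>u. inner u (eigenfun (Suc k))) \<in> borel_measurable (dotH_borel q)"
proof -
  define D where "D = {U. U \<subseteq> dotH q \<and>
         (\<forall>u\<in>U. \<exists>\<epsilon>>0. \<forall>w\<in>dotH q. dotH_normsq q (w - u) < ennreal (\<epsilon>\<^sup>2) \<longrightarrow> w \<in> U)}"
  have sp: "space (dotH_borel q) = dotH q" and D: "D \<subseteq> sets (dotH_borel q)"
    unfolding dotH_borel_def D_def by (auto intro!: space_measure_of sigma_sets.Basic)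
  define l where "l = eigenval (Suc k) powr q"
  have l: "l > 0"
    using eigenval_ge_1[of k] by (simp add: l_def)
  have "{u \<in> dotH q. inner u (eigenfun (Suc k)) < y} \<in> D" for y
    unfolding D_def
  proof (safe)
    fix u assume u: "u \<in> dotH q" "inner u (eigenfun (Suc k)) < y"
    define d where "d = y - inner u (eigenfun (Suc k))"
    show "\<exists>\<epsilon>>0. \<forall>w\<in>dotH q. dotH_normsq q (w - u) < ennreal (\<epsilon>\<^sup>2) \<longrightarrow>
        w \<in> {u \<in> dotH q. inner u (eigenfun (Suc k)) < y}"
    proof (intro exI conjI ballI impI)
      \<comment> \<open>The radius is the gap \<open>d\<close> to the level, scaled by
        \<open>sqrt l\<close> since the squared norm weights this coordinate by
        \<open>l\<close>.\<close>
      show "0 < sqrt l * d"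
        using l u by (simp add: d_def)
      fix w assume w: "w \<in> dotH q" and lt: "dotH_normsq q (w - u) < ennreal ((sqrt l * d)\<^sup>2)"
      have "ennreal (l * (inner (w - u) (eigenfun (Suc k)))\<^sup>2) \<le> dotH_normsq q (w - u)"
        unfolding dotH_normsq_def l_def
        by (rule order_trans[OF _ sum_le_suminf[of _ "{k}"]]) auto
      with lt have "ennreal (l * (inner (w - u) (eigenfun (Suc k)))\<^sup>2) < ennreal ((sqrt l * d)\<^sup>2)"
        by (rule order_le_less_trans[rotated])
      then have "l * (inner (w - u) (eigenfun (Suc k)))\<^sup>2 < l * d\<^sup>2"
        using l by (simp add: ennreal_less_iff power_mult_distrib)
      then have "\<bar>inner (w - u) (eigenfun (Suc k))\<bar> < \<bar>d\<bar>"
        using l power2_less_imp_less[of "\<bar>inner (w - u) (eigenfun (Suc k))\<bar>" "\<bar>d\<bar>"] by simp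
      then show "w \<in> {u \<in> dotH q. inner u (eigenfun (Suc k)) < y}"
        using w u by (simp add: d_def inner_diff_left)
    qed
  qed
  then show ?thesis
    unfolding borel_measurable_iff_less sp using D by auto
qed

lemma borel_measurable_L2_rv_coordinate:
  assumes "v \<in> L2_rv_dotH M q"
  shows "(\<lambda>\<omega>. inner (v \<omega>) (eigenfun (Suc k))) \<in> borel_measurable M"
  using assms measurable_compose[OF _ borel_measurable_inner_eigenfun, of v M q k]
  by (auto simp: L2_rv_dotH_def)

section \<open>Kernel and noise bounds\<close>

lemma powr_le_one_plus_power2:
  fixes x \<theta> :: real
  assumes "0 < x" "0 \<le> \<theta>" "\<theta> \<le> 2"
  shows "x powr \<theta> \<le> (1 + x)\<^sup>2"
proof -
  have "x powr \<theta> \<le> (1 + x) powr \<theta>"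
    using assms by (intro powr_mono2) auto
  also have "\<dots> \<le> (1 + x) powr 2"
    using assms by (intro powr_mono) auto
  finally show ?thesis
    using assms by (simp add: powr_numeral)
qed

text \<open>With \<open>\<theta> = (2 * \<beta> - q) / \<beta>\<close> the eigenvalue part of
  \<open>x powr \<theta>\<close> is exactly the missing weight
  \<open>l powr (2 * \<beta> - q)\<close>. The range of \<open>q\<close> corresponds to
  \<open>\<theta>\<close> between 0 and 2, where the square of \<open>1 + x\<close> absorbs
  it.\<close>

lemma initial_datum_multiplier_bound:
  fixes E D l t :: real
  assumes "0 < l" "0 < t" "0 < \<beta>" "0 \<le> q" "q \<le> 2 * \<beta>"
    and E: "\<bar>E\<bar> \<le> D / (1 + l powr \<beta> * t powr \<alpha>)"
  shows "l powr (2 * \<beta>) * E\<^sup>2 \<le> D\<^sup>2 * t powr (\<alpha> * (q - 2 * \<beta>) / \<beta>) * l powr q"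
proof -
  define x where "x = l powr \<beta> * t powr \<alpha>"
  define \<theta> where "\<theta> = (2 * \<beta> - q) / \<beta>"
  have x: "0 < x"
    using assms by (simp add: x_def)
  have \<theta>: "0 \<le> \<theta>" "\<theta> \<le> 2" "\<beta> * \<theta> = 2 * \<beta> - q"
    using assms by (auto simp: \<theta>_def field_simps)
  have a: "\<alpha> * (q - 2 * \<beta>) / \<beta> = - (\<alpha> * \<theta>)"
    using assms by (simp add: \<theta>_def field_simps)
  have "x powr \<theta> = l powr (2 * \<beta> - q) * t powr (\<alpha> * \<theta>)"
    using assms by (simp add: x_def powr_mult powr_powr \<theta>)
  then have "l powr (2 * \<beta> - q) * t powr (\<alpha> * \<theta>) \<le> (1 + x)\<^sup>2"
    using powr_le_one_plus_power2[OF x \<theta>(1,2)] by simp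
  then have "l powr (2 * \<beta> - q) \<le> (1 + x)\<^sup>2 * t powr (- (\<alpha> * \<theta>))"
    using assms by (simp add: powr_minus field_simps)
  moreover have "E\<^sup>2 \<le> (D / (1 + x))\<^sup>2"
  proof -
    have "0 \<le> D / (1 + x)"
      using order_trans[OF abs_ge_zero E] by (simp add: x_def)
    then show ?thesis
      using E by (simp add: power2_le_iff_abs_le x_def)
  qed
  ultimately have "l powr (2 * \<beta> - q) * E\<^sup>2 \<le> (1 + x)\<^sup>2 * t powr (- (\<alpha> * \<theta>)) * (D / (1 + x))\<^sup>2"
    by (intro mult_mono) auto
  also have "\<dots> = D\<^sup>2 * t powr (- (\<alpha> * \<theta>))"
    using x by (simp add: power_divide)
  finally have "l powr (2 * \<beta> - q) * E\<^sup>2 * l powr q \<le> D\<^sup>2 * t powr (- (\<alpha> * \<theta>)) * l powr q"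
    by (rule mult_right_mono) simp
  moreover have "l powr (2 * \<beta> - q) * E\<^sup>2 * l powr q = (l powr (2 * \<beta> - q) * l powr q) * E\<^sup>2"
    by simp
  moreover have "l powr (2 * \<beta> - q) * l powr q = l powr (2 * \<beta>)"
    using assms by (simp add: powr_add [symmetric])
  ultimately show ?thesis
    by (simp add: a)
qed

text \<open>A single power of \<open>1 + x\<close> is at hand, so
  \<open>x powr \<theta> \<le> 1 + x\<close> is used. With the chosen \<open>\<theta>\<close> this
  consumes half of \<open>\<tau> powr (\<alpha> - 1)\<close>; the remaining positive power is
  largest at \<open>\<tau> = t\<close>.\<close>

lemma convolution_kernel_bound:
  fixes E D l \<tau> :: real
  assumes "0 < l" "0 \<le> \<tau>" "\<tau> \<le> t" "1 < \<alpha>" "0 \<le> D"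
    and E: "\<bar>E\<bar> \<le> D / (1 + l powr \<beta> * \<tau> powr \<alpha>)"
  shows "\<bar>\<tau> powr (\<alpha> - 1) * E\<bar> \<le> D * t powr ((\<alpha> - 1) / 2) * l powr (- (\<beta> * (\<alpha> - 1) / (2 * \<alpha>)))"
proof (cases "\<tau> = 0")
  case True
  then show ?thesis
    using assms by simp
next
  case False
  define x where "x = l powr \<beta> * \<tau> powr \<alpha>"
  define \<theta> where "\<theta> = (\<alpha> - 1) / (2 * \<alpha>)"
  have \<tau>: "0 < \<tau>"
    using False assms by simp
  have x: "0 < x"
    using assms \<tau> by (simp add: x_def)
  have \<theta>: "0 \<le> \<theta>" "\<theta> \<le> 1" "\<alpha> * \<theta> = (\<alpha> - 1) / 2"
    using assms by (auto simp: \<theta>_def field_simps)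
  have "x powr \<theta> \<le> (1 + x) powr \<theta>"
    using x \<theta> by (intro powr_mono2) auto
  also have "\<dots> \<le> (1 + x) powr 1"
    using x \<theta> by (intro powr_mono) auto
  finally have "x powr \<theta> \<le> 1 + x"
    using x by simp
  then have "1 / (1 + x) \<le> 1 / x powr \<theta>"
    using x by (intro divide_left_mono) auto
  also have "\<dots> = l powr (- (\<beta> * \<theta>)) * \<tau> powr (- ((\<alpha> - 1) / 2))"
    using assms \<tau> by (simp add: x_def powr_mult powr_powr powr_minus field_simps flip: \<theta>(3))
  finally have 1: "1 / (1 + x) \<le> l powr (- (\<beta> * \<theta>)) * \<tau> powr (- ((\<alpha> - 1) / 2))" .
  have "\<bar>\<tau> powr (\<alpha> - 1) * E\<bar> \<le> \<tau> powr (\<alpha> - 1) * (D * (1 / (1 + x)))"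
    using mult_left_mono[OF E, of "\<tau> powr (\<alpha> - 1)"] by (simp add: abs_mult x_def)
  also have "\<dots> \<le> \<tau> powr (\<alpha> - 1) * (D * (l powr (- (\<beta> * \<theta>)) * \<tau> powr (- ((\<alpha> - 1) / 2))))"
    using assms 1 by (intro mult_left_mono) auto
  also have "\<dots> = D * l powr (- (\<beta> * \<theta>)) * (\<tau> powr (\<alpha> - 1) * \<tau> powr (- ((\<alpha> - 1) / 2)))"
    by simp
  also have "\<tau> powr (\<alpha> - 1) * \<tau> powr (- ((\<alpha> - 1) / 2)) = \<tau> powr ((\<alpha> - 1) / 2)"
    using \<tau> by (simp add: powr_add [symmetric] field_simps)
  also have "D * l powr (- (\<beta> * \<theta>)) * \<tau> powr ((\<alpha> - 1) / 2) \<le> D * l powr (- (\<beta> * \<theta>)) * t powr ((\<alpha> - 1) / 2)"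
    using assms \<tau> by (intro mult_left_mono powr_mono2) auto
  finally show ?thesis
    by (simp add: \<theta>_def mult_ac)
qed

section \<open>The time grid and pathwise bounds for the noise\<close>

abbreviation cell :: "real \<Rightarrow> nat \<Rightarrow> real set" where
  "cell d i \<equiv> {grid_point d i..<grid_point d (i + 1)}"

lemma sum_indicator_cell:
  assumes "0 < d"
  shows "(\<Sum>i=1..n. indicator (cell d i) s) = (indicator {0..<real n * d} s :: real)"
proof (induction n)
  case (Suc n)
  have c: "cell d (Suc n) = {real n * d..<real (Suc n) * d}"
    by (simp add: grid_point_def)
  have "0 \<le> real n * d" "real n * d \<le> real (Suc n) * d"
    using assms by auto
  moreover have "indicator {0..<A} s + indicator {A..<B} s = (indicator {0..<B} s :: real)"
    if "0 \<le> A" "A \<le> B" for A B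
    using that by (auto simp: indicator_def)
  ultimately have "indicator {0..<real n * d} s + indicator {real n * d..<real (Suc n) * d} s
      = (indicator {0..<real (Suc n) * d} s :: real)"
    by blast
  then show ?case
    using Suc unfolding c [symmetric] by (simp only: sum.nat_ivl_Suc' le_add2 plus_1_eq_Suc add.commute)
qed (simp only: sum.empty atLeastatMost_empty_iff2 of_nat_0 mult_zero_left, simp)

text \<open>An inequality only, because the half-open cells leave out the end point
  \<open>n * d\<close>; at the final time the step noise is therefore 0.\<close>

lemma sum_indicator_cell_le_1:
  assumes "0 < d"
  shows "(\<Sum>i=1..n. indicator (cell d i) s) \<le> (1 :: real)"
  unfolding sum_indicator_cell[OF assms] by (simp add: indicator_def)

definition cell_length :: "real \<Rightarrow> real \<Rightarrow> nat \<Rightarrow> real" where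
  "cell_length d t i = (LINT s|lborel. indicator {0..t} s * indicator (cell d i) s)"

lemma integrable_cell: "integrable lborel (\<lambda>s. indicator {0..t} s * indicator (cell d i) s :: real)"
proof -
  have "integrable lborel (indicator ({0..t} \<inter> cell d i) :: real \<Rightarrow> real)"
    using emeasure_bounded_finite[of "{0..t} \<inter> cell d i"]
    by (intro integrable_real_indicator) (auto simp: bounded_Int)
  also have "indicator ({0..t} \<inter> cell d i) = (\<lambda>s. indicator {0..t} s * indicator (cell d i) s :: real)"
    by (rule ext) (rule indicator_inter_arith)
  finally show ?thesis .
qed

lemma cell_length_nonneg: "0 \<le> cell_length d t i"
  unfolding cell_length_def by (rule Bochner_Integration.integral_nonneg) simp

lemma sum_cell_length_le:
  assumes "0 < d" "0 \<le> t"
  shows "(\<Sum>i=1..n. cell_length d t i) \<le> t"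
proof -
  have "(\<Sum>i=1..n. cell_length d t i)
      = (LINT s|lborel. (\<Sum>i=1..n. indicator {0..t} s * indicator (cell d i) s))"
    unfolding cell_length_def by (rule Bochner_Integration.integral_sum [symmetric]) (rule integrable_cell)
  also have "\<dots> \<le> (LINT s|lborel. indicator {0..t} s)"
  proof (rule integral_mono)
    show "(\<Sum>i=1..n. indicator {0..t} s * indicator (cell d i) s) \<le> (indicator {0..t} s :: real)" for s
      unfolding sum_distrib_left [symmetric] using sum_indicator_cell_le_1[OF assms(1), of s n]
      by (simp add: indicator_def)
    show "integrable lborel (\<lambda>s. \<Sum>i=1..n. indicator {0..t} s * indicator (cell d i) s :: real)"
      by (intro Bochner_Integration.integrable_sum integrable_cell)
    show "integrable lborel (indicator {0..t} :: real \<Rightarrow> real)"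
      using emeasure_bounded_finite[of "{0..t}"] by (intro integrable_real_indicator) auto
  qed
  also have "\<dots> = t"
    using assms by simp
  finally show ?thesis .
qed

text \<open>Each weight is split into two square roots. The weights will be the cell indicators at a
  fixed time, or the cell lengths.\<close>

lemma weighted_Cauchy_Schwarz:
  fixes w y :: "'i \<Rightarrow> real"
  assumes "\<And>i. i \<in> A \<Longrightarrow> 0 \<le> w i"
  shows "(\<Sum>i\<in>A. w i * y i)\<^sup>2 \<le> (\<Sum>i\<in>A. w i) * (\<Sum>i\<in>A. w i * (y i)\<^sup>2)"
proof -
  have "(\<Sum>i\<in>A. w i * y i) = (\<Sum>i\<in>A. sqrt (w i) * (sqrt (w i) * y i))"
    by (intro sum.cong) (use assms in \<open>auto simp flip: mult.assoc\<close>)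
  also have "(\<dots>)\<^sup>2 \<le> (\<Sum>i\<in>A. (sqrt (w i))\<^sup>2) * (\<Sum>i\<in>A. (sqrt (w i) * y i)\<^sup>2)"
    by (rule Cauchy_Schwarz_ineq_sum)
  also have "\<dots> = (\<Sum>i\<in>A. w i) * (\<Sum>i\<in>A. w i * (y i)\<^sup>2)"
    using assms by (intro arg_cong2[of _ _ _ _ "(*)"] sum.cong) (auto simp: power_mult_distrib)
  finally show ?thesis .
qed

lemma step_noise_power2_le:
  assumes "0 < d"
  shows "(step_noise \<xi> d n k s \<omega>)\<^sup>2
    \<le> (\<Sum>i=1..n. indicator (cell d i) s * ((normalised_increment \<xi> d k i \<omega>)\<^sup>2 / d))"
proof -
  have "(step_noise \<xi> d n k s \<omega>)\<^sup>2
      = (\<Sum>i=1..n. indicator (cell d i) s * (1 / sqrt d * normalised_increment \<xi> d k i \<omega>))\<^sup>2"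
    by (simp add: step_noise_def mult.commute)
  also have "\<dots> \<le> (\<Sum>i=1..n. indicator (cell d i) s)
      * (\<Sum>i=1..n. indicator (cell d i) s * (1 / sqrt d * normalised_increment \<xi> d k i \<omega>)\<^sup>2)"
    by (rule weighted_Cauchy_Schwarz) simp
  also have "\<dots> \<le> 1 * (\<Sum>i=1..n. indicator (cell d i) s * (1 / sqrt d * normalised_increment \<xi> d k i \<omega>)\<^sup>2)"
    using assms by (intro mult_right_mono sum_indicator_cell_le_1 sum_nonneg) auto
  also have "\<dots> = (\<Sum>i=1..n. indicator (cell d i) s * ((normalised_increment \<xi> d k i \<omega>)\<^sup>2 / d))"
    using assms by (simp add: power_mult_distrib power_divide)
  finally show ?thesis .
qed

text \<open>Bounding \<open>g\<close> by \<open>B\<close> leaves a sum over cells, and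
  Cauchy-Schwarz with the cell lengths as weights gives one factor \<open>t\<close>. The remaining
  weights give a second \<open>t\<close> once expectations are taken, which is the source of the
  surplus.\<close>

lemma step_noise_convolution_power2_le:
  assumes "0 < d" "0 \<le> t" and g: "\<And>s. s \<in> {0..t} \<Longrightarrow> \<bar>g s\<bar> \<le> B"
  shows "(LBINT s:{0..t}. g s * step_noise \<xi> d n k s \<omega>)\<^sup>2
    \<le> B\<^sup>2 * t * (\<Sum>i=1..n. cell_length d t i * ((normalised_increment \<xi> d k i \<omega>)\<^sup>2 / d))"
proof -
  define y where "y i = 1 / sqrt d * \<bar>normalised_increment \<xi> d k i \<omega>\<bar>" for i
  have B: "0 \<le> B"
    using order_trans[OF abs_ge_zero g[of 0]] assms(2) by simp
  have y: "0 \<le> y i" "(y i)\<^sup>2 = (normalised_increment \<xi> d k i \<omega>)\<^sup>2 / d" for i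
    using assms by (auto simp: y_def power_mult_distrib power_divide)
  have "\<bar>LBINT s:{0..t}. g s * step_noise \<xi> d n k s \<omega>\<bar>
      \<le> (LINT s|lborel. norm (indicator {0..t} s *\<^sub>R (g s * step_noise \<xi> d n k s \<omega>)))"
    unfolding set_lebesgue_integral_def real_norm_def [symmetric] by (rule integral_norm_bound)
  \<comment> \<open>\<open>integral_mono'\<close> asks for integrability of the majorant: a left
    side that is not integrable has integral 0.\<close>
  also have "\<dots> \<le> (LINT s|lborel. (\<Sum>i=1..n. B * y i * (indicator {0..t} s * indicator (cell d i) s)))"
  proof (rule integral_mono')
    show "integrable lborel (\<lambda>s. \<Sum>i=1..n. B * y i * (indicator {0..t} s * indicator (cell d i) s))"
      by (intro Bochner_Integration.integrable_sum integrable_mult_right integrable_cell)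
    fix s
    show "norm (indicator {0..t} s *\<^sub>R (g s * step_noise \<xi> d n k s \<omega>))
        \<le> (\<Sum>i=1..n. B * y i * (indicator {0..t} s * indicator (cell d i) s))"
    proof (cases "s \<in> {0..t}")
      case True
      have "\<bar>step_noise \<xi> d n k s \<omega>\<bar>
          \<le> (\<Sum>i=1..n. \<bar>1 / sqrt d * normalised_increment \<xi> d k i \<omega> * indicator (cell d i) s\<bar>)"
        unfolding step_noise_def by (rule sum_abs)
      also have "\<dots> = (\<Sum>i=1..n. y i * indicator (cell d i) s)"
        using assms by (simp add: y_def abs_mult)
      finally have "\<bar>g s\<bar> * \<bar>step_noise \<xi> d n k s \<omega>\<bar> \<le> B * (\<Sum>i=1..n. y i * indicator (cell d i) s)"
        using g[OF True] B by (intro mult_mono) auto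
      also have "\<dots> = (\<Sum>i=1..n. B * y i * (indicator {0..t} s * indicator (cell d i) s))"
        unfolding indicator_simps(1)[OF True] sum_distrib_left by (simp only: mult_1 mult.assoc)
      finally show ?thesis
        unfolding indicator_simps(1)[OF True] by (simp add: abs_mult)
    qed simp
    show "0 \<le> (\<Sum>i=1..n. B * y i * (indicator {0..t} s * indicator (cell d i) s))"
      using B y by (intro sum_nonneg mult_nonneg_nonneg) auto
  qed
  also have "\<dots> = (\<Sum>i=1..n. LINT s|lborel. B * y i * (indicator {0..t} s * indicator (cell d i) s))"
    by (rule Bochner_Integration.integral_sum) (intro integrable_mult_right integrable_cell)
  also have "\<dots> = B * (\<Sum>i=1..n. cell_length d t i * y i)"
    by (simp add: cell_length_def sum_distrib_left mult_ac)
  finally have "(LBINT s:{0..t}. g s * step_noise \<xi> d n k s \<omega>)\<^sup>2 \<le> (B * (\<Sum>i=1..n. cell_length d t i * y i))\<^sup>2"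
    using B y cell_length_nonneg by (subst power2_le_iff_abs_le) (auto intro!: mult_nonneg_nonneg sum_nonneg)
  also have "\<dots> = B\<^sup>2 * (\<Sum>i=1..n. cell_length d t i * y i)\<^sup>2"
    by (simp add: power_mult_distrib)
  also have "\<dots> \<le> B\<^sup>2 * ((\<Sum>i=1..n. cell_length d t i) * (\<Sum>i=1..n. cell_length d t i * (y i)\<^sup>2))"
    by (intro mult_left_mono weighted_Cauchy_Schwarz cell_length_nonneg) auto
  also have "\<dots> \<le> B\<^sup>2 * (t * (\<Sum>i=1..n. cell_length d t i * (y i)\<^sup>2))"
    using assms by (intro mult_left_mono mult_right_mono sum_cell_length_le sum_nonneg
        mult_nonneg_nonneg cell_length_nonneg) auto
  finally show ?thesis
    by (simp add: y mult.assoc)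
qed

section \<open>Second moments of the increments\<close>

lemma (in prob_space) nn_integral_power2_normal:
  assumes "distributed M lborel X (normal_density 0 \<sigma>)" "0 < \<sigma>"
  shows "(\<integral>\<^sup>+\<omega>. ennreal ((X \<omega>)\<^sup>2) \<partial>M) = ennreal (\<sigma>\<^sup>2)"
proof -
  have "expectation X = 0"
    using normal_distributed_expectation[OF assms(2,1)] .
  then have v: "expectation (\<lambda>\<omega>. (X \<omega>)\<^sup>2) = \<sigma>\<^sup>2"
    using normal_distributed_variance[OF assms(2,1)] by simp
  \<comment> \<open>A function that is not integrable has Bochner integral 0, so the nonzero value
    forces integrability.\<close>
  then have "integrable M (\<lambda>\<omega>. (X \<omega>)\<^sup>2)"
    using assms not_integrable_integral_eq[of M "\<lambda>\<omega>. (X \<omega>)\<^sup>2"] by fastforce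
  then show ?thesis
    by (subst nn_integral_eq_integral) (auto simp: v)
qed

lemma normalised_increment_moment:
  assumes "prob_space M" "standard_wiener M F (\<xi> k)" "0 < d" "1 \<le> i"
  shows "normalised_increment \<xi> d k i \<in> borel_measurable M"
    and "(\<integral>\<^sup>+\<omega>. ennreal ((normalised_increment \<xi> d k i \<omega>)\<^sup>2) \<partial>M) = 1"
proof -
  interpret prob_space M by fact
  define X where "X = (\<lambda>\<omega>. \<xi> k (grid_point d (i + 1)) \<omega> - \<xi> k (grid_point d i) \<omega>)"
  \<comment> \<open>Grid points are numbered from 1; \<open>1 \<le> i\<close> keeps
    \<open>(i - 1) * d\<close> in the time domain of the Wiener process.\<close>
  have g: "0 \<le> grid_point d i" "grid_point d i < grid_point d (i + 1)"
    "grid_point d (i + 1) - grid_point d i = d"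
    using assms by (auto simp: grid_point_def algebra_simps)
  have "\<forall>s t. 0 \<le> s \<and> s < t \<longrightarrow>
      distributed M lborel (\<lambda>\<omega>. \<xi> k t \<omega> - \<xi> k s \<omega>) (normal_density 0 (sqrt (t - s)))"
    using assms(2) unfolding standard_wiener_def by blast
  from this[rule_format, OF conjI[OF g(1,2)]] have X: "distributed M lborel X (normal_density 0 (sqrt d))"
    unfolding X_def g(3) .
  have mX: "X \<in> borel_measurable M"
    using distributed_measurable[OF X] by simp
  have n: "normalised_increment \<xi> d k i = (\<lambda>\<omega>. 1 / sqrt d * X \<omega>)"
    by (simp add: normalised_increment_def X_def fun_eq_iff)
  show "normalised_increment \<xi> d k i \<in> borel_measurable M"
    unfolding n using mX by measurable
  have "(\<integral>\<^sup>+\<omega>. ennreal ((normalised_increment \<xi> d k i \<omega>)\<^sup>2) \<partial>M)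
      = (\<integral>\<^sup>+\<omega>. ennreal (1 / d) * ennreal ((X \<omega>)\<^sup>2) \<partial>M)"
    unfolding n using assms by (simp add: power_mult_distrib power_divide ennreal_mult' [symmetric])
  also have "\<dots> = ennreal (1 / d) * ennreal ((sqrt d)\<^sup>2)"
    using mX X assms by (subst nn_integral_cmult) (auto simp: nn_integral_power2_normal)
  also have "\<dots> = 1"
    using assms by (simp add: ennreal_mult' [symmetric])
  finally show "(\<integral>\<^sup>+\<omega>. ennreal ((normalised_increment \<xi> d k i \<omega>)\<^sup>2) \<partial>M) = 1" .
qed

lemma nn_integral_weighted_increments_le:
  assumes "prob_space M" "standard_wiener M F (\<xi> k)" "0 < d"
    and w: "\<And>i. 0 \<le> w i" "(\<Sum>i=1..n. w i) \<le> c"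
  shows "(\<lambda>\<omega>. \<Sum>i=1..n. w i * ((normalised_increment \<xi> d k i \<omega>)\<^sup>2 / d)) \<in> borel_measurable M"
    and "(\<integral>\<^sup>+\<omega>. ennreal (\<Sum>i=1..n. w i * ((normalised_increment \<xi> d k i \<omega>)\<^sup>2 / d)) \<partial>M) \<le> ennreal (c / d)"
proof -
  note mom = normalised_increment_moment[where \<xi> = \<xi> and k = k, OF assms(1-3)]
  show "(\<lambda>\<omega>. \<Sum>i=1..n. w i * ((normalised_increment \<xi> d k i \<omega>)\<^sup>2 / d)) \<in> borel_measurable M"
    using mom(1) by (intro borel_measurable_sum) simp
  have "(\<integral>\<^sup>+\<omega>. ennreal (\<Sum>i=1..n. w i * ((normalised_increment \<xi> d k i \<omega>)\<^sup>2 / d)) \<partial>M)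
      = (\<integral>\<^sup>+\<omega>. (\<Sum>i=1..n. ennreal (w i / d) * ennreal ((normalised_increment \<xi> d k i \<omega>)\<^sup>2)) \<partial>M)"
    using w assms(3) by (intro nn_integral_cong) (simp add: ennreal_mult' [symmetric])
  also have "\<dots> = (\<Sum>i=1..n. \<integral>\<^sup>+\<omega>. ennreal (w i / d) * ennreal ((normalised_increment \<xi> d k i \<omega>)\<^sup>2) \<partial>M)"
    using mom(1) by (intro nn_integral_sum) simp
  also have "\<dots> = (\<Sum>i=1..n. ennreal (w i / d))"
    using mom by (intro sum.cong refl) (simp add: nn_integral_cmult)
  also have "\<dots> = ennreal ((\<Sum>i=1..n. w i) / d)"
    using w assms(3) by (simp add: sum_ennreal sum_divide_distrib)
  also have "\<dots> \<le> ennreal (c / d)"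
    using w assms(3) by (intro ennreal_leI divide_right_mono) auto
  finally show "(\<integral>\<^sup>+\<omega>. ennreal (\<Sum>i=1..n. w i * ((normalised_increment \<xi> d k i \<omega>)\<^sup>2 / d)) \<partial>M) \<le> ennreal (c / d)" .
qed

section \<open>Estimates for the mild solution\<close>

text \<open>A coefficient is a sum of three parts, two from the initial data and one from the noise;
  the constant 3 comes from squaring that sum.\<close>

lemma mild_coeff_power2_le:
  fixes \<alpha> \<beta> T q r t D m :: real
  assumes par: "1 < \<alpha>" "0 < \<beta>" "0 < T" "0 \<le> q" "q \<le> 2 * \<beta>" "0 \<le> r" "r \<le> 2 * \<beta>"
    and I: "1 \<le> I" and t: "0 < t" "t \<le> T" and D: "0 \<le> D"
    and E: "\<And>b x. b \<in> {1, 2, \<alpha>} \<Longrightarrow> 0 \<le> x \<Longrightarrow> \<bar>mittag_leffler \<alpha> b (- x)\<bar> \<le> D / (1 + x)"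
    and \<sigma>: "\<And>s. s \<in> {0..T} \<Longrightarrow> \<bar>\<sigma> (Suc k) s\<bar> \<le> m"
  shows "eigenval (Suc k) powr (2 * \<beta>) * (mild_coeff \<alpha> \<beta> T I \<sigma> \<xi> v1 v2 (Suc k) t \<omega>)\<^sup>2
    \<le> 3 * D\<^sup>2 * t powr (\<alpha> * (q - 2 * \<beta>) / \<beta>)
        * (eigenval (Suc k) powr q * (inner (v1 \<omega>) (eigenfun (Suc k)))\<^sup>2)
      + 3 * D\<^sup>2 * t powr (2 - \<alpha> * (2 * \<beta> - r) / \<beta>)
        * (eigenval (Suc k) powr r * (inner (v2 \<omega>) (eigenfun (Suc k)))\<^sup>2)
      + 3 * D\<^sup>2 * t powr \<alpha> * (eigenval (Suc k) powr (\<beta> * (\<alpha> + 1) / \<alpha>) * m\<^sup>2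
        * (\<Sum>i=1..I. cell_length (T / real I) t i
            * ((normalised_increment \<xi> (T / real I) (Suc k) i \<omega>)\<^sup>2 / (T / real I))))"
proof -
  define l where "l = eigenval (Suc k)"
  define d where "d = T / real I"
  define Z where "Z = (\<Sum>i=1..I. cell_length d t i * ((normalised_increment \<xi> d (Suc k) i \<omega>)\<^sup>2 / d))"
  define A B where "A = inner (v1 \<omega>) (eigenfun (Suc k))" and "B = inner (v2 \<omega>) (eigenfun (Suc k))"
  define E1 E2 where "E1 = mittag_leffler \<alpha> 1 (- (l powr \<beta>) * t powr \<alpha>)"
    and "E2 = mittag_leffler \<alpha> 2 (- (l powr \<beta>) * t powr \<alpha>)"
  define g where "g s = (t - s) powr (\<alpha> - 1) * mittag_leffler \<alpha> \<alpha> (- (l powr \<beta>) * (t - s) powr \<alpha>) * \<sigma> (Suc k) s" for s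
  define N where "N = (LBINT s:{0..t}. g s * step_noise \<xi> d I (Suc k) s \<omega>)"
  define \<kappa> where "\<kappa> = t powr ((\<alpha> - 1) / 2) * l powr (- (\<beta> * (\<alpha> - 1) / (2 * \<alpha>)))"
  have l: "0 < l"
    using eigenval_ge_1[of k] by (simp add: l_def)
  have d: "0 < d"
    using par I by (simp add: d_def)
  have m: "0 \<le> m"
    using order_trans[OF abs_ge_zero \<sigma>[of 0]] par by simp
  have Z: "0 \<le> Z"
    unfolding Z_def using d by (intro sum_nonneg mult_nonneg_nonneg cell_length_nonneg) auto
  have c: "mild_coeff \<alpha> \<beta> T I \<sigma> \<xi> v1 v2 (Suc k) t \<omega> = E1 * A + t * E2 * B + N"
    by (simp only: mild_coeff_def E1_def E2_def A_def B_def N_def g_def l_def d_def)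
  have sq3: "(x + y + z)\<^sup>2 \<le> 3 * (x\<^sup>2 + y\<^sup>2 + z\<^sup>2)" for x y z :: real
  proof -
    have "0 \<le> (x - y)\<^sup>2 + (y - z)\<^sup>2 + (x - z)\<^sup>2"
      by simp
    then show ?thesis
      by (simp add: power2_eq_square algebra_simps)
  qed
  have "0 \<le> l powr \<beta> * t powr \<alpha>"
    by simp
  then have E1: "\<bar>E1\<bar> \<le> D / (1 + l powr \<beta> * t powr \<alpha>)" and E2: "\<bar>E2\<bar> \<le> D / (1 + l powr \<beta> * t powr \<alpha>)"
    using E[of 1 "l powr \<beta> * t powr \<alpha>"] E[of 2 "l powr \<beta> * t powr \<alpha>"] by (simp_all add: E1_def E2_def)
  have 1: "l powr (2 * \<beta>) * (E1 * A)\<^sup>2 \<le> D\<^sup>2 * t powr (\<alpha> * (q - 2 * \<beta>) / \<beta>) * (l powr q * A\<^sup>2)"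
    using mult_right_mono[OF initial_datum_multiplier_bound[OF l t(1) par(2,4,5) E1], of "A\<^sup>2"]
    by (simp add: power_mult_distrib mult_ac)
  have "l powr (2 * \<beta>) * (t * E2 * B)\<^sup>2 \<le> t\<^sup>2 * (D\<^sup>2 * t powr (\<alpha> * (r - 2 * \<beta>) / \<beta>) * (l powr r * B\<^sup>2))"
    using mult_right_mono[OF initial_datum_multiplier_bound[OF l t(1) par(2,6,7) E2], of "t\<^sup>2 * B\<^sup>2"]
    by (simp add: power_mult_distrib mult_ac)
  \<comment> \<open>The square of the factor \<open>t\<close> in front of the second Mittag-Leffler
    function accounts for the 2 in the time exponent.\<close>
  also have "\<dots> = D\<^sup>2 * (t\<^sup>2 * t powr (\<alpha> * (r - 2 * \<beta>) / \<beta>)) * (l powr r * B\<^sup>2)"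
    by simp
  also have "t\<^sup>2 * t powr (\<alpha> * (r - 2 * \<beta>) / \<beta>) = t powr (2 - \<alpha> * (2 * \<beta> - r) / \<beta>)"
  proof -
    have "2 - \<alpha> * (2 * \<beta> - r) / \<beta> = 2 + \<alpha> * (r - 2 * \<beta>) / \<beta>"
      using par by (simp add: field_simps)
    then show ?thesis
      using t by (simp only: powr_add) (simp add: powr_numeral)
  qed
  finally have 2: "l powr (2 * \<beta>) * (t * E2 * B)\<^sup>2
      \<le> D\<^sup>2 * t powr (2 - \<alpha> * (2 * \<beta> - r) / \<beta>) * (l powr r * B\<^sup>2)" .
  have "N\<^sup>2 \<le> (D * \<kappa> * m)\<^sup>2 * t * Z"
    unfolding N_def Z_def
  proof (rule step_noise_convolution_power2_le[OF d])
    fix s assume s: "s \<in> {0..t}"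
    have "0 \<le> l powr \<beta> * (t - s) powr \<alpha>"
      by simp
    then have "\<bar>(t - s) powr (\<alpha> - 1) * mittag_leffler \<alpha> \<alpha> (- (l powr \<beta> * (t - s) powr \<alpha>))\<bar>
        \<le> D * t powr ((\<alpha> - 1) / 2) * l powr (- (\<beta> * (\<alpha> - 1) / (2 * \<alpha>)))"
      using s t D par by (intro convolution_kernel_bound[OF l] E) auto
    then have "\<bar>(t - s) powr (\<alpha> - 1) * mittag_leffler \<alpha> \<alpha> (- (l powr \<beta> * (t - s) powr \<alpha>))\<bar> * \<bar>\<sigma> (Suc k) s\<bar>
        \<le> (D * \<kappa>) * m"
      using s t m D by (intro mult_mono \<sigma>) (auto simp: \<kappa>_def mult.assoc)
    then show "\<bar>g s\<bar> \<le> D * \<kappa> * m"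
      by (simp add: g_def abs_mult)
  qed (use t in auto)
  then have "l powr (2 * \<beta>) * N\<^sup>2 \<le> l powr (2 * \<beta>) * ((D * \<kappa> * m)\<^sup>2 * t * Z)"
    by (rule mult_left_mono) simp
  also have "\<dots> = D\<^sup>2 * ((l powr (2 * \<beta>) * \<kappa>\<^sup>2) * t) * (m\<^sup>2 * Z)"
    by (simp add: power_mult_distrib)
  \<comment> \<open>One \<open>t\<close> from Cauchy-Schwarz lifts
    \<open>t powr (\<alpha> - 1)\<close> to \<open>t powr \<alpha>\<close>, and
    \<open>2 * \<beta> - \<beta> * (\<alpha> - 1) / \<alpha>\<close> is the eigenvalue exponent of
    the theorem.\<close>
  also have "(l powr (2 * \<beta>) * \<kappa>\<^sup>2) * t = t powr \<alpha> * l powr (\<beta> * (\<alpha> + 1) / \<alpha>)"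
  proof -
    have sq: "(x powr y)\<^sup>2 = x powr (2 * y)" for x y :: real
      by (simp add: power2_eq_square powr_add [symmetric])
    have "2 * ((\<alpha> - 1) / 2) = \<alpha> - 1" "2 * (- (\<beta> * (\<alpha> - 1) / (2 * \<alpha>))) = - (\<beta> * (\<alpha> - 1) / \<alpha>)"
      by simp_all
    then have "\<kappa>\<^sup>2 = t powr (\<alpha> - 1) * l powr (- (\<beta> * (\<alpha> - 1) / \<alpha>))"
      unfolding \<kappa>_def power_mult_distrib sq by (simp only:)
    then have "(l powr (2 * \<beta>) * \<kappa>\<^sup>2) * t
        = (t powr (\<alpha> - 1) * t powr 1) * (l powr (2 * \<beta>) * l powr (- (\<beta> * (\<alpha> - 1) / \<alpha>)))"
      using t by simp
    also have "\<dots> = t powr \<alpha> * l powr (2 * \<beta> - \<beta> * (\<alpha> - 1) / \<alpha>)"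
      unfolding powr_add [symmetric] by simp
    also have "2 * \<beta> - \<beta> * (\<alpha> - 1) / \<alpha> = \<beta> * (\<alpha> + 1) / \<alpha>"
      using par by (simp add: field_simps)
    finally show ?thesis .
  qed
  finally have 3: "l powr (2 * \<beta>) * N\<^sup>2 \<le> D\<^sup>2 * t powr \<alpha> * (l powr (\<beta> * (\<alpha> + 1) / \<alpha>) * m\<^sup>2 * Z)"
    by (simp add: mult.assoc)
  have "l powr (2 * \<beta>) * (E1 * A + t * E2 * B + N)\<^sup>2
      \<le> l powr (2 * \<beta>) * (3 * ((E1 * A)\<^sup>2 + (t * E2 * B)\<^sup>2 + N\<^sup>2))"
    by (intro mult_left_mono sq3) simp
  also have "\<dots> = 3 * (l powr (2 * \<beta>) * (E1 * A)\<^sup>2) + 3 * (l powr (2 * \<beta>) * (t * E2 * B)\<^sup>2)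
      + 3 * (l powr (2 * \<beta>) * N\<^sup>2)"
    by (simp add: distrib_left)
  also have "\<dots> \<le> 3 * (D\<^sup>2 * t powr (\<alpha> * (q - 2 * \<beta>) / \<beta>) * (l powr q * A\<^sup>2))
      + 3 * (D\<^sup>2 * t powr (2 - \<alpha> * (2 * \<beta> - r) / \<beta>) * (l powr r * B\<^sup>2))
      + 3 * (D\<^sup>2 * t powr \<alpha> * (l powr (\<beta> * (\<alpha> + 1) / \<alpha>) * m\<^sup>2 * Z))"
    using 1 2 3 by linarith
  finally show ?thesis
    unfolding c A_def B_def Z_def d_def l_def by (simp only: mult.assoc)
qed

text \<open>The weights are general because two families occur: cell lengths, of sum at most
  \<open>t\<close>, for the convolution, and cell indicators at time \<open>t\<close>, of sum at
  most 1, for the noise itself.\<close>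

lemma nn_integral_noise_sum_le:
  assumes M: "prob_space M" and W: "\<And>k. k \<ge> 1 \<Longrightarrow> standard_wiener M F (\<xi> k)" and d: "0 < d"
    and w: "\<And>i. 0 \<le> w i" "(\<Sum>i=1..n. w i) \<le> c" "0 \<le> c"
    and m: "\<And>k. 0 \<le> m k" "summable m"
  defines "Z \<equiv> \<lambda>k \<omega>. \<Sum>i=1..n. w i * ((normalised_increment \<xi> d (Suc k) i \<omega>)\<^sup>2 / d)"
  shows "(\<lambda>\<omega>. \<Sum>k. ennreal (m k * Z k \<omega>)) \<in> borel_measurable M"
    and "(\<integral>\<^sup>+\<omega>. (\<Sum>k. ennreal (m k * Z k \<omega>)) \<partial>M) \<le> ennreal (c / d * (\<Sum>k. m k))"
proof -
  have mZ: "Z k \<in> borel_measurable M" for k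
    unfolding Z_def using nn_integral_weighted_increments_le(1)[where \<xi> = \<xi> and k = "Suc k", OF M W d w(1,2)] by simp
  have iZ: "(\<integral>\<^sup>+\<omega>. ennreal (Z k \<omega>) \<partial>M) \<le> ennreal (c / d)" for k
    unfolding Z_def using nn_integral_weighted_increments_le(2)[where \<xi> = \<xi> and k = "Suc k", OF M W d w(1,2)] by simp
  show "(\<lambda>\<omega>. \<Sum>k. ennreal (m k * Z k \<omega>)) \<in> borel_measurable M"
    using mZ by measurable
  have "(\<integral>\<^sup>+\<omega>. (\<Sum>k. ennreal (m k * Z k \<omega>)) \<partial>M) = (\<Sum>k. \<integral>\<^sup>+\<omega>. ennreal (m k) * ennreal (Z k \<omega>) \<partial>M)"
    using mZ m by (subst nn_integral_suminf [symmetric]) (auto simp: ennreal_mult')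
  also have "\<dots> = (\<Sum>k. ennreal (m k) * (\<integral>\<^sup>+\<omega>. ennreal (Z k \<omega>) \<partial>M))"
    using mZ by (intro suminf_cong nn_integral_cmult) simp
  also have "\<dots> \<le> (\<Sum>k. ennreal (m k) * ennreal (c / d))"
    by (intro suminf_le mult_left_mono iZ) auto
  also have "\<dots> = (\<Sum>k. ennreal (m k * (c / d)))"
    using m w d by (intro suminf_cong ennreal_mult'' [symmetric]) simp
  also have "\<dots> = ennreal (\<Sum>k. m k * (c / d))"
    using m w d by (intro suminf_ennreal2 summable_mult2) simp_all
  also have "(\<Sum>k. m k * (c / d)) = c / d * (\<Sum>k. m k)"
    using suminf_mult2[OF m(2), of "c / d"] by (simp add: mult.commute)
  finally show "(\<integral>\<^sup>+\<omega>. (\<Sum>k. ennreal (m k * Z k \<omega>)) \<partial>M) \<le> ennreal (c / d * (\<Sum>k. m k))" .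
qed

section \<open>From coefficient bounds to norms of series\<close>

lemma norm_eigenfun_series_le:
  assumes "\<And>k. (c k)\<^sup>2 \<le> G k" and "(\<Sum>k. ennreal (G k)) \<noteq> \<infinity>"
  shows "ennreal ((norm (\<Sum>k. c k *\<^sub>R eigenfun (Suc k)))\<^sup>2) \<le> (\<Sum>k. ennreal (G k))"
proof -
  have G: "0 \<le> G k" for k
    using order_trans[OF zero_le_power2 assms(1)] .
  \<comment> \<open>Finiteness in \<open>ennreal\<close> becomes real summability, on which the
    convergence of the series in \<open>L2\<close> depends.\<close>
  have sG: "summable G"
    using G assms(2) by (intro summable_suminf_not_top) auto
  have "summable (\<lambda>k. (c k)\<^sup>2)"
    by (rule summable_comparison_test'[OF sG, of 0]) (use assms(1) in simp)
  then show ?thesis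
    using sG G assms(1) by (simp add: norm_eigenfun_series_power2 suminf_ennreal2 suminf_le suminf_nonneg)
qed

text \<open>Every eigenvalue is at least 1, so the weighted bound also makes the plain squares
  summable. The series then has exactly the coefficients \<open>c\<close>, and both left sides
  reduce to the same weighted sum.\<close>

lemma eigenfun_series_dotH_estimates:
  assumes "0 \<le> \<beta>" "\<And>k. eigenval (Suc k) powr (2 * \<beta>) * (c k)\<^sup>2 \<le> G k"
    and "(\<Sum>k. ennreal (G k)) \<noteq> \<infinity>"
  shows "dotH_normsq (2 * \<beta>) (\<Sum>k. c k *\<^sub>R eigenfun (Suc k)) \<le> (\<Sum>k. ennreal (G k))"
    and "ennreal ((norm (frac_laplacian \<beta> (\<Sum>k. c k *\<^sub>R eigenfun (Suc k))))\<^sup>2) \<le> (\<Sum>k. ennreal (G k))"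
proof -
  have le: "(c k)\<^sup>2 \<le> G k" for k
  proof -
    have "1 powr (2 * \<beta>) \<le> eigenval (Suc k) powr (2 * \<beta>)"
      using assms(1) eigenval_ge_1 by (intro powr_mono2) auto
    then have "1 * (c k)\<^sup>2 \<le> eigenval (Suc k) powr (2 * \<beta>) * (c k)\<^sup>2"
      by (intro mult_right_mono) auto
    then show ?thesis
      using assms(2)[of k] by simp
  qed
  have G: "0 \<le> G k" for k
    using order_trans[OF zero_le_power2 le] .
  have "summable G"
    using G assms(3) by (intro summable_suminf_not_top) auto
  then have "summable (\<lambda>k. (c k)\<^sup>2)"
    by (rule summable_comparison_test'[of _ 0]) (use le in simp)
  then have inner: "inner (\<Sum>k. c k *\<^sub>R eigenfun (Suc k)) (eigenfun (Suc j)) = c j" for j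
    by (rule inner_eigenfun_series)
  show "dotH_normsq (2 * \<beta>) (\<Sum>k. c k *\<^sub>R eigenfun (Suc k)) \<le> (\<Sum>k. ennreal (G k))"
    unfolding dotH_normsq_def inner by (intro suminf_le ennreal_leI assms(2)) auto
  have "(eigenval (Suc k) powr \<beta> * c k)\<^sup>2 \<le> G k" for k
    using assms(2)[of k] by (simp add: power_mult_distrib power2_eq_square[of "_ powr _"] powr_add [symmetric])
  then show "ennreal ((norm (frac_laplacian \<beta> (\<Sum>k. c k *\<^sub>R eigenfun (Suc k))))\<^sup>2) \<le> (\<Sum>k. ennreal (G k))"
    unfolding frac_laplacian_def inner using assms(3) by (rule norm_eigenfun_series_le)
qed

lemma norm_uminus_add_power2_le:
  fixes x y :: "'a::real_normed_vector"
  shows "ennreal ((norm (- x + y))\<^sup>2) \<le> 2 * ennreal ((norm x)\<^sup>2) + 2 * ennreal ((norm y)\<^sup>2)"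
proof -
  have "(norm (- x + y))\<^sup>2 \<le> (norm x + norm y)\<^sup>2"
    using norm_triangle_ineq[of "- x" y] by (intro power_mono) auto
  also have "\<dots> \<le> 2 * (norm x)\<^sup>2 + 2 * (norm y)\<^sup>2"
    using zero_le_power2[of "norm x - norm y"] by (simp add: power2_sum power2_diff)
  finally have "ennreal ((norm (- x + y))\<^sup>2) \<le> ennreal (2 * (norm x)\<^sup>2 + 2 * (norm y)\<^sup>2)"
    by (rule ennreal_leI)
  then show ?thesis
    by (simp add: ennreal_mult')
qed

lemma borel_measurable_dotH_normsq:
  assumes "v \<in> L2_rv_dotH M q"
  shows "(\<lambda>\<omega>. dotH_normsq q (v \<omega>)) \<in> borel_measurable M"
  unfolding dotH_normsq_def using borel_measurable_L2_rv_coordinate[OF assms] by measurable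

text \<open>\<open>SG\<close> majorizes the weighted coefficients of the solution and
  \<open>SH\<close> those of the noise. Measurability is carried by these two sums, built from
  coordinates and increments; the solution enters through pointwise comparison on the event where
  both are finite.\<close>

lemma mild_solution_estimates:
  fixes \<alpha> \<beta> T q r t D :: real and M :: "'w measure"
  assumes par: "1 < \<alpha>" "0 < \<beta>" "0 < T" "0 \<le> q" "q \<le> 2 * \<beta>" "0 \<le> r" "r \<le> 2 * \<beta>"
    and D: "0 \<le> D"
    and E: "\<And>b x. b \<in> {1, 2, \<alpha>} \<Longrightarrow> 0 \<le> x \<Longrightarrow> \<bar>mittag_leffler \<alpha> b (- x)\<bar> \<le> D / (1 + x)"
    and M: "prob_space M" and W: "\<And>k. k \<ge> 1 \<Longrightarrow> standard_wiener M F (\<xi> k)"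
    and I: "1 \<le> I"
    and \<sigma>: "\<And>k s. k \<ge> 1 \<Longrightarrow> s \<in> {0..T} \<Longrightarrow> \<bar>\<sigma> k s\<bar> \<le> \<mu> k"
    and v: "v1 \<in> L2_rv_dotH M q" "v2 \<in> L2_rv_dotH M r"
    and sum: "summable (\<lambda>k. eigenval (Suc k) powr (\<beta> * (\<alpha> + 1) / \<alpha>) * (\<mu> (Suc k))\<^sup>2)"
      "summable (\<lambda>k. (\<mu> (Suc k))\<^sup>2)"
    and t: "0 < t" "t \<le> T"
  defines "R \<equiv> ennreal (3 * D\<^sup>2 * t powr (\<alpha> * (q - 2 * \<beta>) / \<beta>)) * (\<integral>\<^sup>+\<omega>. dotH_normsq q (v1 \<omega>) \<partial>M)
      + ennreal (3 * D\<^sup>2 * t powr (2 - \<alpha> * (2 * \<beta> - r) / \<beta>)) * (\<integral>\<^sup>+\<omega>. dotH_normsq r (v2 \<omega>) \<partial>M)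
      + ennreal (3 * D\<^sup>2 * t powr \<alpha> * (t / (T / real I)
          * (\<Sum>k. eigenval (Suc k) powr (\<beta> * (\<alpha> + 1) / \<alpha>) * (\<mu> (Suc k))\<^sup>2)))"
  shows "(\<integral>\<^sup>+\<omega>. dotH_normsq (2 * \<beta>) (mild_solution \<alpha> \<beta> T I \<sigma> \<xi> v1 v2 t \<omega>) \<partial>M) \<le> R"
    and "(\<integral>\<^sup>+\<omega>. ennreal ((norm (caputo_mild_solution \<alpha> \<beta> T I \<sigma> \<xi> v1 v2 t \<omega>))\<^sup>2) \<partial>M)
      \<le> 2 * R + 2 * ennreal (1 / (T / real I) * (\<Sum>k. (\<mu> (Suc k))\<^sup>2))"
proof -
  define d where "d = T / real I"
  define p where "p k = eigenval (Suc k) powr (\<beta> * (\<alpha> + 1) / \<alpha>) * (\<mu> (Suc k))\<^sup>2" for k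
  define x1 where "x1 k \<omega> = eigenval (Suc k) powr q * (inner (v1 \<omega>) (eigenfun (Suc k)))\<^sup>2" for k \<omega>
  define x2 where "x2 k \<omega> = eigenval (Suc k) powr r * (inner (v2 \<omega>) (eigenfun (Suc k)))\<^sup>2" for k \<omega>
  define Z where "Z k \<omega> = (\<Sum>i=1..I. cell_length d t i * ((normalised_increment \<xi> d (Suc k) i \<omega>)\<^sup>2 / d))" for k \<omega>
  define Y where "Y k \<omega> = (\<Sum>i=1..I. indicator (cell d i) t * ((normalised_increment \<xi> d (Suc k) i \<omega>)\<^sup>2 / d))" for k \<omega>
  define a1 a2 a3 where "a1 = 3 * D\<^sup>2 * t powr (\<alpha> * (q - 2 * \<beta>) / \<beta>)"
    and "a2 = 3 * D\<^sup>2 * t powr (2 - \<alpha> * (2 * \<beta> - r) / \<beta>)" and "a3 = 3 * D\<^sup>2 * t powr \<alpha>"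
  define G where "G k \<omega> = a1 * x1 k \<omega> + a2 * x2 k \<omega> + a3 * (p k * Z k \<omega>)" for k \<omega>
  define H where "H k \<omega> = (\<mu> (Suc k))\<^sup>2 * Y k \<omega>" for k \<omega>
  define c where "c k \<omega> = mild_coeff \<alpha> \<beta> T I \<sigma> \<xi> v1 v2 (Suc k) t \<omega>" for k \<omega>
  define SG SH where "SG \<omega> = (\<Sum>k. ennreal (G k \<omega>))" and "SH \<omega> = (\<Sum>k. ennreal (H k \<omega>))" for \<omega>
  have d: "0 < d"
    using par I by (simp add: d_def)
  have nn: "0 \<le> a1" "0 \<le> a2" "0 \<le> a3" "0 \<le> x1 k \<omega>" "0 \<le> x2 k \<omega>" "0 \<le> p k" for k \<omega>
    by (simp_all add: a1_def a2_def a3_def x1_def x2_def p_def)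
  have nZ: "0 \<le> Z k \<omega>" for k \<omega>
    unfolding Z_def using d by (intro sum_nonneg mult_nonneg_nonneg cell_length_nonneg) auto
  have cG: "eigenval (Suc k) powr (2 * \<beta>) * (c k \<omega>)\<^sup>2 \<le> G k \<omega>" for k \<omega>
    unfolding c_def G_def a1_def a2_def a3_def x1_def x2_def p_def Z_def d_def
    by (rule mild_coeff_power2_le[OF par I t D E]) (auto intro: \<sigma>)
  have noiseH: "(\<sigma> (Suc k) t * step_noise \<xi> d I (Suc k) t \<omega>)\<^sup>2 \<le> H k \<omega>" for k \<omega>
  proof -
    have "\<bar>\<sigma> (Suc k) t\<bar> \<le> \<mu> (Suc k)"
      using t by (intro \<sigma>) auto
    then have "(\<sigma> (Suc k) t)\<^sup>2 \<le> (\<mu> (Suc k))\<^sup>2"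
      using power_mono[of "\<bar>\<sigma> (Suc k) t\<bar>" "\<mu> (Suc k)" 2] by simp
    then show ?thesis
      unfolding H_def Y_def power_mult_distrib using step_noise_power2_le[OF d]
      by (intro mult_mono) auto
  qed
  have t0: "0 \<le> t"
    using t by simp
  have sp: "summable p"
    unfolding p_def [abs_def] by (rule sum(1))
  note nsG = nn_integral_noise_sum_le[where \<xi> = \<xi> and m = p and w = "cell_length d t" and n = I and c = t,
      OF M W d cell_length_nonneg sum_cell_length_le[OF d t0] t0 nn(6) sp]
  have mZ: "(\<lambda>\<omega>. \<Sum>k. ennreal (p k * Z k \<omega>)) \<in> borel_measurable M"
    unfolding Z_def by (rule nsG(1))
  have iZ: "(\<integral>\<^sup>+\<omega>. (\<Sum>k. ennreal (p k * Z k \<omega>)) \<partial>M) \<le> ennreal (t / d * (\<Sum>k. p k))"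
    unfolding Z_def by (rule nsG(2))
  note nsH = nn_integral_noise_sum_le[where \<xi> = \<xi> and m = "\<lambda>k. (\<mu> (Suc k))\<^sup>2"
      and w = "\<lambda>i. indicator (cell d i) t" and n = I and c = 1,
      OF M W d indicator_pos_le sum_indicator_cell_le_1[OF d] zero_le_one zero_le_power2 sum(2)]
  have mSH: "SH \<in> borel_measurable M"
    unfolding SH_def [abs_def] H_def Y_def by (rule nsH(1))
  have iSH: "(\<integral>\<^sup>+\<omega>. SH \<omega> \<partial>M) \<le> ennreal (1 / d * (\<Sum>k. (\<mu> (Suc k))\<^sup>2))"
    unfolding SH_def [abs_def] H_def Y_def by (rule nsH(2))
  note mv = borel_measurable_dotH_normsq[OF v(1)] borel_measurable_dotH_normsq[OF v(2)]
  have SG: "SG \<omega> = ennreal a1 * dotH_normsq q (v1 \<omega>) + ennreal a2 * dotH_normsq r (v2 \<omega>)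
      + ennreal a3 * (\<Sum>k. ennreal (p k * Z k \<omega>))" for \<omega>
  proof -
    have "ennreal (G k \<omega>) = ennreal a1 * ennreal (x1 k \<omega>) + ennreal a2 * ennreal (x2 k \<omega>)
        + ennreal a3 * ennreal (p k * Z k \<omega>)" for k
      unfolding G_def ennreal_mult'[OF nn(1), symmetric] ennreal_mult'[OF nn(2), symmetric]
        ennreal_mult'[OF nn(3), symmetric]
      using nn nZ by (simp only: ennreal_plus mult_nonneg_nonneg add_nonneg_nonneg)
    then have "SG \<omega> = (\<Sum>k. ennreal a1 * ennreal (x1 k \<omega>)) + (\<Sum>k. ennreal a2 * ennreal (x2 k \<omega>))
        + (\<Sum>k. ennreal a3 * ennreal (p k * Z k \<omega>))"
      unfolding SG_def by (simp only: suminf_add[OF summableI summableI])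
    then show ?thesis
      unfolding ennreal_suminf_cmult dotH_normsq_def x1_def x2_def .
  qed
  have mSG: "SG \<in> borel_measurable M"
    unfolding SG [abs_def] using mv mZ by measurable
  have "(\<integral>\<^sup>+\<omega>. SG \<omega> \<partial>M) = ennreal a1 * (\<integral>\<^sup>+\<omega>. dotH_normsq q (v1 \<omega>) \<partial>M)
      + ennreal a2 * (\<integral>\<^sup>+\<omega>. dotH_normsq r (v2 \<omega>) \<partial>M)
      + ennreal a3 * (\<integral>\<^sup>+\<omega>. (\<Sum>k. ennreal (p k * Z k \<omega>)) \<partial>M)"
    unfolding SG using mv mZ by (simp add: nn_integral_add nn_integral_cmult)
  also have "\<dots> \<le> ennreal a1 * (\<integral>\<^sup>+\<omega>. dotH_normsq q (v1 \<omega>) \<partial>M)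
      + ennreal a2 * (\<integral>\<^sup>+\<omega>. dotH_normsq r (v2 \<omega>) \<partial>M) + ennreal a3 * ennreal (t / d * (\<Sum>k. p k))"
    by (intro add_left_mono mult_left_mono iZ) simp
  also have "\<dots> = R"
    unfolding R_def a1_def [symmetric] a2_def [symmetric] a3_def [symmetric] p_def [symmetric] d_def [symmetric]
    by (simp only: ennreal_mult'[OF nn(3)])
  finally have iSG: "(\<integral>\<^sup>+\<omega>. SG \<omega> \<partial>M) \<le> R" .
  have "R < \<infinity>"
    using v by (auto simp: R_def L2_rv_dotH_def ennreal_mult_less_top)
  with iSG have "AE \<omega> in M. SG \<omega> \<noteq> \<infinity>"
    using mSG by (intro nn_integral_noteq_infinite) auto
  moreover have "AE \<omega> in M. SH \<omega> \<noteq> \<infinity>"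
    using mSH le_less_trans[OF iSH ennreal_less_top] by (intro nn_integral_noteq_infinite) auto
  ultimately have *: "AE \<omega> in M. dotH_normsq (2 * \<beta>) (mild_solution \<alpha> \<beta> T I \<sigma> \<xi> v1 v2 t \<omega>) \<le> SG \<omega>
      \<and> ennreal ((norm (caputo_mild_solution \<alpha> \<beta> T I \<sigma> \<xi> v1 v2 t \<omega>))\<^sup>2) \<le> 2 * SG \<omega> + 2 * SH \<omega>"
  proof eventually_elim
    case (elim \<omega>)
    have ms: "mild_solution \<alpha> \<beta> T I \<sigma> \<xi> v1 v2 t \<omega> = (\<Sum>k. c k \<omega> *\<^sub>R eigenfun (Suc k))"
      by (simp add: mild_solution_def c_def)
    have "0 \<le> \<beta>"
      using par by simp
    note est = eigenfun_series_dotH_estimates[OF this cG elim(1)[unfolded SG_def], folded SG_def ms]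
    have "ennreal ((norm (noise T I \<sigma> \<xi> t \<omega>))\<^sup>2) \<le> SH \<omega>"
      unfolding noise_def SH_def d_def [symmetric]
      by (rule norm_eigenfun_series_le[OF noiseH elim(2)[unfolded SH_def]])
    then have "2 * ennreal ((norm (frac_laplacian \<beta> (mild_solution \<alpha> \<beta> T I \<sigma> \<xi> v1 v2 t \<omega>)))\<^sup>2)
        + 2 * ennreal ((norm (noise T I \<sigma> \<xi> t \<omega>))\<^sup>2) \<le> 2 * SG \<omega> + 2 * SH \<omega>"
      using est(2) by (intro add_mono mult_left_mono) auto
    then have "ennreal ((norm (caputo_mild_solution \<alpha> \<beta> T I \<sigma> \<xi> v1 v2 t \<omega>))\<^sup>2) \<le> 2 * SG \<omega> + 2 * SH \<omega>"
      unfolding caputo_mild_solution_def by (rule order_trans[OF norm_uminus_add_power2_le])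
    with est(1) show ?case
      by simp
  qed
  show "(\<integral>\<^sup>+\<omega>. dotH_normsq (2 * \<beta>) (mild_solution \<alpha> \<beta> T I \<sigma> \<xi> v1 v2 t \<omega>) \<partial>M) \<le> R"
    by (rule order_trans[OF nn_integral_mono_AE iSG]) (use * in auto)
  have "(\<integral>\<^sup>+\<omega>. ennreal ((norm (caputo_mild_solution \<alpha> \<beta> T I \<sigma> \<xi> v1 v2 t \<omega>))\<^sup>2) \<partial>M)
      \<le> (\<integral>\<^sup>+\<omega>. (2 * SG \<omega> + 2 * SH \<omega>) \<partial>M)"
    by (rule nn_integral_mono_AE) (use * in auto)
  also have "\<dots> = 2 * (\<integral>\<^sup>+\<omega>. SG \<omega> \<partial>M) + 2 * (\<integral>\<^sup>+\<omega>. SH \<omega> \<partial>M)"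
    using mSG mSH by (simp add: nn_integral_add nn_integral_cmult)
  also have "\<dots> \<le> 2 * R + 2 * ennreal (1 / d * (\<Sum>k. (\<mu> (Suc k))\<^sup>2))"
    by (intro add_mono mult_left_mono iSG iSH) auto
  finally show "(\<integral>\<^sup>+\<omega>. ennreal ((norm (caputo_mild_solution \<alpha> \<beta> T I \<sigma> \<xi> v1 v2 t \<omega>))\<^sup>2) \<partial>M)
      \<le> 2 * R + 2 * ennreal (1 / (T / real I) * (\<Sum>k. (\<mu> (Suc k))\<^sup>2))"
    by (simp only: d_def)
qed

section \<open>Assembly with a single constant\<close>

theorem theorem3p6:
  fixes \<alpha> \<beta> T q r :: real
  assumes "1 < \<alpha>" "\<alpha> < 2" "1 / 2 < \<beta>" "\<beta> \<le> 1" "0 < T"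
    and "0 \<le> q" "q \<le> 2 * \<beta>" "0 \<le> r" "r \<le> 2 * \<beta>"
  shows "\<exists>C::real>0. \<forall>(M :: 'w measure) (F :: real \<Rightarrow> 'w measure) (\<xi> :: nat \<Rightarrow> real \<Rightarrow> 'w \<Rightarrow> real)
      (I :: nat) (\<Delta>t :: real) (\<sigma> :: nat \<Rightarrow> real \<Rightarrow> real) (\<mu> :: nat \<Rightarrow> real) (v1 :: 'w \<Rightarrow> L2) (v2 :: 'w \<Rightarrow> L2).
      complete_filtered_prob_space M F \<longrightarrow>
      (\<forall>k\<ge>1. standard_wiener M F (\<xi> k)) \<longrightarrow>
      1 \<le> I \<longrightarrow> \<Delta>t = T / real I \<longrightarrow>
      (\<forall>k\<ge>1. continuous_on {0..T} (\<sigma> k)) \<longrightarrow>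
      (\<forall>k\<ge>1. \<forall>t\<in>{0..T}. \<bar>\<sigma> k t\<bar> \<le> \<mu> k) \<longrightarrow>
      v1 \<in> L2_rv_dotH M q \<longrightarrow> v2 \<in> L2_rv_dotH M r \<longrightarrow>
      summable (\<lambda>k. eigenval (Suc k) powr (\<beta> * (\<alpha> + 1) / \<alpha>) * (\<mu> (Suc k))\<^sup>2) \<longrightarrow>
      summable (\<lambda>k. (\<mu> (Suc k))\<^sup>2) \<longrightarrow>
      (\<forall>t\<in>{0<..T}.
        (\<integral>\<^sup>+\<omega>. dotH_normsq (2 * \<beta>) (mild_solution \<alpha> \<beta> T I \<sigma> \<xi> v1 v2 t \<omega>) \<partial>M)
          \<le> ennreal (C * t powr (\<alpha> * (q - 2 * \<beta>) / \<beta>)) * (\<integral>\<^sup>+\<omega>. dotH_normsq q (v1 \<omega>) \<partial>M)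
            + ennreal (C * t powr (2 - \<alpha> * (2 * \<beta> - r) / \<beta>)) * (\<integral>\<^sup>+\<omega>. dotH_normsq r (v2 \<omega>) \<partial>M)
            + ennreal (C * t powr \<alpha> * (1 / \<Delta>t)
                * (\<Sum>k. eigenval (Suc k) powr (\<beta> * (\<alpha> + 1) / \<alpha>) * (\<mu> (Suc k))\<^sup>2))
        \<and>
        (\<integral>\<^sup>+\<omega>. ennreal ((norm (caputo_mild_solution \<alpha> \<beta> T I \<sigma> \<xi> v1 v2 t \<omega>))\<^sup>2) \<partial>M)
          \<le> ennreal (C * t powr (\<alpha> * (q - 2 * \<beta>) / \<beta>)) * (\<integral>\<^sup>+\<omega>. dotH_normsq q (v1 \<omega>) \<partial>M)
            + ennreal (C * t powr (2 - \<alpha> * (2 * \<beta> - r) / \<beta>)) * (\<integral>\<^sup>+\<omega>. dotH_normsq r (v2 \<omega>) \<partial>M)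
            + ennreal (C * t powr \<alpha> * (1 / \<Delta>t)
                * (\<Sum>k. eigenval (Suc k) powr (\<beta> * (\<alpha> + 1) / \<alpha>) * (\<mu> (Suc k))\<^sup>2))
            + ennreal (C * (1 / \<Delta>t) * (\<Sum>k. (\<mu> (Suc k))\<^sup>2)))"
proof -
  have "\<exists>D>0. \<forall>x\<ge>0. \<bar>mittag_leffler \<alpha> b (- x)\<bar> \<le> D / (1 + x)" if "b \<in> {1, 2, \<alpha>}" for b
    using assms that by (intro mittag_leffler_bound) auto
  then obtain D' where D': "\<And>b x. b \<in> {1, 2, \<alpha>} \<Longrightarrow> 0 \<le> x \<Longrightarrow> \<bar>mittag_leffler \<alpha> b (- x)\<bar> \<le> D' b / (1 + x)"
    and pos: "\<And>b. b \<in> {1, 2, \<alpha>} \<Longrightarrow> 0 < D' b"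
    by metis
  \<comment> \<open>One constant for the three Mittag-Leffler functions in the mild solution; their
    positivity makes the sum dominate each.\<close>
  define D where "D = D' 1 + D' 2 + D' \<alpha>"
  have D: "0 \<le> D" "\<And>b. b \<in> {1, 2, \<alpha>} \<Longrightarrow> D' b \<le> D"
    using pos[of 1] pos[of 2] pos[of \<alpha>] by (auto simp: D_def)
  have E: "\<bar>mittag_leffler \<alpha> b (- x)\<bar> \<le> D / (1 + x)" if "b \<in> {1, 2, \<alpha>}" "0 \<le> x" for b x
    using D'[OF that] divide_right_mono[OF D(2)[OF that(1)], of "1 + x"] that(2) by linarith
  \<comment> \<open>The 6 is 3 for the parts of a coefficient times 2 for the two parts of the
    Caputo derivative. The factor \<open>1 + T\<close> covers terms without and with the surplus
    \<open>t\<close>; the final 2 serves the pure noise term and positivity.\<close>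
  define C where "C = 6 * D\<^sup>2 * (1 + T) + 2"
  have C: "0 < C" "6 * D\<^sup>2 \<le> C" "6 * D\<^sup>2 * T \<le> C" "2 \<le> C" "0 \<le> 6 * D\<^sup>2"
    using assms(5) by (auto simp: C_def distrib_left intro!: add_nonneg_pos add_nonneg_nonneg)
  show ?thesis
  proof (rule exI[of _ C], intro conjI allI impI ballI)
    show "0 < C"
      by (rule C)
    fix M :: "'w measure" and F :: "real \<Rightarrow> 'w measure" and \<xi> :: "nat \<Rightarrow> real \<Rightarrow> 'w \<Rightarrow> real" and I :: nat
      and \<Delta>t :: real and \<sigma> :: "nat \<Rightarrow> real \<Rightarrow> real" and \<mu> :: "nat \<Rightarrow> real" and v1 v2 :: "'w \<Rightarrow> L2" and t :: real
    assume M: "complete_filtered_prob_space M F" and W: "\<forall>k\<ge>1. standard_wiener M F (\<xi> k)"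
      and I: "1 \<le> I" and dt: "\<Delta>t = T / real I"
      and \<sigma>: "\<forall>k\<ge>1. \<forall>t\<in>{0..T}. \<bar>\<sigma> k t\<bar> \<le> \<mu> k"
      and v: "v1 \<in> L2_rv_dotH M q" "v2 \<in> L2_rv_dotH M r"
      and sum: "summable (\<lambda>k. eigenval (Suc k) powr (\<beta> * (\<alpha> + 1) / \<alpha>) * (\<mu> (Suc k))\<^sup>2)"
        "summable (\<lambda>k. (\<mu> (Suc k))\<^sup>2)"
      and t: "t \<in> {0<..T}"
    define S1 S2 where "S1 = (\<Sum>k. eigenval (Suc k) powr (\<beta> * (\<alpha> + 1) / \<alpha>) * (\<mu> (Suc k))\<^sup>2)"
      and "S2 = (\<Sum>k. (\<mu> (Suc k))\<^sup>2)"
    define X1 X2 where "X1 = (\<integral>\<^sup>+\<omega>. dotH_normsq q (v1 \<omega>) \<partial>M)" and "X2 = (\<integral>\<^sup>+\<omega>. dotH_normsq r (v2 \<omega>) \<partial>M)"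
    define e1 e2 where "e1 = t powr (\<alpha> * (q - 2 * \<beta>) / \<beta>)" and "e2 = t powr (2 - \<alpha> * (2 * \<beta> - r) / \<beta>)"
    define R where "R = ennreal (3 * D\<^sup>2 * e1) * X1 + ennreal (3 * D\<^sup>2 * e2) * X2
      + ennreal (3 * D\<^sup>2 * t powr \<alpha> * (t / \<Delta>t * S1))"
    have "prob_space M" "0 < \<beta>" "0 < t" "t \<le> T" and pdt: "0 < \<Delta>t"
      using M assms t I by (auto simp: complete_filtered_prob_space_def dt)
    note est = mild_solution_estimates[OF assms(1) \<open>0 < \<beta>\<close> assms(5-9) D(1) E \<open>prob_space M\<close>
        W[rule_format] I \<sigma>[rule_format] v sum \<open>0 < t\<close> \<open>t \<le> T\<close>,
        folded S1_def S2_def X1_def X2_def e1_def e2_def dt, folded R_def]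
    have S: "0 \<le> S1" "0 \<le> S2"
      using sum by (auto simp: S1_def S2_def intro!: suminf_nonneg)
    have e: "0 \<le> e1" "0 \<le> e2"
      by (simp_all add: e1_def e2_def)
    define B where "B = ennreal (C * e1) * X1 + ennreal (C * e2) * X2 + ennreal (C * t powr \<alpha> * (1 / \<Delta>t) * S1)"
    \<comment> \<open>The doubled bound is the one for the Caputo derivative; the first estimate
      follows from it because \<open>R \<le> 2 * R\<close>.\<close>
    have "2 * R \<le> B"
    proof -
      have dbl: "2 * ennreal (3 * D\<^sup>2 * y) = ennreal (6 * D\<^sup>2 * y)" if "0 \<le> y" for y
        using ennreal_mult'[of 2 "3 * D\<^sup>2 * y"] by (simp add: mult.assoc)
      have pn: "0 \<le> t powr \<alpha> * (t / \<Delta>t * S1)"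
        using S pdt \<open>0 < t\<close> by simp
      have "2 * R = 2 * ennreal (3 * D\<^sup>2 * e1) * X1 + 2 * ennreal (3 * D\<^sup>2 * e2) * X2
          + 2 * ennreal (3 * D\<^sup>2 * (t powr \<alpha> * (t / \<Delta>t * S1)))"
        unfolding R_def by (simp only: distrib_left mult.assoc)
      also have "\<dots> = ennreal (6 * D\<^sup>2 * e1) * X1 + ennreal (6 * D\<^sup>2 * e2) * X2
          + ennreal (6 * D\<^sup>2 * (t powr \<alpha> * (t / \<Delta>t * S1)))"
        by (simp only: dbl[OF e(1)] dbl[OF e(2)] dbl[OF pn])
      also have "\<dots> \<le> B"
        unfolding B_def
      proof (intro add_mono mult_right_mono[OF ennreal_leI] ennreal_leI)
        show "6 * D\<^sup>2 * e1 \<le> C * e1" "6 * D\<^sup>2 * e2 \<le> C * e2"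
          using C(2) e by (auto intro: mult_right_mono)
        \<comment> \<open>Here the surplus factor \<open>t\<close> is absorbed through
          \<open>t \<le> T\<close>.\<close>
        have "6 * D\<^sup>2 * t \<le> C"
          using mult_left_mono[OF \<open>t \<le> T\<close> C(5)] C(3) by linarith
        then have "(6 * D\<^sup>2 * t) * (t powr \<alpha> * (1 / \<Delta>t) * S1) \<le> C * (t powr \<alpha> * (1 / \<Delta>t) * S1)"
          using S pdt by (intro mult_right_mono) auto
        then show "6 * D\<^sup>2 * (t powr \<alpha> * (t / \<Delta>t * S1)) \<le> C * t powr \<alpha> * (1 / \<Delta>t) * S1"
          by (simp add: mult_ac)
      qed auto
      finally show ?thesis .
    qed
    moreover have "R \<le> 2 * R"
      by (simp add: mult_2)
    ultimately have "R \<le> B"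
      by simp
    with est(1) show "(\<integral>\<^sup>+\<omega>. dotH_normsq (2 * \<beta>) (mild_solution \<alpha> \<beta> T I \<sigma> \<xi> v1 v2 t \<omega>) \<partial>M)
          \<le> ennreal (C * t powr (\<alpha> * (q - 2 * \<beta>) / \<beta>)) * (\<integral>\<^sup>+\<omega>. dotH_normsq q (v1 \<omega>) \<partial>M)
            + ennreal (C * t powr (2 - \<alpha> * (2 * \<beta> - r) / \<beta>)) * (\<integral>\<^sup>+\<omega>. dotH_normsq r (v2 \<omega>) \<partial>M)
            + ennreal (C * t powr \<alpha> * (1 / \<Delta>t)
                * (\<Sum>k. eigenval (Suc k) powr (\<beta> * (\<alpha> + 1) / \<alpha>) * (\<mu> (Suc k))\<^sup>2))"
      unfolding B_def S1_def X1_def X2_def e1_def e2_def by (rule order_trans)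
    have "2 * ennreal (1 / \<Delta>t * S2) = ennreal (2 * (1 / \<Delta>t * S2))"
      using ennreal_mult'[of 2 "1 / \<Delta>t * S2"] by simp
    also have "\<dots> \<le> ennreal (C * (1 / \<Delta>t * S2))"
      using C(4) S pdt by (intro ennreal_leI mult_right_mono) auto
    finally have "2 * ennreal (1 / \<Delta>t * S2) \<le> ennreal (C * (1 / \<Delta>t) * S2)"
      by (simp only: mult.assoc)
    with \<open>2 * R \<le> B\<close> have "2 * R + 2 * ennreal (1 / \<Delta>t * S2) \<le> B + ennreal (C * (1 / \<Delta>t) * S2)"
      by (rule add_mono)
    with est(2) show "(\<integral>\<^sup>+\<omega>. ennreal ((norm (caputo_mild_solution \<alpha> \<beta> T I \<sigma> \<xi> v1 v2 t \<omega>))\<^sup>2) \<partial>M)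
          \<le> ennreal (C * t powr (\<alpha> * (q - 2 * \<beta>) / \<beta>)) * (\<integral>\<^sup>+\<omega>. dotH_normsq q (v1 \<omega>) \<partial>M)
            + ennreal (C * t powr (2 - \<alpha> * (2 * \<beta> - r) / \<beta>)) * (\<integral>\<^sup>+\<omega>. dotH_normsq r (v2 \<omega>) \<partial>M)
            + ennreal (C * t powr \<alpha> * (1 / \<Delta>t)
                * (\<Sum>k. eigenval (Suc k) powr (\<beta> * (\<alpha> + 1) / \<alpha>) * (\<mu> (Suc k))\<^sup>2))
            + ennreal (C * (1 / \<Delta>t) * (\<Sum>k. (\<mu> (Suc k))\<^sup>2))"
      unfolding B_def S1_def S2_def X1_def X2_def e1_def e2_def by (rule order_trans)
  qed
qed

end
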